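(* Let $q$ be a prime power and let $\mathcal C,\Pi_i,\Pi_e,\mathcal N$ be the sets of planes of ${\rm PG}(5,q)$ defined below. Then $\mathcal C\cup\Pi_i\cup\Pi_e\cup\mathcal N$ consists of $q^3(q^2-1)(q-1)/3+(q^2+1)(q^2+q+1)$ planes, any two of which intersect in at most one point.
   Context: A quadric of ${\rm PG}(2,q)$ is the zero locus of a nonzero quadratic form $a_{11}X_1^2+a_{22}X_2^2+a_{33}X_3^2+a_{12}X_1X_2+a_{13}X_1X_3+a_{23}X_2X_3$ over ${\rm GF}(q)$; the Veronese map $v$ sends it to the point $(a_{11},a_{22},a_{33},a_{12},a_{13},a_{23})$ of ${\rm PG}(5,q)$. Degenerate quadrics are: repeated lines; bi-lines (two distinct lines of ${\rm PG}(2,q)$); imaginary bi-lines (two distinct lines of ${\rm PG}(2,q^2)$ conjugate under $x\mapsto x^q$); a (imaginary) bi-line is centered at the intersection of its two lines. Non-degenerate quadrics are conics. Let $G={\rm PGL}(3,q)$, let $S$ be a Singer cyclic subgroup of $G$ (cyclic of order $q^2+q+1$, regular on points of ${\rm PG}(2,q)$), which fixes a unique triangle of ${\rm PG}(2,q^3)$, and let $\mathcal B$ be the circumscribed bundle left invariant by $S$: the set of conics of ${\rm PG}(2,q)$ whose extension to ${\rm PG}(2,q^3)$ contains the three vertices of that triangle. Definitions: (i) $\mathcal C=\{v(\mathcal B'):\mathcal B'\in\mathcal B^G\}$, where $\mathcal B^G$ is the orbit of $\mathcal B$ under $G$; each $v(\mathcal B')$ is a plane. (ii) $\mathcal N=\{\pi_A: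 A\in{\rm PG}(2,q)\}$, where $\pi_A$ is the plane formed by the images under $v$ of the repeated lines through $A$ and of the bi-lines and imaginary bi-lines centered at $A$. (iii) $\Pi_e$ is the set of planes spanned by $\{v(\beta):\beta\in b,\ \beta\text{ centered at a point of }C\}$, for $b$ an $S$-orbit on bi-lines and $C\in\mathcal B$. (iv) $\Pi_i$ is the set of planes spanned by $\{v(\beta):\beta\in b',\ \beta\text{ centered at a point of }C\}$, for $b'$ an $S$-orbit on imaginary bi-lines and $C\in\mathcal B$. *)

theory Defs
  imports
    "HOL-Analysis.Analysis"
    "HOL-Algebra.Elementary_Groups"
    "HOL-Algebra.Algebraic_Closure_Type"
begin

no_notation fps_nth (infixl \<open>$\<close> 75)

text \<open>
  The field GF(q) is a type of class \<open>finite_field\<close>, with q its cardinality. Its extension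
  GF(q^m) is the subfield of all x with x^(q^m) = x of the algebraic closure, so PG(2,q^m) is
  regarded as a subgeometry of the projective plane over the algebraic closure.
\<close>

section \<open>Projective geometry\<close>

definition proj_points :: "('k::field ^ 'n) set set" where
  "proj_points = {vec.span {x} |x. x \<noteq> 0}"

text \<open>Planes (like lines below) are sets of points.\<close>

definition subspace_points :: "('k::field ^ 'n) set \<Rightarrow> ('k ^ 'n) set set" where
  "subspace_points U = {P \<in> proj_points. P \<subseteq> U}"

definition is_plane :: "('k::field ^ 'n) set set \<Rightarrow> bool" where
  "is_plane \<pi> \<longleftrightarrow> (\<exists>U. vec.subspace U \<and> vec.dim U = 3 \<and> \<pi> = subspace_points U)"

definition proj_span :: "('k::field ^ 'n) set set \<Rightarrow> ('k ^ 'n) set set" where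
  "proj_span \<A> = subspace_points (vec.span (\<Union>\<A>))"

definition line :: "'k::field ^ 3 \<Rightarrow> ('k ^ 3) set set" where
  "line l = {P \<in> proj_points. \<forall>x\<in>P. scalar_product l x = 0}"

section \<open>Field extensions\<close>

definition ext_vec :: "'a::field ^ 'n \<Rightarrow> 'a alg_closure ^ 'n" where
  "ext_vec x = (\<chi> i. to_ac (x $ i))"

definition ext_point :: "('a::field ^ 'n) set \<Rightarrow> ('a alg_closure ^ 'n) set" where
  "ext_point P = vec.span (ext_vec ` P)"

definition over_GF :: "nat \<Rightarrow> 'a::finite_field alg_closure ^ 'n \<Rightarrow> bool" where
  "over_GF m x \<longleftrightarrow> (\<forall>i. (x $ i) ^ (CARD('a) ^ m) = x $ i)"

definition GF_points :: "nat \<Rightarrow> ('a::finite_field alg_closure ^ 'n) set set" where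
  "GF_points m = {vec.span {x} |x. x \<noteq> 0 \<and> over_GF m x}"

definition frob_vec :: "'a::finite_field alg_closure ^ 'n \<Rightarrow> 'a alg_closure ^ 'n" where
  "frob_vec x = (\<chi> i. (x $ i) ^ CARD('a))"

section \<open>Quadrics\<close>

text \<open>
  A quadratic form is given by its coefficient vector
  (a11, a22, a33, a12, a13, a23).
\<close>

definition qeval :: "'k::field ^ 6 \<Rightarrow> 'k ^ 3 \<Rightarrow> 'k" where
  "qeval a x = a$1 * (x$1)^2 + a$2 * (x$2)^2 + a$3 * (x$3)^2
     + a$4 * x$1 * x$2 + a$5 * x$1 * x$3 + a$6 * x$2 * x$3"

text \<open>
  The zero locus over GF(q) does not determine the form up to a scalar (an imaginary bi-line has
  a single point), so a quadric is the class of nonzero multiples of a nonzero form.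
\<close>

definition quadric :: "'k::field ^ 6 \<Rightarrow> ('k ^ 6) set" where
  "quadric a = {c *s a |c. c \<noteq> 0}"

definition quadrics :: "('k::field ^ 6) set set" where
  "quadrics = {quadric a |a. a \<noteq> 0}"

definition zero_locus :: "('k::field ^ 6) set \<Rightarrow> ('k ^ 3) set set" where
  "zero_locus Q = {P \<in> proj_points. \<forall>a\<in>Q. \<forall>x\<in>P. qeval a x = 0}"

definition veronese :: "('k::field ^ 6) set \<Rightarrow> ('k ^ 6) set" where
  "veronese Q = vec.span Q"

definition ext_quadric :: "('a::field ^ 6) set \<Rightarrow> ('a alg_closure ^ 6) set" where
  "ext_quadric Q = (\<Union>a\<in>Q. quadric (ext_vec a))"

definition lin_mult :: "'k::field ^ 3 \<Rightarrow> 'k ^ 3 \<Rightarrow> 'k ^ 6" where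
  "lin_mult l m = vector [l$1 * m$1, l$2 * m$2, l$3 * m$3,
     l$1 * m$2 + l$2 * m$1, l$1 * m$3 + l$3 * m$1, l$2 * m$3 + l$3 * m$2]"

definition repeated_line_through :: "('a::finite_field ^ 3) set \<Rightarrow> ('a ^ 6) set \<Rightarrow> bool" where
  "repeated_line_through A Q \<longleftrightarrow> (\<exists>l. l \<noteq> 0 \<and> Q = quadric (lin_mult l l) \<and> A \<in> line l)"

definition biline_centered :: "('a::finite_field ^ 3) set \<Rightarrow> ('a ^ 6) set \<Rightarrow> bool" where
  "biline_centered A Q \<longleftrightarrow> (\<exists>l m. l \<noteq> 0 \<and> m \<noteq> 0 \<and> line l \<noteq> line m \<and>
     Q = quadric (lin_mult l m) \<and> line l \<inter> line m = {A})"

definition imag_biline_centered :: "('a::finite_field ^ 3) set \<Rightarrow> ('a ^ 6) set \<Rightarrow> bool" where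
  "imag_biline_centered A Q \<longleftrightarrow> Q \<in> quadrics \<and> A \<in> proj_points \<and>
     (\<exists>l. l \<noteq> 0 \<and> over_GF 2 l \<and> line l \<noteq> line (frob_vec l) \<and>
       ext_quadric Q = quadric (lin_mult l (frob_vec l)) \<and>
       line l \<inter> line (frob_vec l) = {ext_point A})"

definition repeated_line :: "('a::finite_field ^ 6) set \<Rightarrow> bool" where
  "repeated_line Q \<longleftrightarrow> (\<exists>l. l \<noteq> 0 \<and> Q = quadric (lin_mult l l))"

definition biline :: "('a::finite_field ^ 6) set \<Rightarrow> bool" where
  "biline Q \<longleftrightarrow> (\<exists>l m. l \<noteq> 0 \<and> m \<noteq> 0 \<and> line l \<noteq> line m \<and> Q = quadric (lin_mult l m))"

definition imag_biline :: "('a::finite_field ^ 6) set \<Rightarrow> bool" where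
  "imag_biline Q \<longleftrightarrow> Q \<in> quadrics \<and>
     (\<exists>l. l \<noteq> 0 \<and> over_GF 2 l \<and> line l \<noteq> line (frob_vec l) \<and>
       ext_quadric Q = quadric (lin_mult l (frob_vec l)))"

definition conic :: "('a::finite_field ^ 6) set \<Rightarrow> bool" where
  "conic Q \<longleftrightarrow> Q \<in> quadrics \<and> \<not> repeated_line Q \<and> \<not> biline Q \<and> \<not> imag_biline Q"

section \<open>The group PGL(3,q) and its actions\<close>

definition GL3 :: "('a::field ^ 3 ^ 3) monoid" where
  "GL3 = \<lparr>carrier = {M. invertible M}, monoid.mult = (**), one = mat 1\<rparr>"

definition scalars3 :: "('a::field ^ 3 ^ 3) set" where
  "scalars3 = {mat c |c. c \<noteq> 0}"

definition PGL3 :: "('a::field ^ 3 ^ 3) set monoid" where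
  "PGL3 = GL3 Mod scalars3"

text \<open>
  An element of \<open>PGL3\<close> is the set of all nonzero multiples of an invertible matrix.
\<close>

definition act_point :: "('k::field ^ 3 ^ 3) set \<Rightarrow> ('k ^ 3) set \<Rightarrow> ('k ^ 3) set" where
  "act_point g P = {M *v x |M x. M \<in> g \<and> x \<in> P}"

text \<open>
  Coefficients of the form \<open>\<lambda>x. qeval b (M *v x)\<close>: its values at the basis vectors and its
  polarization at pairs of basis vectors.
\<close>

definition qpolar :: "'k::field ^ 6 \<Rightarrow> 'k ^ 3 \<Rightarrow> 'k ^ 3 \<Rightarrow> 'k" where
  "qpolar b x y = qeval b (x + y) - qeval b x - qeval b y"

definition pullback :: "'k::field ^ 3 ^ 3 \<Rightarrow> 'k ^ 6 \<Rightarrow> 'k ^ 6" where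
  "pullback M b = vector
     [qeval b (column 1 M), qeval b (column 2 M), qeval b (column 3 M),
      qpolar b (column 1 M) (column 2 M), qpolar b (column 1 M) (column 3 M),
      qpolar b (column 2 M) (column 3 M)]"

text \<open>The image of the quadric F = 0 under x \<open>\<mapsto>\<close> M x is the quadric G = 0 with G(M x) = F(x).\<close>

definition act_quadric :: "('k::field ^ 3 ^ 3) set \<Rightarrow> ('k ^ 6) set \<Rightarrow> ('k ^ 6) set" where
  "act_quadric g Q = {b. \<exists>M\<in>g. pullback M b \<in> Q}"

definition singer_subgroup :: "('a::finite_field ^ 3 ^ 3) set set \<Rightarrow> bool" where
  "singer_subgroup S \<longleftrightarrow> subgroup S PGL3 \<and> cyclic_group (subgroup_generated PGL3 S) \<and>
     card S = CARD('a)^2 + CARD('a) + 1 \<and>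
     (\<forall>P\<in>proj_points. \<forall>P'\<in>proj_points. \<exists>!g. g \<in> S \<and> act_point g P = P')"

definition is_triangle :: "('a::finite_field alg_closure ^ 3) set set \<Rightarrow> bool" where
  "is_triangle T \<longleftrightarrow> T \<subseteq> GF_points 3 \<and> card T = 3 \<and> \<not> (\<exists>l. l \<noteq> 0 \<and> T \<subseteq> line l)"

definition singer_triangle ::
  "('a::finite_field ^ 3 ^ 3) set set \<Rightarrow> ('a alg_closure ^ 3) set set" where
  "singer_triangle S = (THE T. is_triangle T \<and> (\<forall>g\<in>S. act_point (map_matrix to_ac ` g) ` T = T))"

definition circumscribed_bundle :: "('a::finite_field ^ 3 ^ 3) set set \<Rightarrow> ('a ^ 6) set set" where
  "circumscribed_bundle S = {Q. conic Q \<and> singer_triangle S \<subseteq> zero_locus (ext_quadric Q)}"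

section \<open>The four families of planes\<close>

definition planes_C :: "('a::finite_field ^ 3 ^ 3) set set \<Rightarrow> ('a ^ 6) set set set" where
  "planes_C S = {veronese ` (act_quadric g ` circumscribed_bundle S) |g. g \<in> carrier PGL3}"

definition nucleus_plane :: "('a::finite_field ^ 3) set \<Rightarrow> ('a ^ 6) set set" where
  "nucleus_plane A = veronese `
     {Q. repeated_line_through A Q \<or> biline_centered A Q \<or> imag_biline_centered A Q}"

definition planes_N :: "('a::finite_field ^ 6) set set set" where
  "planes_N = nucleus_plane ` proj_points"

definition quadric_orbit ::
  "('a::finite_field ^ 3 ^ 3) set set \<Rightarrow> ('a ^ 6) set \<Rightarrow> ('a ^ 6) set set" where
  "quadric_orbit S Q = (\<lambda>g. act_quadric g Q) ` S"

definition planes_e :: "('a::finite_field ^ 3 ^ 3) set set \<Rightarrow> ('a ^ 6) set set set" where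
  "planes_e S = {proj_span (veronese `
       {\<beta> \<in> quadric_orbit S \<beta>0. \<exists>A\<in>zero_locus C. biline_centered A \<beta>})
     |\<beta>0 C. biline \<beta>0 \<and> C \<in> circumscribed_bundle S}"

definition planes_i :: "('a::finite_field ^ 3 ^ 3) set set \<Rightarrow> ('a ^ 6) set set set" where
  "planes_i S = {proj_span (veronese `
       {\<beta> \<in> quadric_orbit S \<beta>0. \<exists>A\<in>zero_locus C. imag_biline_centered A \<beta>})
     |\<beta>0 C. imag_biline \<beta>0 \<and> C \<in> circumscribed_bundle S}"

end

theory Submission
  imports Defs
begin

text \<open>
  A generator of the Singer group has an eigenvector \<open>v\<close> over GF(q^3) whose Frobenius conjugates form a
  basis; their points are the vertices of the triangle. This identifies the points of PG(2,q) with the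
  elements \<open>s\<close> of GF(q^3) up to scalars, the Singer group with multiplications, and quadratic forms with the
  functions Tr(a s^2 + b s^(q+1)). The bundle is a = 0, every plane in \<open>\<Pi>\<^sub>e\<close> or \<open>\<Pi>\<^sub>i\<close> is the
  graph a = A b + B b^(q^2) of a linearized binomial, and being singular at a given point is again a binomial
  condition. As a nonzero binomial has a kernel of dimension at most one, these planes meet each other and
  the planes \<open>\<pi>\<^sub>A\<close> in at most one point. The conics in a plane of \<open>\<C>\<close> are nondegenerate, whereas
  the discriminant restricted to a plane in \<open>\<Pi>\<^sub>e\<close> or \<open>\<Pi>\<^sub>i\<close> splits off a line, which meets every line of
  that plane. Finally, two conics of a bundle share only one point besides the vertices of the triangle, and
  it is rational, so they do not share a second triangle.
\<close>

section \<open>Ternary quadratic forms\<close>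

text \<open>Points of PG(5,q) are replaced by vectors of coefficients and planes by subspaces of
  forms with \<open>q^3\<close> elements. Such a subspace cannot meet itself in at most one point,
  so the estimates that bound intersections also prove planes distinct, and the same lemmas serve
  for the incidence claim and for the count. The families \<open>\<Pi>\<^sub>e\<close> and
  \<open>\<Pi>\<^sub>i\<close> become one: both consist of forms that are singular at a point and
  not multiples of a square, and whether the two lines are rational or conjugate never matters for
  the geometry. What shapes the details is uniformity in \<open>q\<close>. In characteristic 2
  polarization loses the squares and the determinant of the polar matrix is identically 0; for
  \<open>q = 2\<close> a line has only three points to span a plane with. The numbers come from
  parametrizations with fibres of constant size: matrices in GL(3,q) with fibres of size
  \<open>3 (q^3 - 1)\<close>, since a net of conics remembers its vertex up to conjugation and a
  factor in GF(q^3); pairs of a degenerate form and a line with fibres of size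
  \<open>(q - 1)^2\<close>; and vectors with fibres of size \<open>q - 1\<close>.\<close>

lemma exhaust_6:
  fixes x :: 6
  shows "x = 1 \<or> x = 2 \<or> x = 3 \<or> x = 4 \<or> x = 5 \<or> x = 6"
proof (induct x)
  case (of_int z)
  then have "z = 0 \<or> z = 1 \<or> z = 2 \<or> z = 3 \<or> z = 4 \<or> z = 5" by fastforce
  then show ?case by auto
qed

lemma forall_6: "(\<forall>i::6. P i) \<longleftrightarrow> P 1 \<and> P 2 \<and> P 3 \<and> P 4 \<and> P 5 \<and> P 6"
  by (metis exhaust_6)

lemma vector_6 [simp]:
  "(vector [a,b,c,d,e,f] :: ('a::zero)^6)$1 = a"
  "(vector [a,b,c,d,e,f] :: ('a::zero)^6)$2 = b"
  "(vector [a,b,c,d,e,f] :: ('a::zero)^6)$3 = c"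
  "(vector [a,b,c,d,e,f] :: ('a::zero)^6)$4 = d"
  "(vector [a,b,c,d,e,f] :: ('a::zero)^6)$5 = e"
  "(vector [a,b,c,d,e,f] :: ('a::zero)^6)$6 = f"
  unfolding vector_def by simp_all

lemma qpolar_expand:
  "qpolar f x y = 2 * f$1 * x$1 * y$1 + 2 * f$2 * x$2 * y$2 + 2 * f$3 * x$3 * y$3
     + f$4 * (x$1 * y$2 + x$2 * y$1) + f$5 * (x$1 * y$3 + x$3 * y$1) + f$6 * (x$2 * y$3 + x$3 * y$2)"
  by (simp add: qpolar_def qeval_def algebra_simps power2_eq_square)

lemma qpolar_sym: "qpolar f x y = qpolar f y x"
  by (simp add: qpolar_expand algebra_simps)

lemma qpolar_add_right: "qpolar f x (y + z) = qpolar f x y + qpolar f x z"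
  by (simp add: qpolar_expand algebra_simps)

lemma qpolar_scale_right: "qpolar f x (c *s y) = c * qpolar f x y"
  by (simp add: qpolar_expand algebra_simps)

lemma qeval_scale: "qeval f (c *s x) = c^2 * qeval f x"
  by (simp add: qeval_def algebra_simps power2_eq_square)

lemma qeval_plus: "qeval (f + g) x = qeval f x + qeval g x"
  by (simp add: qeval_def algebra_simps)

lemma qeval_smult: "qeval (c *s f) x = c * qeval f x"
  by (simp add: qeval_def algebra_simps)

lemma qeval_zero [simp]: "qeval 0 x = 0" "qeval f 0 = 0"
  by (simp_all add: qeval_def)

lemma qpolar_plus: "qpolar (f + g) x y = qpolar f x y + qpolar g x y"
  by (simp add: qpolar_def qeval_plus)

lemma qpolar_smult: "qpolar (c *s f) x y = c * qpolar f x y"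
  by (simp add: qpolar_def qeval_smult algebra_simps)

text \<open>The values at the basis vectors give the coefficients of the squares and polarization
  gives the mixed ones, so this holds even over GF(2). Identities between forms can thus be checked
  pointwise.\<close>

lemma form_eqI:
  assumes "\<And>x. qeval f x = qeval g x"
  shows "f = g"
proof -
  have p: "qpolar f x y = qpolar g x y" for x y
    by (simp add: qpolar_def assms)
  show ?thesis
    using assms[of "vector [1,0,0]"] assms[of "vector [0,1,0]"] assms[of "vector [0,0,1]"]
      p[of "vector [1,0,0]" "vector [0,1,0]"] p[of "vector [1,0,0]" "vector [0,0,1]"]
      p[of "vector [0,1,0]" "vector [0,0,1]"]
    by (simp add: vec_eq_iff forall_6 qpolar_expand qeval_def)
qed

lemma matrix_vector_columns:
  "(M :: 'k::field^3^3) *v x = x$1 *s column 1 M + x$2 *s column 2 M + x$3 *s column 3 M"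
  by (simp add: vec_eq_iff matrix_vector_mult_def sum_3 column_def mult.commute)

lemma qeval_comb3:
  "qeval f (a *s x + b *s y + c *s z) = a^2 * qeval f x + b^2 * qeval f y + c^2 * qeval f z
     + a * b * qpolar f x y + a * c * qpolar f x z + b * c * qpolar f y z"
  by (simp add: qeval_def qpolar_expand algebra_simps power2_eq_square)

lemma qeval_pullback: "qeval (pullback M f) x = qeval f (M *v x)"
  unfolding matrix_vector_columns qeval_comb3
  by (simp add: qeval_def pullback_def algebra_simps power2_eq_square)

lemma qpolar_pullback: "qpolar (pullback M f) x y = qpolar f (M *v x) (M *v y)"
  by (simp add: qpolar_def qeval_pullback matrix_vector_right_distrib)

lemma pullback_pullback: "pullback N (pullback M f) = pullback (M ** N) f"
  by (rule form_eqI) (simp add: qeval_pullback matrix_vector_mul_assoc)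

lemma pullback_mat_1 [simp]: "pullback (mat 1) f = f"
  by (rule form_eqI) (simp add: qeval_pullback)

lemma pullback_smult: "pullback M (c *s f) = c *s pullback M f"
  by (rule form_eqI) (simp add: qeval_pullback qeval_smult)

lemma pullback_zero [simp]: "pullback M 0 = 0"
  by (rule form_eqI) (simp add: qeval_pullback)

lemma mat_mult_vec: "mat c *v (x :: 'k::field^3) = c *s x"
  by (simp add: vec_eq_iff matrix_vector_mult_def mat_def forall_3 sum_3)

lemma scalar_product_3: "scalar_product (l::'k::field^3) x = l$1 * x$1 + l$2 * x$2 + l$3 * x$3"
  by (simp add: scalar_product_def sum_3)

lemma qeval_lin_mult: "qeval (lin_mult l m) x = scalar_product l x * scalar_product m x"
  by (simp add: qeval_def lin_mult_def scalar_product_3 algebra_simps power2_eq_square)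

lemma qpolar_lin_mult:
  "qpolar (lin_mult l m) x y = scalar_product l x * scalar_product m y + scalar_product l y * scalar_product m x"
  by (simp add: qpolar_expand lin_mult_def scalar_product_3 algebra_simps)

lemma scalar_product_mult_vec: "scalar_product l ((M :: 'k::field^3^3) *v x) = scalar_product (l v* M) x"
  by (simp add: scalar_product_3 matrix_vector_mult_def vector_matrix_mult_def sum_3 algebra_simps)

lemma pullback_lin_mult: "pullback M (lin_mult l m) = lin_mult (l v* M) (m v* M)"
  by (rule form_eqI) (simp add: qeval_pullback qeval_lin_mult scalar_product_mult_vec)

text \<open>Half the determinant of the polar form; the division by 2 is carried out formally,
  so that the invariant is meaningful in characteristic 2.\<close>

definition disc :: "'k::field^6 \<Rightarrow> 'k" where
  "disc f = 4 * f$1 * f$2 * f$3 + f$4 * f$5 * f$6 - f$1 * (f$6)^2 - f$2 * (f$5)^2 - f$3 * (f$4)^2"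

lemma disc_lin_mult: "disc (lin_mult l m) = 0"
  by (simp add: disc_def lin_mult_def algebra_simps power2_eq_square)

lemma disc_smult: "disc (c *s f) = c^3 * disc f"
  by (simp add: disc_def algebra_simps power2_eq_square power3_eq_cube)

definition polar_matrix :: "'k::field^6 \<Rightarrow> 'k^3^3" where
  "polar_matrix f = vector [vector [2 * f$1, f$4, f$5], vector [f$4, 2 * f$2, f$6], vector [f$5, f$6, 2 * f$3]]"

lemma det_polar_matrix: "det (polar_matrix f) = 2 * disc f"
  by (simp add: det_3 polar_matrix_def disc_def algebra_simps power2_eq_square)

lemma polar_matrix_pullback: "polar_matrix (pullback M f) = transpose M ** polar_matrix f ** M"
  by (simp add: vec_eq_iff forall_3 polar_matrix_def matrix_matrix_mult_def transpose_def sum_3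
      pullback_def qpolar_expand qeval_def column_def algebra_simps power2_eq_square)

text \<open>In characteristic 2 the discriminant is the value of the form at its nucleus.\<close>

definition nucleus :: "'k::field^6 \<Rightarrow> 'k^3" where
  "nucleus f = vector [f$6, f$5, f$4]"

lemma qeval_nucleus: "qeval f (nucleus f) = disc f + 2 * (f$1 * (f$6)^2 + f$2 * (f$5)^2 + f$3 * (f$4)^2
    + f$4 * f$5 * f$6 - 2 * f$1 * f$2 * f$3)"
  by (simp add: qeval_def nucleus_def disc_def algebra_simps power2_eq_square)

text \<open>In characteristic 2 the polar form is alternating and \<open>qpolar f x y\<close> is the
  determinant of \<open>nucleus f\<close>, \<open>x\<close>, \<open>y\<close>. Substituting
  \<open>M\<close> therefore applies the adjugate of \<open>M\<close> to the nucleus.\<close>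

lemma nucleus_pullback:
  assumes two: "(2::'k::field) = 0"
  shows "M *v nucleus (pullback M f) = (det M :: 'k) *s nucleus f"
proof -
  have t: "a + a = 0" for a :: 'k
    using two by (metis mult_2 mult_zero_left)
  have m: "- a = a" for a :: 'k
    using t[of a] by (simp add: eq_neg_iff_add_eq_0)
  have d: "a + (a + b) = b" for a b :: 'k
    using t[of a] by (simp add: add.assoc[symmetric])
  show ?thesis
    by (simp add: vec_eq_iff forall_3 nucleus_def matrix_vector_mult_def sum_3 pullback_def
        qpolar_expand column_def det_3 two m diff_conv_add_uminus t d algebra_simps del: add_uminus_conv_diff)
qed

text \<open>Away from characteristic 2 this is the determinant law for the polar matrix with a
  factor 2 cancelled. In characteristic 2 that law reads 0 = 0, and the covariance of the nucleus
  replaces it.\<close>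

lemma disc_pullback: "disc (pullback M f) = (det M)^2 * disc (f :: 'k::field^6)"
proof (cases "(2::'k) = 0")
  case True
  then have "disc (pullback M f) = qeval f (M *v nucleus (pullback M f))"
    using qeval_nucleus[of "pullback M f"] by (simp add: qeval_pullback)
  also have "\<dots> = (det M)^2 * disc f"
    using qeval_nucleus[of f] True by (simp add: nucleus_pullback qeval_scale)
  finally show ?thesis .
next
  case False
  have "2 * disc (pullback M f) = det (transpose M ** polar_matrix f ** M)"
    by (simp only: det_polar_matrix[symmetric] polar_matrix_pullback)
  also have "\<dots> = 2 * ((det M)^2 * disc f)"
    by (simp add: det_mul det_transpose det_polar_matrix power2_eq_square)
  finally show ?thesis
    using False by simp
qed

section \<open>The Frobenius map\<close>

text \<open>Write \<open>q = p^k * m\<close> with \<open>p\<close> not dividing \<open>m\<close>.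
  The additive map \<open>x^(p^k)\<close> has \<open>x^m\<close> as its inverse because
  \<open>x^q = x\<close>, hence \<open>(x + 1)^m = x^m + 1\<close>. If \<open>m > 1\<close>, this is
  a polynomial identity of degree below \<open>m\<close> with leading coefficient \<open>m\<close>,
  nonzero in the field, and it cannot have \<open>q\<close> roots. The additivity of
  \<open>fr\<close> rests on it.\<close>

lemma finite_field_card_prime_power: "\<exists>k. CARD('a::finite_field) = CHAR('a) ^ k"
proof -
  define p where "p = CHAR('a)"
  have p: "Factorial_Ring.prime p"
    unfolding p_def by (rule prime_CHAR_semidom) (rule CHAR_pos)
  have card2: "CARD('a) > 0"
    by (simp add: finite_UNIV_card_ge_0)
  obtain k m where m: "CARD('a) = p ^ k * m" and pm: "\<not> p dvd m"
  proof (rule multiplicity_decompose'[of "CARD('a)" p])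
    show "\<not> is_unit p" "CARD('a) \<noteq> 0"
      using p card2 by (auto dest: not_prime_unit)
  qed (rule that)
  have add: "(x + y) ^ (p^k) = x ^ (p^k) + y ^ (p^k)" for x y :: 'a
    by (rule freshmans_dream') (use p in \<open>auto simp: p_def\<close>)
  have mk': "(x ^ (p^k)) ^ m = x" for x :: 'a
    unfolding power_mult[symmetric] m[symmetric] by (rule finite_field_power_card_eq_same)
  have mk: "(x ^ m) ^ (p^k) = x" for x :: 'a
    using mk'[of x] unfolding power_mult[symmetric] by (subst mult.commute)
  have addm: "(x + 1) ^ m = x ^ m + 1" for x :: 'a
    using mk'[of "x ^ m + 1"] mk[of x] by (simp add: add)
  have "m = 1"
  proof (rule ccontr)
    assume "m \<noteq> 1"
    moreover have "m \<noteq> 0"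
      using m card2 by auto
    ultimately have m2: "m \<ge> 2" by simp
    define P :: "'a poly" where "P = [:1, 1:] ^ m - Polynomial.monom 1 m - 1"
    have lin: "Polynomial.coeff ([:1, 1:] ^ m :: 'a poly) i = of_nat (m choose i)" for i
    proof (cases "i \<le> m")
      case True
      then show ?thesis
        by (simp add: coeff_linear_poly_power)
    next
      case False
      then show ?thesis
        by (simp add: binomial_eq_0 coeff_eq_0 degree_linear_power)
    qed
    have c: "Polynomial.coeff P i = of_nat (m choose i) - (if i = m then 1 else 0) - (if i = 0 then 1 else 0)" for i
      by (simp add: P_def lin coeff_1 del: One_nat_def)
    have "Polynomial.coeff P (m - 1) = of_nat m"
    proof -
      define n where "n = m - 2"
      have "m = Suc (Suc n)"
        using m2 by (simp add: n_def)
      then show ?thesis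
        by (simp add: c binomial_Suc_n del: binomial_Suc_Suc)
    qed
    moreover have "of_nat m \<noteq> (0 :: 'a)"
      using pm by (simp add: of_nat_eq_0_iff_char_dvd p_def)
    ultimately have P0: "P \<noteq> 0" by auto
    have "poly P x = 0" for x
      using addm[of x] by (simp add: P_def poly_monom add.commute[of x 1])
    then have "CARD('a) \<le> Polynomial.degree P"
      using card_poly_roots_bound[OF P0] by simp
    also have "Polynomial.degree P < m"
    proof -
      have "Polynomial.coeff P i = 0" if "i \<ge> m" for i
        using that m2 by (cases "i = m") (auto simp: c binomial_eq_0)
      then show ?thesis
        using P0 by (meson leading_coeff_0_iff not_le)
    qed
    finally show False
      using m card2 by (metis dvd_imp_le dvd_triv_right leD)
  qed
  then show ?thesis
    using m unfolding p_def by auto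
qed

definition fr :: "'a::finite_field alg_closure \<Rightarrow> 'a alg_closure" where
  "fr x = x ^ CARD('a)"

lemma fr_add [simp]: "fr (x + y) = fr x + fr y"
proof -
  obtain k where "CARD('a) = CHAR('a) ^ k"
    using finite_field_card_prime_power by blast
  moreover have "Factorial_Ring.prime CHAR('a alg_closure)"
    by (simp add: prime_CHAR_semidom)
  ultimately show ?thesis
    unfolding fr_def by (intro freshmans_dream'[of _ k]) auto
qed

lemma fr_mult [simp]: "fr (x * y) = fr x * fr y"
  by (simp add: fr_def power_mult_distrib)

lemma fr_power [simp]: "fr (x ^ n) = fr x ^ n"
  by (simp add: fr_def flip: power_mult) (simp add: mult.commute)

lemma fr_0 [simp]: "fr 0 = 0"
  by (simp add: fr_def power_0_left finite_UNIV_card_ge_0)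

lemma fr_1 [simp]: "fr 1 = 1"
  by (simp add: fr_def)

lemma fr_minus [simp]: "fr (- x) = - fr x"
  by (metis add.right_inverse fr_0 fr_add minus_unique)

lemma fr_diff [simp]: "fr (x - y) = fr x - fr y"
  using fr_add[of x "- y"] by simp

lemma fr_eq_0_iff [simp]: "fr x = 0 \<longleftrightarrow> x = 0"
  by (simp add: fr_def finite_UNIV_card_ge_0)

lemma fr_eq_iff [simp]: "fr x = fr y \<longleftrightarrow> x = y"
  by (metis fr_diff fr_eq_0_iff right_minus_eq)

lemma fr_inverse [simp]: "fr (inverse x) = inverse (fr x)"
  by (simp add: fr_def power_inverse)

lemma fr_divide [simp]: "fr (x / y) = fr x / fr y"
  by (simp add: fr_def power_divide)

lemma fr_to_ac [simp]: "fr (to_ac a) = to_ac a"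
  by (simp add: fr_def finite_field_power_card_eq_same flip: to_ac_power)

lemma fr_numeral [simp]: "fr (numeral n) = numeral n"
  using fr_to_ac[of "numeral n"] by simp

lemma card_power_eq_self:
  fixes n :: nat
  assumes "n \<ge> 2"
  shows "finite {x :: 'k::field. x ^ n = x}" "card {x :: 'k. x ^ n = x} \<le> n"
proof -
  define P :: "'k poly" where "P = Polynomial.monom 1 n - Polynomial.monom 1 1"
  have "Polynomial.coeff P n = 1"
    using assms by (simp add: P_def)
  then have P0: "P \<noteq> 0" by auto
  have eq: "{x. x ^ n = x} = {x. poly P x = 0}"
    by (simp add: P_def poly_monom)
  show "finite {x :: 'k. x ^ n = x}"
    unfolding eq by (rule poly_roots_finite[OF P0])
  have "Polynomial.degree P \<le> n"
    using assms unfolding P_def by (intro degree_diff_le) (auto simp: degree_monom_eq)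
  then show "card {x :: 'k. x ^ n = x} \<le> n"
    unfolding eq using card_poly_roots_bound[OF P0] by linarith
qed

lemma card_finite_field_ge_2: "CARD('a::finite_field) \<ge> 2"
proof -
  have "card {0, 1 :: 'a} \<le> CARD('a)"
    by (intro card_mono) auto
  then show ?thesis by simp
qed

text \<open>The polynomial \<open>X^q - X\<close> has at most \<open>q\<close> roots, and the ground
  field already supplies \<open>q\<close> of them.\<close>

lemma fr_fixed_iff: "fr x = x \<longleftrightarrow> x \<in> range to_ac"
proof
  assume x: "fr x = x"
  have "range (to_ac :: 'a \<Rightarrow> _) = {x. x ^ CARD('a) = x}"
  proof (rule card_seteq)
    show "finite {x :: 'a alg_closure. x ^ CARD('a) = x}"
      by (rule card_power_eq_self[OF card_finite_field_ge_2])
    show "range (to_ac :: 'a \<Rightarrow> _) \<subseteq> {x. x ^ CARD('a) = x}"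
      by (auto simp flip: fr_def)
    have "card (range (to_ac :: 'a \<Rightarrow> _)) = CARD('a)"
      by (simp add: card_image inj_to_ac)
    moreover have "card {x :: 'a alg_closure. x ^ CARD('a) = x} \<le> CARD('a)"
      by (rule card_power_eq_self(2)) (rule card_finite_field_ge_2)
    ultimately show "card {x :: 'a alg_closure. x ^ CARD('a) = x} \<le> card (range (to_ac :: 'a \<Rightarrow> _))"
      by simp
  qed
  then show "x \<in> range to_ac"
    using x by (auto simp: fr_def)
qed auto

definition cubic :: "'a::finite_field alg_closure set" where
  "cubic = {x. fr (fr (fr x)) = x}"

lemma fr_fr_fr: "fr (fr (fr x)) = x ^ (CARD('a) ^ 3)" for x :: "'a::finite_field alg_closure"
  by (simp add: fr_def power3_eq_cube flip: power_mult)

lemma fr_fr: "fr (fr x) = x ^ (CARD('a) ^ 2)" for x :: "'a::finite_field alg_closure"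
  by (simp add: fr_def power2_eq_square flip: power_mult)

text \<open>Counting roots gives only an upper bound; equality is obtained in
  \<open>card_cubic\<close> from the bijection between GF(q^3) and GF(q)^3.\<close>

lemma finite_cubic: "finite (cubic :: 'a::finite_field alg_closure set)"
  and card_cubic_le: "card (cubic :: 'a::finite_field alg_closure set) \<le> CARD('a) ^ 3"
proof -
  have "CARD('a) ^ 1 \<le> CARD('a) ^ 3"
    using card_finite_field_ge_2[where ?'a = 'a] by (intro power_increasing) auto
  then have ge: "CARD('a) ^ 3 \<ge> 2"
    using card_finite_field_ge_2[where ?'a = 'a] unfolding power_one_right by (rule order_trans[rotated])
  show "finite (cubic :: 'a alg_closure set)"
    unfolding cubic_def fr_fr_fr by (rule card_power_eq_self(1)[OF ge])
  show "card (cubic :: 'a alg_closure set) \<le> CARD('a) ^ 3"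
    unfolding cubic_def fr_fr_fr by (rule card_power_eq_self(2)[OF ge])
qed

lemma cubicD: "x \<in> cubic \<Longrightarrow> fr (fr (fr x)) = x"
  by (simp add: cubic_def)

lemma cubic_intros:
  "x \<in> cubic \<Longrightarrow> y \<in> cubic \<Longrightarrow> x + y \<in> cubic"
  "x \<in> cubic \<Longrightarrow> y \<in> cubic \<Longrightarrow> x - y \<in> cubic"
  "x \<in> cubic \<Longrightarrow> y \<in> cubic \<Longrightarrow> x * y \<in> cubic"
  "x \<in> cubic \<Longrightarrow> y \<in> cubic \<Longrightarrow> x / y \<in> cubic"
  "x \<in> cubic \<Longrightarrow> - x \<in> cubic"
  "x \<in> cubic \<Longrightarrow> inverse x \<in> cubic"
  "x \<in> cubic \<Longrightarrow> fr x \<in> cubic"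
  "x \<in> cubic \<Longrightarrow> x ^ n \<in> cubic"
  "to_ac a \<in> cubic" "0 \<in> cubic" "1 \<in> cubic"
  by (simp_all add: cubic_def)

text \<open>As 2 and 3 are coprime, GF(q^2) and GF(q^3) meet in GF(q). Most scalars of GF(q) below
  are recognized by being in \<open>cubic\<close> and fixed by the square of
  \<open>fr\<close>.\<close>

lemma fr_fr_fixed_imp: "x \<in> cubic \<Longrightarrow> fr (fr x) = x \<Longrightarrow> fr x = x"
  by (metis cubicD)

section \<open>Extension of scalars and Frobenius for vectors, matrices and forms\<close>

lemma ext_vec_nth [simp]: "ext_vec x $ i = to_ac (x $ i)"
  by (simp add: ext_vec_def)

lemma frob_vec_nth [simp]: "frob_vec x $ i = fr (x $ i)"
  by (simp add: frob_vec_def fr_def)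

lemma frob_vec_simps [simp]:
  "frob_vec (x + y) = frob_vec x + frob_vec y" "frob_vec (c *s x) = fr c *s frob_vec x"
  "frob_vec (ext_vec z) = ext_vec z" "frob_vec 0 = 0"
  by (simp_all add: vec_eq_iff)

lemma frob_vec_eq_0_iff [simp]: "frob_vec x = 0 \<longleftrightarrow> x = 0"
  by (simp add: vec_eq_iff)

lemma ext_vec_simps [simp]:
  "ext_vec (x + y) = ext_vec x + ext_vec y" "ext_vec (c *s x) = to_ac c *s ext_vec x" "ext_vec 0 = 0"
  by (simp_all add: vec_eq_iff)

lemma ext_vec_eq_iff [simp]: "ext_vec x = ext_vec y \<longleftrightarrow> x = y"
  by (simp add: vec_eq_iff)

lemma ext_vec_eq_0_iff [simp]: "ext_vec x = 0 \<longleftrightarrow> x = 0"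
  by (simp add: vec_eq_iff)

lemma frob_vec_fixed_imp: "frob_vec x = x \<Longrightarrow> x \<in> range ext_vec"
proof -
  assume "frob_vec x = x"
  then have "x = ext_vec (\<chi> i. of_ac (x $ i))"
    by (simp add: vec_eq_iff to_ac_of_ac flip: fr_fixed_iff)
  then show ?thesis by blast
qed

lemma over_GF_2_iff: "over_GF 2 x \<longleftrightarrow> frob_vec (frob_vec x) = x"
  by (simp add: over_GF_def vec_eq_iff fr_fr)

lemma over_GF_3_iff: "over_GF 3 x \<longleftrightarrow> frob_vec (frob_vec (frob_vec x)) = x"
  by (simp add: over_GF_def vec_eq_iff fr_fr_fr)

abbreviation ext_mat :: "'a::field^3^3 \<Rightarrow> 'a alg_closure^3^3" where
  "ext_mat \<equiv> map_matrix to_ac"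

lemma ext_mat_mult_vec: "ext_mat M *v ext_vec x = ext_vec (M *v x)"
  by (simp add: vec_eq_iff matrix_vector_mult_def sum_3)

lemma ext_mat_mult: "ext_mat (M ** N) = ext_mat M ** ext_mat N"
  by (simp add: vec_eq_iff matrix_matrix_mult_def sum_3)

lemma ext_mat_mat: "ext_mat (mat c) = mat (to_ac c)"
  by (simp add: vec_eq_iff mat_def)

lemma det_ext_mat: "det (ext_mat M) = to_ac (det M)"
  by (simp add: det_3)

lemma frob_vec_ext_mat_mult [simp]: "frob_vec (ext_mat M *v x) = ext_mat M *v frob_vec x"
  by (simp add: vec_eq_iff matrix_vector_mult_def sum_3)

lemma qeval_ext_vec: "qeval (ext_vec f) (ext_vec x) = to_ac (qeval f x)"
  by (simp add: qeval_def)

lemma qpolar_ext_vec: "qpolar (ext_vec f) (ext_vec x) (ext_vec y) = to_ac (qpolar f x y)"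
  by (simp add: qpolar_expand)

lemma qeval_frob_vec: "qeval (ext_vec f) (frob_vec x) = fr (qeval (ext_vec f) x)"
  by (simp add: qeval_def)

lemma qpolar_frob_vec: "qpolar (ext_vec f) (frob_vec x) (frob_vec y) = fr (qpolar (ext_vec f) x y)"
  by (simp add: qpolar_expand)

lemma ext_vec_pullback: "ext_vec (pullback M f) = pullback (ext_mat M) (ext_vec f)"
  by (simp add: vec_eq_iff forall_6 pullback_def qeval_def qpolar_expand column_def)

lemma disc_ext_vec: "disc (ext_vec f) = to_ac (disc f)"
  by (simp add: disc_def)

section \<open>Coordinates over the cubic extension\<close>

definition frame :: "'a::finite_field alg_closure^3 \<Rightarrow> 'a alg_closure^3^3" where
  "frame v = transpose (vector [v, frob_vec v, frob_vec (frob_vec v)])"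

lemma frame_nth [simp]:
  "frame v $ i $ 1 = v $ i" "frame v $ i $ 2 = fr (v $ i)" "frame v $ i $ 3 = fr (fr (v $ i))"
  by (simp_all add: frame_def transpose_def)

lemma column_frame [simp]:
  "column 1 (frame v) = v" "column 2 (frame v) = frob_vec v" "column 3 (frame v) = frob_vec (frob_vec v)"
  by (simp_all add: column_def vec_eq_iff)

lemma frame_mult_vec:
  "frame v *v x = x$1 *s v + x$2 *s frob_vec v + x$3 *s frob_vec (frob_vec v)"
  by (simp add: matrix_vector_columns)

lemma invertible_mult_vec_eq_iff:
  fixes M :: "'k::field^'n^'n"
  assumes "det M \<noteq> 0"
  shows "M *v x = M *v y \<longleftrightarrow> x = y"
  using assms inj_matrix_vector_mult[of M] by (simp add: invertible_det_nz inj_def) blast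

lemma invertible_mult_vec_surj:
  fixes M :: "'k::field^'n^'n"
  assumes "det M \<noteq> 0"
  obtains x where "y = M *v x"
proof -
  obtain N where "M ** N = mat 1"
    using assms by (auto simp: invertible_def simp flip: invertible_det_nz)
  then have "M *v (N *v y) = y"
    by (simp add: matrix_vector_mul_assoc)
  then show thesis
    using that by metis
qed

text \<open>The vertex condition. In characteristic 2 the radical of the polar form may contain a
  point off the quadric, such as the nucleus of a conic; the equation \<open>qeval f y = 0\<close>
  excludes it.\<close>

definition sing :: "'k::field^6 \<Rightarrow> 'k^3 \<Rightarrow> bool" where
  "sing f y \<longleftrightarrow> qeval f y = 0 \<and> (\<forall>x. qpolar f x y = 0)"

lemma sing_ext_vec: "sing (ext_vec f) (ext_vec y) \<longleftrightarrow> sing f y"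
proof
  assume f: "sing f y"
  then have "qpolar f (vector [1,0,0]) y = 0" "qpolar f (vector [0,1,0]) y = 0" "qpolar f (vector [0,0,1]) y = 0"
    by (simp_all add: sing_def)
  then have h: "2 * f$1 * y$1 + f$4 * y$2 + f$5 * y$3 = 0" "2 * f$2 * y$2 + f$4 * y$1 + f$6 * y$3 = 0"
      "2 * f$3 * y$3 + f$5 * y$1 + f$6 * y$2 = 0"
    by (simp_all add: qpolar_expand)
  have "qpolar (ext_vec f) x (ext_vec y) = x$1 * to_ac (2 * f$1 * y$1 + f$4 * y$2 + f$5 * y$3)
      + x$2 * to_ac (2 * f$2 * y$2 + f$4 * y$1 + f$6 * y$3) + x$3 * to_ac (2 * f$3 * y$3 + f$5 * y$1 + f$6 * y$2)" for x
    by (simp add: qpolar_expand algebra_simps)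
  then have "qpolar (ext_vec f) x (ext_vec y) = 0" for x
    by (simp only: h) simp
  then show "sing (ext_vec f) (ext_vec y)"
    using f by (simp add: sing_def qeval_ext_vec)
next
  assume f: "sing (ext_vec f) (ext_vec y)"
  then have "to_ac (qpolar f x y) = 0" for x
    by (simp add: sing_def flip: qpolar_ext_vec)
  then show "sing f y"
    using f by (simp add: sing_def qeval_ext_vec)
qed

definition tr :: "'a::finite_field alg_closure \<Rightarrow> 'a alg_closure" where
  "tr x = x + fr x + fr (fr x)"

lemma fr_tr: "x \<in> cubic \<Longrightarrow> fr (tr x) = tr x"
  by (simp add: tr_def cubicD)

lemma tr_fr: "x \<in> cubic \<Longrightarrow> tr (fr x) = tr x"
  by (simp add: tr_def cubicD)

text \<open>No group enters here, so the locale can also be instantiated at the vectors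
  \<open>ext_mat N *v v\<close>, whose conjugates are the vertices of the triangles of the other
  bundles.\<close>

locale cubic_frame =
  fixes v :: "'a::finite_field alg_closure^3"
  assumes cubic_v: "frob_vec (frob_vec (frob_vec v)) = v"
    and det_frame: "det (frame v) \<noteq> 0"
begin

lemma v_nth_cubic: "v $ i \<in> cubic"
  using cubic_v by (simp add: vec_eq_iff cubic_def)

lemma v_nonzero: "v \<noteq> 0"
proof
  assume "v = 0"
  then have "det (frame v) = 0" by (simp add: det_3)
  then show False using det_frame by simp
qed

lemma frame_coords_eq:
  assumes "a *s v + b *s frob_vec v + c *s frob_vec (frob_vec v) = a' *s v + b' *s frob_vec v + c' *s frob_vec (frob_vec v)"
  shows "a = a' \<and> b = b' \<and> c = c'"
proof -
  have "frame v *v vector [a,b,c] = frame v *v vector [a',b',c']"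
    using assms by (simp add: frame_mult_vec)
  then have "vector [a,b,c] = (vector [a',b',c'] :: 'a alg_closure^3)"
    using det_frame by (simp add: invertible_mult_vec_eq_iff)
  then show ?thesis
    by (simp add: vec_eq_iff forall_3)
qed

text \<open>The rational vector whose coordinates in the frame are \<open>s\<close> and its
  conjugates. Its entries are traces, so for \<open>s\<close> in \<open>cubic\<close> the map
  \<open>of_ac\<close> is applied to elements of GF(q) only.\<close>

definition pt :: "'a alg_closure \<Rightarrow> 'a^3" where
  "pt s = (\<chi> i. of_ac (tr (s * v $ i)))"

lemma ext_pt: "s \<in> cubic \<Longrightarrow> ext_vec (pt s) = s *s v + fr s *s frob_vec v + fr (fr s) *s frob_vec (frob_vec v)"
proof -
  assume "s \<in> cubic"
  then have "tr (s * v $ i) \<in> range to_ac" for i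
    by (simp add: fr_tr cubic_intros v_nth_cubic flip: fr_fixed_iff)
  then show ?thesis
    by (simp add: vec_eq_iff pt_def to_ac_of_ac tr_def)
qed

lemma pt_eq_iff:
  assumes "s \<in> cubic" "t \<in> cubic"
  shows "pt s = pt t \<longleftrightarrow> s = t"
proof
  assume "pt s = pt t"
  then have "ext_vec (pt s) = ext_vec (pt t)" by simp
  then show "s = t"
    unfolding ext_pt[OF assms(1)] ext_pt[OF assms(2)] using frame_coords_eq by blast
qed auto

text \<open>A rational vector equals its Frobenius image. Comparing coordinates in the frame, which
  \<open>fr\<close> permutes cyclically, shows that they form a conjugate triple.\<close>

lemma pt_surj:
  obtains s where "s \<in> cubic" "y = pt s"
proof -
  obtain z where z: "ext_vec y = frame v *v z"
    using invertible_mult_vec_surj[OF det_frame] by blast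
  have e: "ext_vec y = z$1 *s v + z$2 *s frob_vec v + z$3 *s frob_vec (frob_vec v)"
    using z by (simp add: frame_mult_vec)
  have "ext_vec y = frob_vec (ext_vec y)" by simp
  also have "\<dots> = fr (z$3) *s v + fr (z$1) *s frob_vec v + fr (z$2) *s frob_vec (frob_vec v)"
    unfolding e by (simp add: cubic_v)
  finally have "z$1 = fr (z$3) \<and> z$2 = fr (z$1) \<and> z$3 = fr (z$2)"
    unfolding e by (rule frame_coords_eq)
  then have z1: "fr (z$3) = z$1" and z2: "z$2 = fr (z$1)" and z3: "z$3 = fr (fr (z$1))"
    by metis+
  have "z$1 \<in> cubic"
    using z1 unfolding z3 by (simp add: cubic_def)
  moreover from this z2 z3 have "ext_vec y = ext_vec (pt (z$1))"
    by (simp add: e ext_pt)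
  ultimately show thesis
    using that by simp
qed

lemma bij_pt: "bij_betw pt cubic UNIV"
proof (rule bij_betw_imageI)
  show "inj_on pt cubic"
    by (rule inj_onI) (simp add: pt_eq_iff)
  have "y \<in> pt ` cubic" for y
    by (rule pt_surj[of y]) auto
  then show "pt ` cubic = UNIV" by blast
qed

lemma card_cubic: "card (cubic :: 'a alg_closure set) = CARD('a) ^ 3"
  using bij_betw_same_card[OF bij_pt] by simp

lemma pt_scale: "s \<in> cubic \<Longrightarrow> pt (to_ac c * s) = c *s pt s"
proof -
  assume s: "s \<in> cubic"
  have "ext_vec (pt (to_ac c * s)) = ext_vec (c *s pt s)"
    using s by (simp add: ext_pt cubic_intros vec_eq_iff algebra_simps)
  then show ?thesis by (simp only: ext_vec_eq_iff)
qed

lemma pt_0 [simp]: "pt 0 = 0"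
proof -
  have "ext_vec (pt 0) = 0" by (simp add: ext_pt cubic_intros)
  then show ?thesis by simp
qed

lemma pt_eq_0_iff: "s \<in> cubic \<Longrightarrow> pt s = 0 \<longleftrightarrow> s = 0"
  using pt_eq_iff[of s 0] by (simp add: cubic_intros)

text \<open>In the coordinate \<open>s\<close> of a point \<open>pt s\<close>, the form \<open>f\<close> becomes
  \<open>tr (c0 f * s^2 + c1 f * s * fr s)\<close>.\<close>

definition c0 :: "'a^6 \<Rightarrow> 'a alg_closure" where
  "c0 f = qeval (ext_vec f) v"

definition c1 :: "'a^6 \<Rightarrow> 'a alg_closure" where
  "c1 f = qpolar (ext_vec f) v (frob_vec v)"

lemma c0_cubic: "c0 f \<in> cubic"
  by (simp add: c0_def cubic_def cubic_v flip: qeval_frob_vec)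

lemma c1_cubic: "c1 f \<in> cubic"
  by (simp add: c1_def cubic_def cubic_v flip: qpolar_frob_vec)

lemmas cubic_simps = cubic_intros c0_cubic c1_cubic

lemma c0_linear: "c0 (f + g) = c0 f + c0 g" "c0 (k *s f) = to_ac k * c0 f" "c0 0 = 0"
  by (simp_all add: c0_def qeval_plus qeval_smult)

lemma c1_linear: "c1 (f + g) = c1 f + c1 g" "c1 (k *s f) = to_ac k * c1 f" "c1 0 = 0"
  by (simp_all add: c1_def qpolar_plus qpolar_smult) (simp add: qpolar_def)

lemma pullback_frame:
  "pullback (frame v) (ext_vec f) = vector [c0 f, fr (c0 f), fr (fr (c0 f)), c1 f, fr (fr (c1 f)), fr (c1 f)]"
proof -
  have "qpolar (ext_vec f) v (frob_vec (frob_vec v)) = fr (fr (c1 f))"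
    unfolding c1_def qpolar_frob_vec[symmetric] by (simp add: cubic_v qpolar_sym)
  then show ?thesis
    by (simp add: pullback_def c0_def c1_def qeval_frob_vec qpolar_frob_vec)
qed

lemma form_eq_iff: "f = g \<longleftrightarrow> c0 f = c0 g \<and> c1 f = c1 g"
proof
  assume "c0 f = c0 g \<and> c1 f = c1 g"
  then have "pullback (frame v) (ext_vec f) = pullback (frame v) (ext_vec g)"
    by (simp add: pullback_frame)
  then have "qeval (ext_vec f) (frame v *v x) = qeval (ext_vec g) (frame v *v x)" for x
    by (simp flip: qeval_pullback)
  then have "ext_vec f = ext_vec g"
    using invertible_mult_vec_surj[OF det_frame] by (metis form_eqI)
  then show "f = g" by simp
qed auto

lemma form_eq_0_iff: "f = 0 \<longleftrightarrow> c0 f = 0 \<and> c1 f = 0"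
  using form_eq_iff[of f 0] by (simp add: c0_linear c1_linear)

text \<open>Injectivity is \<open>form_eq_iff\<close>; surjectivity follows since both sides have
  \<open>q^6\<close> elements.\<close>

lemma bij_form: "bij_betw (\<lambda>f. (c0 f, c1 f)) UNIV (cubic \<times> cubic)"
proof -
  have inj: "inj (\<lambda>f. (c0 f, c1 f))"
    by (rule injI) (simp add: form_eq_iff)
  have "range (\<lambda>f. (c0 f, c1 f)) = cubic \<times> cubic"
  proof (rule card_seteq)
    show "finite (cubic \<times> cubic :: ('a alg_closure \<times> 'a alg_closure) set)"
      by (simp add: finite_cubic)
    show "range (\<lambda>f. (c0 f, c1 f)) \<subseteq> cubic \<times> cubic"
      by (auto simp: c0_cubic c1_cubic)
    have "card (range (\<lambda>f. (c0 f, c1 f))) = CARD('a ^ 6)"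
      by (rule card_image[OF inj])
    then show "card (cubic \<times> cubic :: ('a alg_closure \<times> 'a alg_closure) set) \<le> card (range (\<lambda>f. (c0 f, c1 f)))"
      by (simp add: card_cartesian_product card_cubic flip: power_add)
  qed
  then show ?thesis
    using inj by (simp add: bij_betw_def)
qed

lemma form_exists:
  assumes "a \<in> cubic" "b \<in> cubic"
  obtains f where "c0 f = a" "c1 f = b"
proof -
  have "(a, b) \<in> range (\<lambda>f. (c0 f, c1 f))"
    using bij_form assms by (simp add: bij_betw_def)
  then show thesis
    using that by auto
qed

lemma qeval_pt:
  assumes s: "s \<in> cubic"
  shows "to_ac (qeval f (pt s)) = tr (c0 f * s^2 + c1 f * s * fr s)"
proof -
  have "to_ac (qeval f (pt s)) = qeval (ext_vec f) (frame v *v vector [s, fr s, fr (fr s)])"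
    using s by (simp add: frame_mult_vec flip: qeval_ext_vec ext_pt)
  also have "\<dots> = qeval (pullback (frame v) (ext_vec f)) (vector [s, fr s, fr (fr s)])"
    by (simp add: qeval_pullback)
  also have "\<dots> = tr (c0 f * s^2 + c1 f * s * fr s)"
    unfolding pullback_frame by (simp add: qeval_def tr_def cubicD[OF s] algebra_simps)
  finally show ?thesis .
qed

lemma qpolar_v_pt:
  assumes s: "s \<in> cubic"
  shows "qpolar (ext_vec f) v (ext_vec (pt s)) = 2 * c0 f * s + c1 f * fr s + fr (fr (c1 f * s))"
proof -
  have "v = frame v *v vector [1,0,0]"
    by (simp add: frame_mult_vec)
  then have "qpolar (ext_vec f) v (ext_vec (pt s))
      = qpolar (ext_vec f) (frame v *v vector [1,0,0]) (frame v *v vector [s, fr s, fr (fr s)])"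
    using s by (simp add: frame_mult_vec ext_pt)
  also have "\<dots> = qpolar (pullback (frame v) (ext_vec f)) (vector [1,0,0]) (vector [s, fr s, fr (fr s)])"
    by (simp add: qpolar_pullback)
  also have "\<dots> = 2 * c0 f * s + c1 f * fr s + fr (fr (c1 f * s))"
    unfolding pullback_frame by (simp add: qpolar_expand algebra_simps)
  finally show ?thesis .
qed

lemma sing_pt:
  assumes "s \<in> cubic" "sing f (pt s)"
  shows "2 * c0 f * s + c1 f * fr s + fr (fr (c1 f * s)) = 0"
  using assms qpolar_v_pt[of s f] sing_ext_vec[of f "pt s"] by (simp add: sing_def)

lemma disc_frame:
  "(det (frame v))^2 * to_ac (disc f) = disc (vector [c0 f, fr (c0 f), fr (fr (c0 f)), c1 f, fr (fr (c1 f)), fr (c1 f)])"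
  using disc_pullback[of "frame v" "ext_vec f"] by (simp add: pullback_frame disc_ext_vec)

lemma disc_eq_0_iff: "disc f = 0 \<longleftrightarrow>
  disc (vector [c0 f, fr (c0 f), fr (fr (c0 f)), c1 f, fr (fr (c1 f)), fr (c1 f)]) = 0"
  using disc_frame[of f] det_frame by (metis mult_eq_0_iff power_eq_0_iff to_ac_eq_0_iff mult_zero_right to_ac_0)

text \<open>For \<open>c0 f = 0\<close> the discriminant in the frame reduces to the norm of
  \<open>c1 f\<close>.\<close>

lemma disc_bundle_nonzero: "c0 f = 0 \<Longrightarrow> f \<noteq> 0 \<Longrightarrow> disc f \<noteq> 0"
  by (simp add: disc_eq_0_iff form_eq_0_iff) (simp add: disc_def)

end

section \<open>Subspaces, frames and singular points\<close>

lemma card_span_insert: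
  fixes x :: "'a::finite_field^'n"
  assumes "x \<notin> vec.span B"
  shows "card (vec.span (insert x B)) = CARD('a) * card (vec.span B)"
proof -
  have "bij_betw (\<lambda>(k, y). k *s x + y) (UNIV \<times> vec.span B) (vec.span (insert x B))"
  proof (rule bij_betw_imageI)
    show "inj_on (\<lambda>(k, y). k *s x + y) (UNIV \<times> vec.span B)"
    proof (rule inj_onI, clarsimp)
      fix k y l z
      assume y: "y \<in> vec.span B" and z: "z \<in> vec.span B" and e: "k *s x + y = l *s x + z"
      have d: "(k - l) *s x = z - y"
        using e by (simp add: algebra_simps vec_eq_iff)
      have "k = l"
      proof (rule ccontr)
        assume "k \<noteq> l"
        then have "x = inverse (k - l) *s (z - y)"
          unfolding d[symmetric] vec.scale_scale by simp
        then show False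
          using assms y z by (metis vec.span_diff vec.span_scale)
      qed
      then show "k = l \<and> y = z" using e by simp
    qed
    show "(\<lambda>(k, y). k *s x + y) ` (UNIV \<times> vec.span B) = vec.span (insert x B)"
    proof (intro equalityI subsetI)
      fix z assume "z \<in> (\<lambda>(k, y). k *s x + y) ` (UNIV \<times> vec.span B)"
      then obtain k y where z: "z = k *s x + y" and y: "y \<in> vec.span B"
        by auto
      have "y \<in> vec.span (insert x B)"
        using y vec.span_mono[of B "insert x B"] by blast
      moreover have "x \<in> vec.span (insert x B)"
        by (rule vec.span_base) simp
      ultimately show "z \<in> vec.span (insert x B)"
        unfolding z by (intro vec.span_add vec.span_scale)
    next
      fix z assume "z \<in> vec.span (insert x B)"
      then obtain k where "z - k *s x \<in> vec.span B"
        by (auto simp: vec.span_insert)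
      then show "z \<in> (\<lambda>(k, y). k *s x + y) ` (UNIV \<times> vec.span B)"
        by (auto intro!: image_eqI[of _ _ "(k, z - k *s x)"])
    qed
  qed
  from bij_betw_same_card[OF this] show ?thesis
    by (simp add: card_cartesian_product)
qed

lemma card_span_independent:
  fixes B :: "('a::finite_field^'n) set"
  assumes "vec.independent B"
  shows "card (vec.span B) = CARD('a) ^ card B"
proof -
  have "finite B" by simp
  then show ?thesis
    using assms
  proof (induction B rule: finite_induct)
    case (insert x B)
    then have "x \<notin> vec.span B" "vec.independent B"
      by (auto simp: vec.independent_insert split: if_splits)
    then show ?case
      using insert by (simp add: card_span_insert)
  qed simp
qed

lemma card_subspace:
  fixes U :: "('a::finite_field^'n) set"
  assumes "vec.subspace U"
  shows "card U = CARD('a) ^ vec.dim U"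
proof -
  obtain B where B: "B \<subseteq> U" "vec.independent B" "U \<subseteq> vec.span B" "card B = vec.dim U"
    using vec.basis_exists by blast
  then have "vec.span B = U"
    using assms by (meson subset_antisym vec.span_minimal)
  then show ?thesis
    using card_span_independent[OF B(2)] B(4) by simp
qed

lemma is_plane_subspace_points:
  fixes U :: "('a::finite_field^'n) set"
  assumes "vec.subspace U" "card U = CARD('a) ^ 3"
  shows "is_plane (subspace_points U)"
proof -
  have "CARD('a) ^ vec.dim U = CARD('a) ^ 3"
    using assms by (simp add: card_subspace)
  then have "vec.dim U = 3"
    using card_finite_field_ge_2[where ?'a = 'a] by (simp add: power_inject_exp)
  then show ?thesis
    using assms unfolding is_plane_def by blast
qed

text \<open>The vector-space counterpart of having at most one projective point.\<close>

definition thin :: "('k::field^'n) set \<Rightarrow> bool" where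
  "thin U \<longleftrightarrow> (\<forall>f\<in>U. \<forall>g\<in>U. f \<noteq> 0 \<longrightarrow> (\<exists>k. g = k *s f))"

lemma thinI: "(\<And>f g. f \<in> U \<Longrightarrow> g \<in> U \<Longrightarrow> f \<noteq> 0 \<Longrightarrow> \<exists>k. g = k *s f) \<Longrightarrow> thin U"
  by (simp add: thin_def)

lemma span_singleton_eq: "k \<noteq> 0 \<Longrightarrow> vec.span {k *s (f :: 'k::field^'n)} = vec.span {f}"
proof -
  assume k: "k \<noteq> 0"
  have "f = inverse k *s (k *s f)" using k by simp
  then have "f \<in> vec.span {k *s f}"
    by (metis insertI1 vec.span_base vec.span_scale)
  moreover have "k *s f \<in> vec.span {f}"
    by (simp add: vec.span_base vec.span_scale)
  ultimately show ?thesis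
    by (simp add: vec.span_eq)
qed

lemma thin_imp_card_le_1:
  fixes U V :: "('k::field^'n) set"
  assumes "thin (U \<inter> V)"
  shows "card (subspace_points U \<inter> subspace_points V) \<le> 1"
proof -
  have "P = Q" if P: "P \<in> subspace_points U \<inter> subspace_points V" and Q: "Q \<in> subspace_points U \<inter> subspace_points V" for P Q
  proof -
    obtain f g where f: "f \<noteq> 0" "P = vec.span {f}" and g: "g \<noteq> 0" "Q = vec.span {g}"
      using P Q by (auto simp: subspace_points_def proj_points_def)
    have "f \<in> P" "g \<in> Q"
      using f g by (simp_all add: vec.span_base)
    then have "f \<in> U \<inter> V" "g \<in> U \<inter> V"
      using P Q by (auto simp: subspace_points_def)
    then obtain k where "g = k *s f"
      using assms f unfolding thin_def by blast
    then show ?thesis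
      using f g span_singleton_eq[of k f] by (metis vec.scale_zero_left)
  qed
  then show ?thesis
    by (metis card_le_Suc0_iff_eq card.infinite One_nat_def le_0_eq zero_le)
qed

lemma card_thin_le:
  fixes U :: "('a::finite_field^'n) set"
  assumes "thin U"
  shows "card U \<le> CARD('a)"
proof (cases "\<exists>f\<in>U. f \<noteq> 0")
  case True
  then obtain f where f: "f \<in> U" "f \<noteq> 0" by blast
  have "U \<subseteq> (\<lambda>k. k *s f) ` UNIV"
    using assms f unfolding thin_def by blast
  then have "card U \<le> card ((\<lambda>k. k *s f) ` UNIV)"
    by (intro card_mono) auto
  also have "\<dots> \<le> CARD('a)"
    by (rule card_image_le) simp
  finally show ?thesis .
next
  case False
  then have "U \<subseteq> {0}" by blast
  then have "card U \<le> card {0 :: 'a^'n}"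
    by (intro card_mono) auto
  also have "\<dots> \<le> CARD('a)"
    using card_finite_field_ge_2[where ?'a = 'a] by simp
  finally show ?thesis .
qed

text \<open>Makes thinness of an intersection a proof that two planes are different, see
  \<open>distinct_subspace_points\<close>.\<close>

lemma not_thin_card_cube:
  fixes U :: "('a::finite_field^'n) set"
  assumes "card U = CARD('a) ^ 3"
  shows "\<not> thin U"
proof
  assume "thin U"
  then have "CARD('a) ^ 3 \<le> CARD('a) ^ 1"
    using card_thin_le[of U] assms by simp
  then show False
    using card_finite_field_ge_2[where ?'a = 'a] power_le_imp_le_exp[of "CARD('a)" 3 1] by simp
qed

lemma subspace_points_eq_imp:
  fixes U V :: "('k::field^'n) set"
  assumes "vec.subspace U" "vec.subspace V" "subspace_points U = subspace_points V"
  shows "U = V"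
proof -
  have *: "U \<subseteq> V" if "vec.subspace U" "vec.subspace V" "subspace_points U = subspace_points V" for U V :: "('k^'n) set"
  proof
    fix f assume f: "f \<in> U"
    show "f \<in> V"
    proof (cases "f = 0")
      case False
      then have "vec.span {f} \<in> subspace_points U"
        using f that(1) by (auto simp: subspace_points_def proj_points_def vec.span_minimal)
      then show ?thesis
        using that(3) vec.span_base[of f "{f}"] by (auto simp: subspace_points_def)
    qed (use that in \<open>simp add: vec.subspace_0\<close>)
  qed
  show ?thesis
    using *[OF assms] *[OF assms(2,1) assms(3)[symmetric]] by blast
qed

section \<open>Cross products, changes of basis and singular points\<close>

definition cross :: "'k::field^3 \<Rightarrow> 'k^3 \<Rightarrow> 'k^3" where
  "cross x y = vector [x$2 * y$3 - x$3 * y$2, x$3 * y$1 - x$1 * y$3, x$1 * y$2 - x$2 * y$1]"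

lemma cross_perp: "scalar_product x (cross x y) = 0" "scalar_product y (cross x y) = 0"
  by (simp_all add: scalar_product_3 cross_def algebra_simps)

lemma scalar_product_sym: "scalar_product x y = scalar_product y (x :: 'k::field^3)"
  by (simp add: scalar_product_3 mult.commute)

lemma scalar_product_scale: "scalar_product (c *s x) y = c * scalar_product x y"
  "scalar_product x (c *s y) = c * scalar_product x (y :: 'k::field^3)"
  by (simp_all add: scalar_product_3 algebra_simps)

lemma scalar_product_zero [simp]: "scalar_product 0 y = 0" "scalar_product y 0 = (0 :: 'k::field)" for y :: "'k::field^3"
  by (simp_all add: scalar_product_3)

lemma cross_eq_0_imp:
  assumes "cross x y = 0" "x \<noteq> 0"
  shows "\<exists>k. y = k *s x"
proof -
  have e: "x$2 * y$3 = x$3 * y$2" "x$3 * y$1 = x$1 * y$3" "x$1 * y$2 = x$2 * y$1"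
    using assms(1) by (simp_all add: cross_def vec_eq_iff forall_3)
  obtain i where i: "x $ i \<noteq> 0"
    using assms(2) by (auto simp: vec_eq_iff)
  have "x $ i * y $ j = y $ i * x $ j" for j
    using exhaust_3[of i] exhaust_3[of j] e by (elim disjE) (simp_all add: mult.commute)
  then have "y = (y $ i / x $ i) *s x"
    using i by (simp add: vec_eq_iff field_simps)
  then show ?thesis by blast
qed

lemma exists_nonperp: "l \<noteq> 0 \<Longrightarrow> \<exists>x. scalar_product l (x :: 'k::field^3) \<noteq> 0"
proof (rule ccontr)
  assume "l \<noteq> 0" "\<nexists>x. scalar_product l x \<noteq> 0"
  then have "scalar_product l x = 0" for x by blast
  from this[of "vector [1,0,0]"] this[of "vector [0,1,0]"] this[of "vector [0,0,1]"]
  show False using \<open>l \<noteq> 0\<close> by (simp add: scalar_product_3 vec_eq_iff forall_3)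
qed

lemma extend_to_frame:
  fixes y y' :: "'k::field^3"
  assumes "y \<noteq> 0" "\<nexists>k. y' = k *s y"
  obtains M :: "'k^3^3" where "det M \<noteq> 0" "column 1 M = y" "column 2 M = y'"
proof -
  define mk where "mk z = transpose (vector [y, y', z] :: 'k^3^3)" for z :: "'k^3"
  have col: "column 1 (mk z) = y" "column 2 (mk z) = y'" for z
    by (simp_all add: mk_def column_def transpose_def vec_eq_iff)
  have d: "det (mk z) = scalar_product (cross y y') z" for z
    by (simp add: det_3 mk_def transpose_def cross_def scalar_product_3 algebra_simps)
  have "cross y y' \<noteq> 0"
    using cross_eq_0_imp assms by blast
  then obtain z where "det (mk z) \<noteq> 0"
    unfolding d using exists_nonperp by blast
  then show thesis using that col by blast
qed

text \<open>The factor \<open>k\<close> admits nonsquare multiples of squares, and the zero form is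
  included. For a nonzero form this says that its quadric is a repeated line.\<close>

definition rep :: "'k::field^6 \<Rightarrow> bool" where
  "rep f \<longleftrightarrow> (\<exists>k l. f = k *s lin_mult l l)"

lemma lin_mult_scale: "lin_mult (c *s l) (d *s m) = (c * d) *s lin_mult l m"
  by (rule form_eqI) (simp add: qeval_lin_mult qeval_smult scalar_product_3 algebra_simps)

lemma rep_pullback: "rep f \<Longrightarrow> rep (pullback M f)"
  unfolding rep_def by (metis pullback_smult pullback_lin_mult)

lemma pullback_inverse:
  fixes M :: "'k::field^3^3"
  assumes "det M \<noteq> 0"
  obtains N where "det N \<noteq> 0" "M ** N = mat 1" "N ** M = mat 1" "\<And>f. pullback N (pullback M f) = f" "\<And>f. pullback M (pullback N f) = f"
proof -
  obtain N where N: "M ** N = mat 1" "N ** M = mat 1"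
    using assms by (auto simp: invertible_def simp flip: invertible_det_nz)
  have "det N \<noteq> 0"
    using N det_mul[of M N] by auto
  then show thesis
    using that N by (simp add: pullback_pullback)
qed

lemma sing_pullback:
  assumes "det M \<noteq> 0"
  shows "sing (pullback M f) y \<longleftrightarrow> sing f (M *v (y :: 'k::field^3))"
  unfolding sing_def qeval_pullback qpolar_pullback
  by (metis invertible_mult_vec_surj[OF assms])

text \<open>Move the two points to (1,0,0) and (0,1,0). Singularity there kills every coefficient
  except that of the third square, so what is left is the repeated line joining the points.\<close>

lemma sing_two_points:
  fixes y y' :: "'k::field^3"
  assumes "y \<noteq> 0" "\<nexists>k. y' = k *s y"
  obtains g where "rep g" "\<And>f. sing f y \<Longrightarrow> sing f y' \<Longrightarrow> \<exists>k. f = k *s g"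
proof -
  obtain M :: "'k^3^3" where M: "det M \<noteq> 0" "column 1 M = y" "column 2 M = y'"
    using extend_to_frame[OF assms] .
  obtain N where N: "\<And>f :: 'k^6. pullback N (pullback M f) = f"
    using pullback_inverse[OF M(1)] by metis
  define e :: "'k^3" where "e = vector [0,0,1]"
  have y: "y = M *v vector [1,0,0]" "y' = M *v vector [0,1,0]"
    using M by (simp_all add: matrix_vector_columns)
  have "\<exists>k. f = k *s pullback N (lin_mult e e)" if f: "sing f y" "sing f y'" for f
  proof -
    have s: "sing (pullback M f) (vector [1,0,0])" "sing (pullback M f) (vector [0,1,0])"
      using f M by (simp_all add: sing_pullback y)
    have p: "qpolar (pullback M f) z (vector [1,0,0]) = 0" "qpolar (pullback M f) z (vector [0,1,0]) = 0"
        "qeval (pullback M f) (vector [1,0,0]) = 0" "qeval (pullback M f) (vector [0,1,0]) = 0" for z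
      using s by (simp_all add: sing_def)
    have "pullback M f = (pullback M f $ 3) *s lin_mult e e"
      using p(1)[of "vector [0,1,0]"] p(1)[of "vector [0,0,1]"] p(2)[of "vector [0,0,1]"] p(3,4)
      by (simp add: vec_eq_iff forall_6 lin_mult_def e_def qpolar_expand qeval_def)
    then have "f = (pullback M f $ 3) *s pullback N (lin_mult e e)"
      by (metis N pullback_smult)
    then show ?thesis by blast
  qed
  moreover have "rep (pullback N (lin_mult e e))"
    unfolding rep_def by (metis pullback_lin_mult vec.scale_one)
  ultimately show thesis using that by blast
qed

lemma sing_unique:
  assumes "sing f y" "sing f y'" "y \<noteq> 0" "\<not> rep f"
  shows "\<exists>k. y' = k *s y"
proof (rule ccontr)
  assume "\<nexists>k. y' = k *s y"
  then obtain g where "rep g" "\<exists>k. f = k *s g"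
    using sing_two_points[of y y'] assms by metis
  then have "rep f"
    unfolding rep_def by (metis vec.scale_scale)
  then show False using assms(4) by simp
qed

lemma thin_sing_two_points:
  fixes y y' :: "'k::field^3"
  assumes "y \<noteq> 0" "\<nexists>k. y' = k *s y"
  shows "thin ({f. sing f y} \<inter> {f. sing f y'})"
proof (rule thinI)
  fix f h
  assume f: "f \<in> {f. sing f y} \<inter> {f. sing f y'}" and h: "h \<in> {f. sing f y} \<inter> {f. sing f y'}" and "f \<noteq> 0"
  obtain g where g: "\<And>f. sing f y \<Longrightarrow> sing f y' \<Longrightarrow> \<exists>k. f = k *s g"
    using sing_two_points[OF assms] by metis
  obtain k l where kl: "f = k *s g" "h = l *s g"
    using g f h by blast
  with \<open>f \<noteq> 0\<close> have "h = (l / k) *s f" by (auto simp: vec_eq_iff)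
  then show "\<exists>k. h = k *s f" by blast
qed

lemma finite_field_sqrt_char2:
  assumes "(2 :: 'a::finite_field) = 0"
  obtains y where "y^2 = (x :: 'a)"
proof -
  have "inj (\<lambda>y :: 'a. y^2)"
  proof (rule injI)
    fix y z :: 'a assume "y^2 = z^2"
    then have "(y - z)^2 = 2 * (z^2 - y * z)"
      by (simp add: power2_eq_square algebra_simps)
    then show "y = z" using assms by simp
  qed
  then have "surj (\<lambda>y :: 'a. y^2)"
    by (simp add: finite_UNIV_inj_surj)
  then show thesis
    using that by (metis surjD)
qed

text \<open>Every element of a finite field of characteristic 2 is a square and squaring is
  additive, so a diagonal form is the square of a linear form.\<close>

lemma rep_char2:
  fixes f :: "'a::finite_field^6"
  assumes "(2 :: 'a) = 0" "f$4 = 0" "f$5 = 0" "f$6 = 0"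
  shows "rep f"
proof -
  obtain a b c where abc: "a^2 = f$1" "b^2 = f$2" "c^2 = f$3"
    using finite_field_sqrt_char2[OF assms(1)] by metis
  have t: "x + x = 0" for x :: 'a
    using assms(1) by (metis mult_2 mult_zero_left)
  have "f = 1 *s lin_mult (vector [a,b,c]) (vector [a,b,c])"
    using abc assms(2-) t by (simp add: vec_eq_iff forall_6 lin_mult_def power2_eq_square mult.commute)
  then show ?thesis
    unfolding rep_def by blast
qed

section \<open>Planes spanned by degenerate quadrics\<close>

lemma scalar_product_frob: "scalar_product (ext_vec (l :: 'a::finite_field^3)) (frob_vec x) = fr (scalar_product (ext_vec l) x)"
  by (simp add: scalar_product_3)

text \<open>The form with squares \<open>a0\<close>, \<open>a1\<close>, \<open>a2\<close> and mixed
  coefficients \<open>b0\<close>, \<open>b2\<close>, \<open>b1\<close> is assumed singular at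
  (1,1,1). Its polar matrix then has zero row sums, so all its cofactors agree; \<open>e\<close> is
  their common value. The discriminant turns out to be \<open>e\<close> times the value of the form
  at (1,1,1), which settles characteristic 2 along with the rest.\<close>

lemma degenerate_disc:
  fixes b0 b1 b2 a0 a1 a2 :: "'k::field"
  assumes "2 * a0 + b0 + b2 = 0" "2 * a1 + b1 + b0 = 0" "2 * a2 + b2 + b1 = 0"
    and sum: "a0 + a1 + a2 + b0 + b1 + b2 = 0"
  shows "disc (vector [a0, a1, a2, b0, b2, b1] :: 'k^6) = 0"
    and "b0^2 - 4 * a0 * a1 = b1^2 - 4 * a1 * a2"
proof -
  define e where "e = b0 * b1 + b0 * b2 + b1 * b2"
  have a: "2 * a0 = - (b0 + b2)" "2 * a1 = - (b1 + b0)" "2 * a2 = - (b2 + b1)"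
    unfolding eq_neg_iff_add_eq_0 using assms(1-3) by (simp_all add: add.assoc)
  have m: "4 * x * y = (2 * x) * (2 * y)" for x y :: 'k
    by simp
  have e0: "b0^2 = 4 * a0 * a1 - e" and e1: "b1^2 = 4 * a1 * a2 - e" and e2: "b2^2 = 4 * a2 * a0 - e"
    unfolding m a e_def by (simp_all add: algebra_simps power2_eq_square)
  show "b0^2 - 4 * a0 * a1 = b1^2 - 4 * a1 * a2"
    unfolding e0 e1 by simp
  have "disc (vector [a0, a1, a2, b0, b2, b1] :: 'k^6) = 4 * a0 * a1 * a2 + b0 * b1 * b2 - a0 * b1^2 - a1 * b2^2 - a2 * b0^2"
    by (simp add: disc_def)
  also have "\<dots> = e * (a0 + a1 + a2) + b0 * b1 * b2 - (2 * a0) * (2 * a1) * (2 * a2)"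
    unfolding e0 e1 e2 by (simp add: algebra_simps)
  also have "\<dots> = e * (a0 + a1 + a2 + b0 + b1 + b2)"
    unfolding a e_def by (simp add: algebra_simps)
  finally show "disc (vector [a0, a1, a2, b0, b2, b1] :: 'k^6) = 0"
    by (simp only: sum mult_zero_right)
qed

context cubic_frame begin

lemma dot_cubic: "scalar_product (ext_vec l) v \<in> cubic"
  unfolding cubic_def by (simp add: cubic_v flip: scalar_product_frob)

text \<open>Dual to \<open>pt\<close>: a rational linear form is determined by its value at
  \<open>v\<close>, since Frobenius gives its values at the conjugates. Counting then gives
  surjectivity.\<close>

lemma dot_surj:
  assumes "r \<in> cubic"
  obtains l :: "'a^3" where "scalar_product (ext_vec l) v = r"
proof -
  have inj: "inj (\<lambda>l :: 'a^3. scalar_product (ext_vec l) v)"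
  proof (rule injI)
    fix l m :: "'a^3"
    assume e: "scalar_product (ext_vec l) v = scalar_product (ext_vec m) v"
    have "scalar_product (ext_vec l) (frame v *v x) = scalar_product (ext_vec m) (frame v *v x)" for x
    proof -
      have lin: "scalar_product u (frame v *v x) = x$1 * scalar_product u v + x$2 * scalar_product u (frob_vec v)
          + x$3 * scalar_product u (frob_vec (frob_vec v))" for u
        by (simp add: frame_mult_vec scalar_product_3 algebra_simps)
      show ?thesis
        unfolding lin scalar_product_frob e ..
    qed
    then have s: "scalar_product (ext_vec l) x = scalar_product (ext_vec m) x" for x
      using invertible_mult_vec_surj[OF det_frame] by metis
    show "l = m"
      using s[of "vector [1,0,0]"] s[of "vector [0,1,0]"] s[of "vector [0,0,1]"]
      by (simp add: scalar_product_3 vec_eq_iff forall_3)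
  qed
  have "range (\<lambda>l :: 'a^3. scalar_product (ext_vec l) v) = cubic"
  proof (rule card_seteq)
    show "range (\<lambda>l :: 'a^3. scalar_product (ext_vec l) v) \<subseteq> cubic"
      using dot_cubic by blast
    show "card (cubic :: 'a alg_closure set) \<le> card (range (\<lambda>l :: 'a^3. scalar_product (ext_vec l) v))"
      by (simp add: card_cubic card_image[OF inj])
  qed (rule finite_cubic)
  then have "r \<in> range (\<lambda>l :: 'a^3. scalar_product (ext_vec l) v)"
    using assms by simp
  then show thesis
    using that by auto
qed

text \<open>Converse of \<open>sing_pt\<close>. Conjugating the gradient equation in the direction
  \<open>v\<close> gives the directions of the two conjugates, and together these span
  everything.\<close>

lemma sing_ptI:
  assumes "s \<in> cubic" "2 * c0 f * s + c1 f * fr s + fr (fr (c1 f * s)) = 0" "tr (c0 f * s^2 + c1 f * s * fr s) = 0"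
  shows "sing f (pt s)"
proof -
  have "qpolar (ext_vec f) v (ext_vec (pt s)) = 0"
    using assms qpolar_v_pt by simp
  moreover from this have "qpolar (ext_vec f) (frob_vec v) (frob_vec (ext_vec (pt s))) = 0"
    by (simp only: qpolar_frob_vec fr_0)
  moreover from this have "qpolar (ext_vec f) (frob_vec (frob_vec v)) (frob_vec (frob_vec (ext_vec (pt s)))) = 0"
    by (simp only: qpolar_frob_vec fr_0)
  ultimately have "qpolar (ext_vec f) (frame v *v z) (ext_vec (pt s)) = 0" for z
    by (simp add: frame_mult_vec qpolar_sym[of _ _ "ext_vec (pt s)"] qpolar_add_right qpolar_scale_right)
  then have "qpolar (ext_vec f) z (ext_vec (pt s)) = 0" for z
    using invertible_mult_vec_surj[OF det_frame] by metis
  moreover have "to_ac (qeval f (pt s)) = 0"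
    using assms by (simp add: qeval_pt)
  ultimately have "sing (ext_vec f) (ext_vec (pt s))"
    by (simp add: sing_def qeval_ext_vec)
  then show ?thesis by (simp add: sing_ext_vec)
qed

text \<open>The square of the linear form with value \<open>r\<close> at \<open>v\<close> has
  coefficients \<open>r^2\<close> and \<open>2 * r * fr r\<close>.\<close>

lemma repI:
  assumes "r \<in> cubic" "c0 f = to_ac k * r^2" "c1 f = to_ac k * (2 * r * fr r)"
  shows "rep f"
proof -
  obtain l :: "'a^3" where l: "scalar_product (ext_vec l) v = r"
    using dot_surj[OF assms(1)] .
  have lm: "ext_vec (lin_mult l l) = lin_mult (ext_vec l) (ext_vec l)"
    by (simp add: vec_eq_iff forall_6 lin_mult_def)
  have "f = k *s lin_mult l l"
    unfolding form_eq_iff c0_linear c1_linear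
    using assms by (simp add: c0_def c1_def lm qeval_lin_mult qpolar_lin_mult scalar_product_frob l power2_eq_square algebra_simps)
  then show ?thesis
    unfolding rep_def by blast
qed

text \<open>By \<open>sing_form_cases\<close> these are the bi-lines and imaginary bi-lines centered
  at \<open>pt 1\<close>. The Singer group is transitive on points, so every orbit has such a
  representative.\<close>

definition base :: "'a^6 \<Rightarrow> bool" where
  "base g \<longleftrightarrow> g \<noteq> 0 \<and> sing g (pt 1) \<and> \<not> rep g"

lemma base_eqs:
  assumes "base g"
  shows "2 * c0 g + c1 g + fr (fr (c1 g)) = 0" "2 * fr (c0 g) + fr (c1 g) + c1 g = 0"
    "2 * fr (fr (c0 g)) + fr (fr (c1 g)) + fr (c1 g) = 0"
    "c0 g + fr (c0 g) + fr (fr (c0 g)) + c1 g + fr (c1 g) + fr (fr (c1 g)) = 0"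
proof -
  show *: "2 * c0 g + c1 g + fr (fr (c1 g)) = 0"
    using sing_pt[of 1 g] assms by (simp add: base_def cubic_simps)
  have "fr (2 * c0 g + c1 g + fr (fr (c1 g))) = 0"
    unfolding * by simp
  then show **: "2 * fr (c0 g) + fr (c1 g) + c1 g = 0"
    by (simp add: cubicD cubic_simps)
  have "fr (2 * fr (c0 g) + fr (c1 g) + c1 g) = 0"
    unfolding ** by simp
  then show "2 * fr (fr (c0 g)) + fr (fr (c1 g)) + fr (c1 g) = 0"
    by simp
  have "tr (c0 g + c1 g) = 0"
    using qeval_pt[of 1 g] assms by (simp add: base_def sing_def cubic_simps)
  then show "c0 g + fr (c0 g) + fr (fr (c0 g)) + c1 g + fr (c1 g) + fr (fr (c1 g)) = 0"
    by (simp add: tr_def algebra_simps)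
qed

lemma disc_base: "base g \<Longrightarrow> disc g = 0"
  unfolding disc_eq_0_iff by (rule degenerate_disc(1)) (use base_eqs in auto)

lemma base_c0: "base g \<Longrightarrow> c0 g \<noteq> 0"
  using disc_base disc_bundle_nonzero by (auto simp: base_def)

text \<open>If \<open>c1 g = 0\<close>, the singularity at \<open>pt 1\<close> gives
  \<open>2 * c0 g = 0\<close>, so the characteristic is 2 and the polar form vanishes. Then
  \<open>g\<close> is diagonal, hence a square by \<open>rep_char2\<close>.\<close>

lemma base_c1:
  assumes g: "base g"
  shows "c1 g \<noteq> 0"
proof
  assume c1: "c1 g = 0"
  have "2 * c0 g = 0"
    using base_eqs(1)[OF g] c1 by simp
  then have two: "(2 :: 'a alg_closure) = 0"
    using base_c0[OF g] by simp
  have "to_ac (2 :: 'a) = 0"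
    by (simp add: two)
  then have two': "(2 :: 'a) = 0"
    unfolding to_ac_eq_0_iff .
  have "qpolar (ext_vec g) (frame v *v x) (frame v *v y) = 0" for x y
    unfolding qpolar_pullback[symmetric] pullback_frame by (simp add: c1 qpolar_expand two)
  then have "qpolar (ext_vec g) x y = 0" for x y
    using invertible_mult_vec_surj[OF det_frame] by metis
  then have p: "qpolar g x y = 0" for x y
    using qpolar_ext_vec[of g x y] by simp
  have "rep g"
    using p[of "vector [1,0,0]" "vector [0,1,0]"] p[of "vector [1,0,0]" "vector [0,0,1]"] p[of "vector [0,1,0]" "vector [0,0,1]"]
    by (intro rep_char2 two') (simp_all add: qpolar_expand)
  then show False
    using g by (simp add: base_def)
qed

text \<open>Multiplication of \<open>s\<close> by \<open>u\<close> turns \<open>g\<close> into the form with coefficients \<open>c0 g * u^2\<close> and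
  \<open>c1 g * u * fr u\<close>. The equation below says that the symmetric tensor with diagonal entry \<open>c0 f / c0 g\<close>
  and off-diagonal entry \<open>c1 f / c1 g\<close> (\<open>u^2\<close> and \<open>u * fr u\<close> in the case just mentioned) is annihilated
  by \<open>c\<close>, that is, that \<open>u\<close> lies on the line \<open>tr (c * u) = 0\<close>.\<close>

definition bplane :: "'a^6 \<Rightarrow> 'a alg_closure \<Rightarrow> ('a^6) set" where
  "bplane g c = {f. c * c0 f / c0 g + fr c * c1 f / c1 g + fr (fr (c * c1 f / c1 g)) = 0}"

definition slopeA :: "'a^6 \<Rightarrow> 'a alg_closure \<Rightarrow> 'a alg_closure" where
  "slopeA g c = - (c0 g * fr c / (c1 g * c))"

definition slopeB :: "'a^6 \<Rightarrow> 'a alg_closure \<Rightarrow> 'a alg_closure" where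
  "slopeB g c = - (c0 g * fr (fr c) / (fr (fr (c1 g)) * c))"

lemma bplane_iff:
  assumes "base g" "c \<noteq> 0"
  shows "f \<in> bplane g c \<longleftrightarrow> c0 f = slopeA g c * c1 f + slopeB g c * fr (fr (c1 f))"
  using base_c0[OF assms(1)] base_c1[OF assms(1)] assms(2)
  by (simp add: bplane_def slopeA_def slopeB_def field_simps eq_neg_iff_add_eq_0)

lemma subspace_bplane: "vec.subspace (bplane g c)"
proof -
  define F where "F f = c * c0 f / c0 g + fr c * c1 f / c1 g + fr (fr (c * c1 f / c1 g))" for f
  have add: "F (f + h) = F f + F h" for f h
    by (simp add: F_def c0_linear c1_linear distrib_left distrib_right add_divide_distrib)
  have scale: "F (k *s f) = to_ac k * F f" for k f
    by (simp add: F_def c0_linear c1_linear distrib_left mult.left_commute)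
  have "F 0 = 0"
    by (simp add: F_def c0_linear c1_linear)
  then show ?thesis
    unfolding bplane_def F_def[symmetric] by (intro vec.subspaceI) (simp_all add: add scale)
qed

lemma card_graph:
  assumes "\<And>t. t \<in> cubic \<Longrightarrow> h t \<in> cubic"
  shows "card {f. c0 f = h (c1 f)} = CARD('a) ^ 3"
proof -
  have "bij_betw c1 {f. c0 f = h (c1 f)} cubic"
  proof (rule bij_betw_imageI)
    show "inj_on c1 {f. c0 f = h (c1 f)}"
      by (rule inj_onI) (simp add: form_eq_iff)
    show "c1 ` {f. c0 f = h (c1 f)} = cubic"
    proof (intro equalityI subsetI)
      fix t :: "'a alg_closure" assume t: "t \<in> cubic"
      obtain f where "c0 f = h t" "c1 f = t"
        using form_exists[OF assms[OF t] t] .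
      then show "t \<in> c1 ` {f. c0 f = h (c1 f)}" by auto
    qed (auto simp: c1_cubic)
  qed
  from bij_betw_same_card[OF this] show ?thesis by (simp add: card_cubic)
qed

lemma slopes_cubic: "c \<in> cubic \<Longrightarrow> slopeA g c \<in> cubic" "c \<in> cubic \<Longrightarrow> slopeB g c \<in> cubic"
  by (simp_all add: slopeA_def slopeB_def cubic_simps)

lemma card_bplane:
  assumes "base g" "c \<in> cubic" "c \<noteq> 0"
  shows "card (bplane g c) = CARD('a) ^ 3"
proof -
  have "bplane g c = {f. c0 f = slopeA g c * c1 f + slopeB g c * fr (fr (c1 f))}"
    using bplane_iff[OF assms(1,3)] by blast
  then show ?thesis
    using card_graph[of "\<lambda>t. slopeA g c * t + slopeB g c * fr (fr t)"] assms by (simp add: cubic_simps slopes_cubic)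
qed

lemma cubic_ratio:
  assumes "s \<in> cubic" "t \<in> cubic" "s \<noteq> 0" "fr (fr t) * s = t * fr (fr s)"
  obtains k where "t = to_ac k * s"
proof -
  have "t / s \<in> cubic" using assms by (simp add: cubic_intros)
  moreover have "fr (fr (t / s)) = t / s" using assms by (simp add: field_simps)
  ultimately have "fr (t / s) = t / s" by (rule fr_fr_fixed_imp)
  then obtain k where "t / s = to_ac k" by (metis fr_fixed_iff imageE)
  then show thesis using that assms(3) by (simp add: field_simps)
qed

text \<open>Here \<open>b\<close> cannot vanish, so the equations force
  \<open>fr (fr t) / t = fr (fr s) / s\<close> for nonzero \<open>t\<close>. The quotient
  \<open>t / s\<close> is thus fixed by the square of \<open>fr\<close> and lies in GF(q).\<close>

lemma binomial_kernel:
  assumes "s \<in> cubic" "t \<in> cubic" "s \<noteq> 0" "a * s + b * fr (fr s) = 0" "a * t + b * fr (fr t) = 0"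
    and "a \<noteq> 0 \<or> b \<noteq> 0"
  obtains k where "t = to_ac k * s"
proof -
  have "b \<noteq> 0" using assms by auto
  moreover have "b * (fr (fr t) * s) = b * (t * fr (fr s))"
  proof -
    have "b * (fr (fr t) * s) = (b * fr (fr t)) * s" by simp
    also have "\<dots> = - (a * t) * s" using assms(5) by (metis add.commute eq_neg_iff_add_eq_0)
    also have "\<dots> = t * - (a * s)" by simp
    also have "\<dots> = t * (b * fr (fr s))" using assms(4) by (metis add.commute eq_neg_iff_add_eq_0)
    finally show ?thesis by simp
  qed
  ultimately show thesis
    using cubic_ratio[OF assms(1-3)] that by auto
qed

text \<open>On the space of forms the plane is the graph of \<open>c0\<close> as a function of \<open>c1\<close>; so a linear
  binomial equation in \<open>c1\<close> cuts out at most a point.\<close>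

lemma thin_bplane_Int:
  assumes "base g" "c \<noteq> 0" "a \<noteq> 0 \<or> b \<noteq> 0"
    and "\<And>f. f \<in> bplane g c \<Longrightarrow> f \<in> U \<Longrightarrow> a * c1 f + b * fr (fr (c1 f)) = 0"
  shows "thin (bplane g c \<inter> U)"
proof (rule thinI)
  fix f h assume f: "f \<in> bplane g c \<inter> U" and h: "h \<in> bplane g c \<inter> U" and "f \<noteq> 0"
  have f0: "c0 f = slopeA g c * c1 f + slopeB g c * fr (fr (c1 f))"
    and h0: "c0 h = slopeA g c * c1 h + slopeB g c * fr (fr (c1 h))"
    using f h assms by (simp_all add: bplane_iff)
  then have "c1 f \<noteq> 0" using \<open>f \<noteq> 0\<close> by (auto simp: form_eq_0_iff)
  then obtain k where k: "c1 h = to_ac k * c1 f"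
    using binomial_kernel[of "c1 f" "c1 h" a b] f h assms by (auto simp: c1_cubic)
  have "h = k *s f"
    unfolding form_eq_iff c0_linear c1_linear using f0 h0 k by (simp add: algebra_simps)
  then show "\<exists>k. h = k *s f" by blast
qed

lemma thin_bplane_bplane:
  assumes "base g" "base g'" "c \<noteq> 0" "c' \<noteq> 0" "slopeA g c \<noteq> slopeA g' c' \<or> slopeB g c \<noteq> slopeB g' c'"
  shows "thin (bplane g c \<inter> bplane g' c')"
proof (rule thin_bplane_Int[where a = "slopeA g c - slopeA g' c'" and b = "slopeB g c - slopeB g' c'"])
  fix f assume "f \<in> bplane g c" "f \<in> bplane g' c'"
  then have "slopeA g c * c1 f + slopeB g c * fr (fr (c1 f)) = slopeA g' c' * c1 f + slopeB g' c' * fr (fr (c1 f))"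
    using assms by (simp add: bplane_iff)
  then show "(slopeA g c - slopeA g' c') * c1 f + (slopeB g c - slopeB g' c') * fr (fr (c1 f)) = 0"
    by (simp add: algebra_simps)
qed (use assms in auto)

text \<open>Inserting the graph of \<open>bplane g c\<close> into the gradient equation of
  \<open>sing_pt\<close> gives a binomial in \<open>c1 f\<close>. Were both its coefficients zero,
  the characteristic would be odd and \<open>g\<close> would be a multiple of a square, against
  \<open>base g\<close>.\<close>

lemma thin_bplane_sing:
  assumes g: "base g" and c: "c \<in> cubic" "c \<noteq> 0" and s: "s \<in> cubic" "s \<noteq> 0"
  shows "thin (bplane g c \<inter> {f. sing f (pt s)})"
proof (rule thin_bplane_Int[where a = "2 * slopeA g c * s + fr s" and b = "2 * slopeB g c * s + fr (fr s)"])
  show "base g" "c \<noteq> 0" by fact+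
  fix f assume "f \<in> bplane g c" "f \<in> {f. sing f (pt s)}"
  then show "(2 * slopeA g c * s + fr s) * c1 f + (2 * slopeB g c * s + fr (fr s)) * fr (fr (c1 f)) = 0"
    using sing_pt[OF s(1), of f] bplane_iff[OF g c(2)] by (simp add: algebra_simps)
next
  show "2 * slopeA g c * s + fr s \<noteq> 0 \<or> 2 * slopeB g c * s + fr (fr s) \<noteq> 0"
  proof (rule ccontr)
    define z where "z = s / c"
    define a b where "a = c0 g" and "b = c1 g"
    have z: "z \<in> cubic" "z \<noteq> 0" using c s by (simp_all add: z_def cubic_intros)
    have ab: "a \<in> cubic" "b \<in> cubic" "a \<noteq> 0" "b \<noteq> 0"
      using g by (simp_all add: a_def b_def base_c0 base_c1 cubic_simps)
    assume "\<not> ?thesis"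
    then have "2 * slopeA g c * s + fr s = 0" "2 * slopeB g c * s + fr (fr s) = 0" by auto
    moreover have s': "s = z * c" using c by (simp add: z_def)
    ultimately have 1: "2 * a * z = b * fr z" and 2: "2 * a * z = fr (fr b) * fr (fr z)"
      using c ab z unfolding slopeA_def slopeB_def a_def[symmetric] b_def[symmetric]
      by (simp_all add: field_simps eq_neg_iff_add_eq_0)
    have two: "(2 :: 'a alg_closure) \<noteq> 0"
      using 1 z ab by auto
    then have two': "(2 :: 'a) \<noteq> 0"
      by (metis to_ac_0 to_ac_numeral)
    \<comment> \<open>The scalar with \<open>2 * g\<close> equal to \<open>w\<close> times the
      square of the linear form whose value at \<open>v\<close> is \<open>inverse z\<close>; the two
      equations show that it lies in GF(q).\<close>
    define w where "w = b * z * fr z"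
    have "fr (fr w) = w"
      using 1 2 by (simp add: w_def cubicD[OF z(1)] algebra_simps)
    moreover have "w \<in> cubic" using z ab by (simp add: w_def cubic_intros)
    ultimately have "fr w = w" by (metis fr_fr_fixed_imp)
    then obtain k where k: "w = to_ac k" by (metis fr_fixed_iff imageE)
    have "rep g"
    proof (rule repI[of "inverse z" _ "k / 2"])
      show "inverse z \<in> cubic" using z by (simp add: cubic_intros)
      have "2 * a * z^2 = w" using 1 by (simp add: w_def power2_eq_square algebra_simps)
      then show "c0 g = to_ac (k / 2) * (inverse z)^2"
        using z two unfolding k a_def by (simp add: field_simps)
      show "c1 g = to_ac (k / 2) * (2 * inverse z * fr (inverse z))"
        using z two unfolding to_ac_divide k[symmetric] w_def b_def by (simp add: field_simps)
    qed
    then show False using g by (simp add: base_def)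
  qed
qed

text \<open>Equal slopes say that \<open>g'\<close> is, up to a factor \<open>k\<close> in GF(q),
  the image of \<open>g\<close> under the substitution of \<open>r * s\<close> for \<open>s\<close>,
  where \<open>r = c' / c\<close>. As \<open>g'\<close> is singular at \<open>pt 1\<close>,
  \<open>g\<close> is singular at \<open>pt r\<close>; the vertex of \<open>g\<close> being unique,
  \<open>r\<close> is in GF(q).\<close>

lemma slopes_inj:
  assumes g: "base g" "base g'" and c: "c \<in> cubic" "c \<noteq> 0" "c' \<in> cubic" "c' \<noteq> 0"
    and eq: "slopeA g c = slopeA g' c'" "slopeB g c = slopeB g' c'"
  shows "\<exists>k l. g' = k *s g \<and> c' = to_ac l * c"
proof -
  define r where "r = c' / c"
  define a b where "a = c0 g" and "b = c1 g"
  define a' b' where "a' = c0 g'" and "b' = c1 g'"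
  note abs = a_def[symmetric] b_def[symmetric] a'_def[symmetric] b'_def[symmetric]
  have ab: "a \<in> cubic" "b \<in> cubic" "a' \<in> cubic" "b' \<in> cubic" "a \<noteq> 0" "b \<noteq> 0" "a' \<noteq> 0" "b' \<noteq> 0"
    using g by (simp_all add: a_def b_def a'_def b'_def base_c0 base_c1 cubic_simps)
  have r: "r \<in> cubic" "r \<noteq> 0" and c': "c' = r * c"
    using c by (simp_all add: r_def cubic_intros)
  have 1: "a * b' * r = a' * b * fr r" and 2: "a * fr (fr b') * r = a' * fr (fr b) * fr (fr r)"
    using eq c ab r unfolding slopeA_def slopeB_def abs c' by (simp_all add: field_simps)
  define w where "w = b' / (b * (r * fr r))"
  have "w \<in> cubic" using ab r by (simp add: w_def cubic_intros)
  have "a * r * (b' * (fr (fr b) * fr (fr r))) = (a * b' * r) * (fr (fr b) * fr (fr r))"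
    by (simp only: mult_ac)
  also have "\<dots> = (a' * fr (fr b) * fr (fr r)) * (b * fr r)"
    unfolding 1 by (simp only: mult_ac)
  also have "\<dots> = a * r * (fr (fr b') * (b * fr r))"
    unfolding 2[symmetric] by (simp only: mult_ac)
  finally have "a * r * (b' * (fr (fr b) * fr (fr r))) = a * r * (fr (fr b') * (b * fr r))" .
  then have "b' * (fr (fr b) * fr (fr r)) = fr (fr b') * (b * fr r)"
    using ab r by simp
  then have "fr (fr w) = w"
    using ab r by (simp add: w_def cubicD[OF r(1)] field_simps)
  then have "fr w = w" using \<open>w \<in> cubic\<close> by (metis fr_fr_fixed_imp)
  then obtain k where k: "w = to_ac k" by (metis fr_fixed_iff imageE)
  have b': "b' = to_ac k * (b * (r * fr r))"
    using ab r unfolding k[symmetric] w_def by simp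
  have a': "a' = to_ac k * (a * r^2)"
    using 1 ab r unfolding b' by (simp add: power2_eq_square algebra_simps)
  have k0: "to_ac k \<noteq> 0" using b' ab by auto
  have "sing g (pt r)"
  proof (rule sing_ptI[OF r(1)], unfold abs)
    have "2 * a' + b' + fr (fr b') = 0"
      using base_eqs(1)[OF g(2)] unfolding abs .
    then have "to_ac k * r * (2 * a * r + b * fr r + fr (fr (b * r))) = 0"
      unfolding a' b' by (simp add: cubicD[OF r(1)] power2_eq_square algebra_simps)
    then show "2 * a * r + b * fr r + fr (fr (b * r)) = 0"
      using k0 r by simp
    have "tr (a' + b') = 0"
      using base_eqs(4)[OF g(2)] unfolding abs tr_def by (simp add: algebra_simps)
    then have "to_ac k * tr (a * r^2 + b * r * fr r) = 0"
      unfolding a' b' tr_def by (simp add: algebra_simps)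
    then show "tr (a * r^2 + b * r * fr r) = 0"
      using k0 by simp
  qed
  then obtain l where "pt r = l *s pt 1"
    using sing_unique[of g "pt 1" "pt r"] g(1) by (auto simp: base_def pt_eq_0_iff cubic_intros)
  then have "pt r = pt (to_ac l * 1)"
    by (simp only: pt_scale cubic_intros)
  then have l: "r = to_ac l"
    using r by (simp add: pt_eq_iff cubic_intros)
  have "g' = (k * l^2) *s g"
    unfolding form_eq_iff c0_linear c1_linear using a' b' l by (simp add: abs power2_eq_square algebra_simps)
  then show ?thesis
    using c' l by blast
qed

end

section \<open>Planes of conics\<close>

definition through :: "'a::finite_field alg_closure^3 \<Rightarrow> ('a^6) set" where
  "through w = {f. qeval (ext_vec f) w = 0}"

lemma subspace_through: "vec.subspace (through w)"
  by (rule vec.subspaceI) (simp_all add: through_def qeval_plus qeval_smult)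

lemma through_scale: "k \<noteq> 0 \<Longrightarrow> through (k *s w) = through w"
  by (simp add: through_def qeval_scale)

lemma through_frob: "through (frob_vec w) = through w"
  by (simp add: through_def qeval_frob_vec)

text \<open>The planes \<open>bplane g c\<close> are Hadamard products of the degenerate form \<open>g\<close> with the symmetric
  tensors annihilated by \<open>c\<close>. The discriminant vanishes on the conic of rank one tensors
  \<open>p * r + r * t + t * p = 0\<close>, so the cubic splits off a line.\<close>

lemma hadamard_disc:
  fixes p r t :: "'k::field"
  shows "- 4 * a0 * a1 * a2 * (p + t) * (r + p) * (t + r) + b0 * b1 * b2 * p * r * t
      + a0 * (p + t) * (b1 * r)^2 + a1 * (r + p) * (b2 * t)^2 + a2 * (t + r) * (b0 * p)^2
    = (p * r + r * t + t * p) * (a2 * (b0^2 - 4 * a0 * a1) * p + a0 * (b1^2 - 4 * a1 * a2) * r + a1 * (b2^2 - 4 * a2 * a0) * t)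
      + p * r * t * (4 * a0 * a1 * a2 + b0 * b1 * b2 - a0 * b1^2 - a1 * b2^2 - a2 * b0^2)"
  by (simp add: power2_eq_square algebra_simps)

text \<open>With \<open>l0\<close>, \<open>l1\<close>, \<open>l2\<close> the conjugates of
  \<open>c\<close>, a symmetric tensor annihilated by them has off-diagonal entries
  \<open>p\<close>, \<open>r\<close>, \<open>t\<close> and diagonal entries minus the sums of two of
  these, after rescaling. In \<open>hadamard_disc\<close> the three quantities
  \<open>b0^2 - 4 * a0 * a1\<close> and so on equal a common \<open>d\<close>, which leaves a
  quadratic times a linear factor; the summand with \<open>p * r * t\<close> carries the
  discriminant of the degenerate form and drops out.\<close>

lemma hadamard_degenerate:
  fixes p r t :: "'k::field"
  assumes "disc (vector [a0, a1, a2, b0, b2, b1] :: 'k^6) = 0"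
    and "b0^2 - 4 * a0 * a1 = d" "b1^2 - 4 * a1 * a2 = d" "b2^2 - 4 * a2 * a0 = d"
    and "a2 * p + a0 * r + a1 * t = 0"
    and nz: "l0 \<noteq> 0" "l1 \<noteq> 0" "l2 \<noteq> 0"
  shows "disc (vector [- (a0 * (p + t) / l0^2), - (a1 * (r + p) / l1^2), - (a2 * (t + r) / l2^2),
    b0 * p / (l0 * l1), b2 * t / (l2 * l0), b1 * r / (l1 * l2)] :: 'k^6) = 0" (is "disc ?f = 0")
proof -
  have "(l0 * l1 * l2)^2 * disc ?f = - 4 * a0 * a1 * a2 * (p + t) * (r + p) * (t + r) + b0 * b1 * b2 * p * r * t
      + a0 * (p + t) * (b1 * r)^2 + a1 * (r + p) * (b2 * t)^2 + a2 * (t + r) * (b0 * p)^2"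
    using nz by (simp add: disc_def power2_eq_square field_simps)
  also have "\<dots> = (p * r + r * t + t * p) * (d * (a2 * p + a0 * r + a1 * t))
      + p * r * t * disc (vector [a0, a1, a2, b0, b2, b1] :: 'k^6)"
    unfolding hadamard_disc assms(2-4) by (simp add: disc_def algebra_simps)
  finally have "(l0 * l1 * l2)^2 * disc ?f = 0"
    by (simp only: assms mult_zero_right add_0)
  then show ?thesis using nz by simp
qed

context cubic_frame begin

lemma through_eq: "through v = {f. c0 f = 0}"
  by (simp add: through_def c0_def)

lemma card_through: "card (through v) = CARD('a) ^ 3"
  using card_graph[of "\<lambda>_. 0"] by (simp add: through_eq cubic_intros)

lemma through_disc: "f \<in> through v \<Longrightarrow> f \<noteq> 0 \<Longrightarrow> disc f \<noteq> 0"
  by (simp add: through_eq disc_bundle_nonzero)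

lemma disc_bplane:
  assumes g: "base g" and c: "c \<in> cubic" "c \<noteq> 0" and f: "f \<in> bplane g c"
    and psi: "tr (fr (fr (c0 g)) * (c * fr c * c1 f / c1 g)) = 0"
  shows "disc f = 0"
proof -
  \<comment> \<open>The off-diagonal entry \<open>c1 f / c1 g\<close> of the tensor, rescaled so
    that its conjugates are the \<open>r\<close> and \<open>t\<close> of
    \<open>hadamard_degenerate\<close>.\<close>
  define p where "p = c * fr c * c1 f / c1 g"
  define a b where "a = c0 g" and "b = c1 g"
  have ab: "a \<in> cubic" "b \<in> cubic" "a \<noteq> 0" "b \<noteq> 0"
    using g by (simp_all add: a_def b_def base_c0 base_c1 cubic_simps)
  have p: "p \<in> cubic" using c g by (simp add: p_def cubic_simps)
  have c1f: "c1 f = b * p / (c * fr c)"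
    using c ab by (simp add: p_def flip: b_def)
  have "c * c0 f / a + fr c * c1 f / b + fr (fr (c * c1 f / b)) = 0"
    using f unfolding bplane_def a_def b_def by simp
  also have "c * c0 f / a + fr c * c1 f / b + fr (fr (c * c1 f / b)) = c * c0 f / a + (p + fr (fr p)) / c"
    unfolding c1f using c ab by (simp add: cubicD[OF c(1)] add_divide_distrib)
  finally have c0f: "c0 f = - (a * (p + fr (fr p)) / c^2)"
    using c ab by (simp add: field_simps power2_eq_square eq_neg_iff_add_eq_0)
  note cs = cubicD[OF c(1)] cubicD[OF p] cubicD[OF ab(1)] cubicD[OF ab(2)]
  have eqs: "b^2 - 4 * a * fr a = fr b^2 - 4 * fr a * fr (fr a)"
    "disc (vector [a, fr a, fr (fr a), b, fr (fr b), fr b] :: 'a alg_closure^6) = 0"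
    using degenerate_disc[OF base_eqs[OF g]] unfolding a_def[symmetric] b_def[symmetric] by blast+
  have eqs': "fr (fr b)^2 - 4 * fr (fr a) * a = fr b^2 - 4 * fr a * fr (fr a)"
    using arg_cong[OF eqs(1), of fr] by (simp add: cs)
  have "disc (vector [- (a * (p + fr (fr p)) / c^2), - (fr a * (fr p + p) / (fr c)^2), - (fr (fr a) * (fr (fr p) + fr p) / (fr (fr c))^2),
    b * p / (c * fr c), fr (fr b) * fr (fr p) / (fr (fr c) * c), fr b * fr p / (fr c * fr (fr c))] :: 'a alg_closure^6) = 0"
  proof (rule hadamard_degenerate)
    show "fr (fr a) * p + a * fr p + fr a * fr (fr p) = 0"
      using psi unfolding p_def[symmetric] a_def[symmetric] tr_def by (simp add: cs add.commute add.left_commute)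
  qed (use eqs eqs' c in auto)
  then show ?thesis
    unfolding disc_eq_0_iff c0f c1f by (simp add: cs)
qed

text \<open>The map \<open>psi\<close> is the linear factor of the discriminant on
  \<open>bplane g c\<close>, as a functional with values in GF(q). A nonzero form in its kernel
  would be degenerate, whereas nonzero forms of \<open>through w\<close> are not. So
  \<open>psi\<close> is injective on the intersection, whose dimension is therefore at most
  one.\<close>

lemma thin_through_bplane:
  assumes g: "base g" and c: "c \<in> cubic" "c \<noteq> 0" and w: "cubic_frame w"
  shows "thin (through w \<inter> bplane g c)"
proof (rule thinI)
  interpret w: cubic_frame w by fact
  define psi where "psi f = of_ac (tr (fr (fr (c0 g)) * (c * fr c * c1 f / c1 g)))" for f
  have psi: "to_ac (psi f) = tr (fr (fr (c0 g)) * (c * fr c * c1 f / c1 g))" for f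
  proof -
    have "fr (fr (c0 g)) * (c * fr c * c1 f / c1 g) \<in> cubic"
      using c by (simp add: cubic_simps)
    then show ?thesis
      unfolding psi_def by (intro to_ac_of_ac) (metis fr_tr fr_fixed_iff)
  qed
  have disc: "disc f = 0" if "f \<in> bplane g c" "psi f = 0" for f
    using disc_bplane[OF g c that(1)] psi[of f] that(2) by simp
  fix f h assume f: "f \<in> through w \<inter> bplane g c" and h: "h \<in> through w \<inter> bplane g c" and "f \<noteq> 0"
  then have "psi f \<noteq> 0"
    using disc w.through_disc by blast
  \<comment> \<open>The combination of \<open>f\<close> and \<open>h\<close> on which
    \<open>psi\<close> vanishes.\<close>
  define k where "k = h + (- psi h / psi f) *s f"
  have "to_ac (psi k) = to_ac (psi h) + to_ac (- psi h / psi f) * to_ac (psi f)"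
  proof -
    have lin: "tr (x + to_ac r * y) = tr x + to_ac r * tr y" for x y :: "'a alg_closure" and r
      by (simp add: tr_def distrib_left)
    show ?thesis
      unfolding psi lin[symmetric] k_def c1_linear
      by (simp only: distrib_left add_divide_distrib times_divide_eq_right mult_ac)
  qed
  also have "\<dots> = 0" using \<open>psi f \<noteq> 0\<close> by simp
  finally have "psi k = 0" by simp
  moreover have "k \<in> through w" "k \<in> bplane g c"
    unfolding k_def using f h
    by (blast intro: vec.subspace_add vec.subspace_scale subspace_through subspace_bplane)+
  ultimately have "k = 0"
    using disc w.through_disc by blast
  then have "h = (psi h / psi f) *s f"
    by (simp add: k_def vec_eq_iff algebra_simps)
  then show "\<exists>k. h = k *s f" by blast
qed

lemma two_linear_eqs:
  fixes x y z :: "'k::field"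
  assumes "x + y + z = 0" "a * x + b * y + c * z = 0"
  shows "(c - a) * x = (b - c) * y"
proof -
  have z: "z = - (x + y)"
    using assms(1) by (metis add.commute eq_neg_iff_add_eq_0)
  have "a * x + b * y + c * (- (x + y)) = 0"
    using assms(2) by (simp only: z)
  then show ?thesis
    by (simp add: algebra_simps)
qed

lemma frame_det_zeroI:
  assumes "frob_vec w = k *s w"
  shows "det (frame w) = 0"
proof -
  have "fr (w $ i) = k * w $ i" for i
    using assms by (simp add: vec_eq_iff)
  then show ?thesis by (simp add: det_3 algebra_simps)
qed

text \<open>Two conics of the bundle meet outside the triangle in one further point, whose coordinates
  are the reciprocals of a conjugate triple; hence that point is fixed by the Frobenius map.\<close>

lemma thin_through_through:
  assumes w: "cubic_frame w"
    and nv: "\<nexists>k. w = k *s v" "\<nexists>k. w = k *s frob_vec v" "\<nexists>k. w = k *s frob_vec (frob_vec v)"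
  shows "thin (through v \<inter> through w)"
proof (rule thinI)
  interpret w: cubic_frame w by fact
  fix f h assume f: "f \<in> through v \<inter> through w" and h: "h \<in> through v \<inter> through w" and "f \<noteq> 0"
  obtain z where z: "w = frame v *v z"
    using invertible_mult_vec_surj[OF det_frame] by blast
  define z1 z2 z3 where "z1 = z $ 1" and "z2 = z $ 2" and "z3 = z $ 3"
  have wz: "w = z1 *s v + z2 *s frob_vec v + z3 *s frob_vec (frob_vec v)"
    by (simp add: z frame_mult_vec z1_def z2_def z3_def)
  have on: "c1 f * (z1 * z2) + fr (c1 f) * (z2 * z3) + fr (fr (c1 f)) * (z3 * z1) = 0" if "f \<in> through v \<inter> through w" for f
  proof -
    have "qeval (pullback (frame v) (ext_vec f)) z = 0"
      using that by (simp add: qeval_pullback through_def z)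
    then show ?thesis
      using that unfolding pullback_frame through_eq
      by (simp add: qeval_def z1_def z2_def z3_def algebra_simps)
  qed
  define t where "t = c1 f"
  have t: "t \<noteq> 0" "t \<in> cubic"
    using f \<open>f \<noteq> 0\<close> by (auto simp: form_eq_0_iff through_eq t_def c1_cubic)
  define s where "s = c1 h / t"
  have s: "s \<in> cubic" "c1 h = s * t" using t by (simp_all add: s_def cubic_simps)
  have "fr s = s"
  proof (rule ccontr)
    assume ns: "fr s \<noteq> s"
    \<comment> \<open>The products \<open>t * (z1 * z2)\<close> and its two companions satisfy the
      linear equations with coefficients (1,1,1) and (\<open>s\<close>, \<open>fr s\<close>,
      \<open>fr (fr s)\<close>). They are therefore \<open>m\<close> times the differences of
      conjugates of \<open>s\<close>.\<close>
    define m where "m = fr t * (z2 * z3) / (fr (fr s) - s)"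
    have ns2: "fr (fr s) - s \<noteq> 0" using ns s fr_fr_fixed_imp by auto
    have ns3: "fr s - fr (fr s) \<noteq> 0" using ns by simp
    have 1: "t * (z1 * z2) + fr t * (z2 * z3) + fr (fr t) * (z3 * z1) = 0"
      using on[OF f] by (simp add: t_def)
    have 2: "s * (t * (z1 * z2)) + fr s * (fr t * (z2 * z3)) + fr (fr s) * (fr (fr t) * (z3 * z1)) = 0"
      using on[OF h] by (simp add: s(2) mult.assoc)
    have m23: "fr t * (z2 * z3) = m * (fr (fr s) - s)"
      using ns2 by (simp add: m_def)
    have m12: "t * (z1 * z2) = m * (fr s - fr (fr s))"
    proof -
      have "(fr (fr s) - s) * (t * (z1 * z2)) = (fr s - fr (fr s)) * (fr t * (z2 * z3))"
        by (rule two_linear_eqs[OF 1 2])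
      then show ?thesis using ns2 unfolding m23 by simp
    qed
    have m31: "fr (fr t) * (z3 * z1) = m * (s - fr s)"
      using 1 unfolding m23 m12 by (simp add: algebra_simps eq_neg_iff_add_eq_0)
    show False
    proof (cases "m = 0")
      case True
      \<comment> \<open>Two coordinates of \<open>w\<close> vanish, so \<open>w\<close> represents a
        vertex of the first triangle.\<close>
      then have "z1 * z2 = 0" "z2 * z3 = 0" "z3 * z1 = 0"
        using m12 m23 m31 t by auto
      then consider "z2 = 0" "z3 = 0" | "z1 = 0" "z3 = 0" | "z1 = 0" "z2 = 0" by auto
      then show False
        using nv wz by cases auto
    next
      case False
      have nz: "z1 \<noteq> 0" "z2 \<noteq> 0" "z3 \<noteq> 0"
        using m12 m23 m31 False ns2 ns3 t by auto
      define d where "d = (fr s - fr (fr s)) / t"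
      have d: "d \<in> cubic" "d \<noteq> 0" using s t ns3 by (simp_all add: d_def cubic_intros)
      have e12: "z1 * z2 = m * d" and e23: "z2 * z3 = m * fr d" and e31: "z3 * z1 = m * fr (fr d)"
        using m12 m23 m31 t by (simp_all add: d_def cubicD[OF s(1)] field_simps)
      define mu where "mu = fr m / m"
      have mu: "fr m = mu * m" using False by (simp add: mu_def)
      have f12: "fr z1 * fr z2 = mu * (z2 * z3)" and f23: "fr z2 * fr z3 = mu * (z3 * z1)" and f31: "fr z3 * fr z1 = mu * (z1 * z2)"
        unfolding fr_mult[symmetric] e12 e23 e31 by (simp_all add: mu cubicD[OF d(1)])
      have mu0: "mu \<noteq> 0" using False by (simp add: mu_def)
      \<comment> \<open>The products of two coordinates are \<open>m\<close> times a conjugate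
        triple, so \<open>fr\<close> permutes them cyclically up to the factor \<open>mu\<close>.
        Hence \<open>fr\<close> permutes the coordinates themselves cyclically up to one factor
        \<open>k\<close>, and \<open>w\<close> is proportional to its conjugate, which contradicts
        the independence of its conjugates.\<close>
      define k where "k = fr z3 / z1"
      have k3: "fr z3 = k * z1" using nz by (simp add: k_def)
      have k1: "fr z1 = k * z2"
      proof -
        have "mu * (fr z1 * (z3 * z1)) = (fr z2 * fr z3) * fr z1" by (simp add: f23)
        also have "\<dots> = (fr z1 * fr z2) * fr z3" by simp
        also have "\<dots> = mu * (k * z2 * (z3 * z1))" by (simp add: f12 k3)
        finally show ?thesis using mu0 nz by simp
      qed
      have k2: "fr z2 = k * z3"
      proof -
        have "mu * (fr z2 * (z1 * z2)) = (fr z3 * fr z1) * fr z2" by (simp add: f31)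
        also have "\<dots> = (fr z1 * fr z2) * fr z3" by simp
        also have "\<dots> = mu * (k * z3 * (z1 * z2))" by (simp add: f12 k3)
        finally show ?thesis using mu0 nz by simp
      qed
      have "frob_vec w = k *s w"
        unfolding wz by (simp add: cubic_v k1 k2 k3 vec_eq_iff algebra_simps)
      then show False
        using frame_det_zeroI w.det_frame by blast
    qed
  qed
  then obtain k where "s = to_ac k" by (metis fr_fixed_iff imageE)
  then have "h = k *s f"
    unfolding form_eq_iff c0_linear c1_linear using f h s by (simp add: through_eq t_def)
  then show "\<exists>k. h = k *s f" by blast
qed

end

section \<open>Lines and degenerate quadrics\<close>

lemma perp_cross:
  fixes l y y' :: "'k::field^3"
  assumes "y \<noteq> 0" "\<nexists>k. y' = k *s y" "scalar_product l y = 0" "scalar_product l y' = 0"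
  shows "\<exists>k. l = k *s cross y y'"
proof (rule cross_eq_0_imp)
  show "cross y y' \<noteq> 0"
    using cross_eq_0_imp assms(1,2) by blast
  have *: "cross (cross y y') l = scalar_product l y *s y' - scalar_product l y' *s y"
    by (simp add: vec_eq_iff forall_3 cross_def scalar_product_3 algebra_simps)
  show "cross (cross y y') l = 0"
    unfolding * assms by simp
qed

lemma common_perp_unique:
  fixes l m y y' :: "'k::field^3"
  assumes "l \<noteq> 0" "\<nexists>k. m = k *s l" "y \<noteq> 0"
    and "scalar_product l y = 0" "scalar_product m y = 0" "scalar_product l y' = 0" "scalar_product m y' = 0"
  shows "\<exists>k. y' = k *s y"
proof (rule ccontr)
  assume n: "\<nexists>k. y' = k *s y"
  obtain a b where a: "l = a *s cross y y'" and b: "m = b *s cross y y'"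
    using perp_cross[OF assms(3) n] assms by metis
  with assms(1) have "m = (b / a) *s l" by auto
  then show False using assms(2) by blast
qed

lemma span_singleton_in_line:
  assumes "x \<noteq> 0"
  shows "vec.span {x} \<in> line l \<longleftrightarrow> scalar_product l x = 0"
proof -
  have "vec.span {x} \<in> proj_points"
    using assms by (auto simp: proj_points_def)
  moreover have "(\<forall>z\<in>vec.span {x}. scalar_product l z = 0) \<longleftrightarrow> scalar_product l x = 0"
    by (auto simp: vec.span_singleton scalar_product_scale)
  ultimately show ?thesis by (simp add: line_def)
qed

lemma line_scale: "k \<noteq> 0 \<Longrightarrow> line (k *s l) = line l"
  by (auto simp: line_def scalar_product_scale)

lemma line_eq_iff:
  assumes "l \<noteq> 0" "m \<noteq> 0"
  shows "line l = line m \<longleftrightarrow> (\<exists>k. m = k *s l)"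
proof
  assume eq: "line l = line m"
  show "\<exists>k. m = k *s l"
  proof (rule ccontr)
    assume n: "\<nexists>k. m = k *s l"
    obtain M :: "'a^3^3" where M: "det M \<noteq> 0" "column 1 M = l" "column 2 M = m"
      using extend_to_frame[OF assms(1) n] .
    \<comment> \<open>A point on \<open>line l\<close> but not on \<open>line m\<close>, because
      \<open>scalar_product m x\<close> is minus the determinant of \<open>M\<close>.\<close>
    define x where "x = cross l (column 3 M)"
    have d: "scalar_product m x = - det M"
      by (simp add: M(2,3)[symmetric] x_def det_3 cross_def scalar_product_3 column_def algebra_simps)
    have "x \<noteq> 0"
      using d M by auto
    then have "vec.span {x} \<in> line l" "vec.span {x} \<notin> line m"
      using d M(1) by (simp_all add: span_singleton_in_line) (simp add: x_def cross_perp)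
    then show False using eq by simp
  qed
next
  assume "\<exists>k. m = k *s l"
  then show "line l = line m"
    using assms line_scale by (metis vec.scale_zero_left)
qed

lemma line_Int_line:
  assumes "l \<noteq> 0" "\<nexists>k. m = k *s l" "y \<noteq> 0" "scalar_product l y = 0" "scalar_product m y = 0"
  shows "line l \<inter> line m = {vec.span {y}}"
proof (intro equalityI subsetI)
  fix P assume P: "P \<in> line l \<inter> line m"
  then obtain x where x: "x \<noteq> 0" "P = vec.span {x}"
    by (auto simp: line_def proj_points_def)
  have "scalar_product l x = 0" "scalar_product m x = 0"
    using P x span_singleton_in_line[OF x(1)] by auto
  then obtain k where "x = k *s y"
    using common_perp_unique[OF assms] by blast
  then show "P \<in> {vec.span {y}}"
    using x span_singleton_eq[of k y] by auto
qed (use assms span_singleton_in_line[OF assms(3)] in auto)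

lemma sing_lin_mult:
  assumes "l \<noteq> 0" "m \<noteq> 0"
  shows "sing (lin_mult l m) y \<longleftrightarrow> scalar_product l y = 0 \<and> scalar_product m y = 0"
proof
  assume s: "sing (lin_mult l m) y"
  have 1: "scalar_product l y * scalar_product m y = 0"
    using s by (simp add: sing_def qeval_lin_mult)
  have 2: "scalar_product l x * scalar_product m y + scalar_product l y * scalar_product m x = 0" for x
    using s by (simp add: sing_def qpolar_lin_mult)
  obtain a b where ab: "scalar_product l a \<noteq> 0" "scalar_product m b \<noteq> 0"
    using assms exists_nonperp by metis
  show "scalar_product l y = 0 \<and> scalar_product m y = 0"
    using 1 2[of a] 2[of b] ab by auto
qed (simp add: sing_def qeval_lin_mult qpolar_lin_mult)

lemma sing_smult: "k \<noteq> 0 \<Longrightarrow> sing (k *s f) y \<longleftrightarrow> sing f y"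
  by (simp add: sing_def qeval_smult qpolar_smult)

lemma sing_scale: "sing f y \<Longrightarrow> sing f (k *s y)"
  by (simp add: sing_def qeval_scale qpolar_scale_right)

lemma exists_not_multiple: "\<exists>z :: 'k::field^3. \<nexists>k. z = k *s y"
proof (rule ccontr)
  assume "\<nexists>z. \<nexists>k. z = k *s y"
  then have "\<exists>k. z = k *s y" for z by blast
  from this[of "vector [1,0,0]"] this[of "vector [0,1,0]"] obtain a b
    where "vector [1,0,0] = a *s y" "vector [0,1,0] = b *s y" by blast
  then have "a * y$1 = 1" "a * y$2 = 0" "b * y$2 = 1"
    by (simp_all add: vec_eq_iff forall_3)
  then show False by auto
qed

lemma exists_two_perps:
  fixes l :: "'k::field^3"
  obtains y y' where "y \<noteq> 0" "\<nexists>k. y' = k *s y" "scalar_product l y = 0" "scalar_product l y' = 0"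
proof (cases "l = 0")
  case True
  obtain y' where "\<nexists>k. y' = k *s (vector [1,0,0] :: 'k^3)"
    using exists_not_multiple by blast
  then show thesis
    using that[of "vector [1,0,0]" y'] True by (simp add: vec_eq_iff forall_3)
next
  case False
  obtain m where m: "\<nexists>k. m = k *s l"
    using exists_not_multiple by blast
  obtain M :: "'k^3^3" where M: "det M \<noteq> 0" "column 1 M = l" "column 2 M = m"
    using extend_to_frame[OF False m] .
  have d: "scalar_product m (cross l (column 3 M)) = - det M"
    by (simp add: M(2,3)[symmetric] det_3 cross_def scalar_product_3 column_def algebra_simps)
  have n: "cross l m \<noteq> 0"
    using cross_eq_0_imp[OF _ False] m by blast
  have "\<nexists>k. cross l (column 3 M) = k *s cross l m"
    using d M(1) cross_perp(2)[of m l] by (auto simp: scalar_product_scale cross_perp)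
  then show thesis
    using that n cross_perp(1) by blast
qed

lemma rep_two_sing:
  assumes "rep f"
  obtains y y' where "y \<noteq> 0" "\<nexists>k. y' = k *s y" "sing f y" "sing f y'"
proof -
  obtain k l where f: "f = k *s lin_mult l l"
    using assms by (auto simp: rep_def)
  obtain y y' where y: "y \<noteq> 0" "\<nexists>k. y' = k *s y" "scalar_product l y = 0" "scalar_product l y' = 0"
    using exists_two_perps by metis
  have "sing f y" "sing f y'"
    using y by (simp_all add: f sing_def qeval_smult qpolar_smult qeval_lin_mult qpolar_lin_mult)
  then show thesis using that y by blast
qed

lemma quadric_self: "f \<in> quadric f"
  unfolding quadric_def by (auto intro: exI[of _ 1])

lemma quadric_eq_iff: "quadric f = quadric g \<longleftrightarrow> (\<exists>k. k \<noteq> 0 \<and> g = k *s f)"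
proof
  assume "quadric f = quadric g"
  then have "g \<in> quadric f" using quadric_self by blast
  then show "\<exists>k. k \<noteq> 0 \<and> g = k *s f" by (auto simp: quadric_def)
next
  assume "\<exists>k. k \<noteq> 0 \<and> g = k *s f"
  then obtain k where k: "k \<noteq> 0" "g = k *s f" by blast
  have "c *s f = (c / k) *s g" for c
    using k by simp
  then have "quadric f \<subseteq> quadric g"
    using k(1) unfolding quadric_def by (smt (verit) divide_eq_0_iff mem_Collect_eq subsetI)
  moreover have "quadric g \<subseteq> quadric f"
    using k unfolding quadric_def by auto
  ultimately show "quadric f = quadric g" by blast
qed

lemma quadric_smult: "k \<noteq> 0 \<Longrightarrow> quadric (k *s f) = quadric f"
  using quadric_eq_iff by metis

lemma veronese_quadric: "veronese (quadric f) = vec.span {f}"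
proof -
  have "vec.span (quadric f) \<subseteq> vec.span {f}"
    by (rule vec.span_minimal[OF _ vec.subspace_span]) (auto simp: quadric_def vec.span_base vec.span_scale)
  moreover have "vec.span {f} \<subseteq> vec.span (quadric f)"
    by (rule vec.span_mono) (simp add: quadric_self)
  ultimately show ?thesis by (simp add: veronese_def)
qed

lemma ext_quadric_quadric: "ext_quadric (quadric f) = quadric (ext_vec f)"
proof -
  have "quadric (ext_vec (c *s f)) = quadric (ext_vec f)" if "c \<noteq> 0" for c
    using that by (simp add: quadric_smult)
  then have "quadric (ext_vec g) = quadric (ext_vec f)" if "g \<in> quadric f" for g
    using that by (auto simp: quadric_def[of f])
  then have "(\<Union>g\<in>quadric f. quadric (ext_vec g)) = (\<Union>g\<in>quadric f. quadric (ext_vec f))"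
    by (intro SUP_cong refl)
  also have "\<dots> = quadric (ext_vec f)"
    using quadric_self[of f] by blast
  finally show ?thesis by (simp add: ext_quadric_def)
qed

lemma ext_point_span: "ext_point (vec.span {y}) = vec.span {ext_vec y}"
proof -
  have "vec.span (ext_vec ` vec.span {y}) \<subseteq> vec.span {ext_vec y}"
    by (rule vec.span_minimal[OF _ vec.subspace_span]) (auto simp: vec.span_singleton)
  moreover have "vec.span {ext_vec y} \<subseteq> vec.span (ext_vec ` vec.span {y})"
    by (rule vec.span_mono) (simp add: vec.span_base)
  ultimately show ?thesis by (simp add: ext_point_def)
qed

lemma ext_vec_multiple: "ext_vec y' = k *s ext_vec y \<Longrightarrow> y \<noteq> 0 \<Longrightarrow> \<exists>k. y' = k *s y"
proof -
  assume e: "ext_vec y' = k *s ext_vec y" and "y \<noteq> 0"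
  then obtain i where i: "y $ i \<noteq> 0" by (auto simp: vec_eq_iff)
  have "to_ac (y' $ j) = k * to_ac (y $ j)" for j
    using arg_cong[OF e, of "\<lambda>x. x $ j"] by simp
  then have "to_ac (y $ i * y' $ j) = to_ac (y' $ i * y $ j)" for j
    by simp
  then have "y $ i * y' $ j = y' $ i * y $ j" for j
    by (simp only: to_ac_eq_iff)
  then have "y' = (y' $ i / y $ i) *s y"
    using i by (simp add: vec_eq_iff field_simps)
  then show ?thesis by blast
qed

definition real_pair :: "'a::field^6 \<Rightarrow> 'a^3 \<Rightarrow> 'a^3 \<Rightarrow> bool" where
  "real_pair f l m \<longleftrightarrow> l \<noteq> 0 \<and> m \<noteq> 0 \<and> (\<nexists>k. m = k *s l) \<and> f = lin_mult l m"

text \<open>The factor \<open>k\<close> is taken in the closure because \<open>ext_quadric\<close>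
  yields classes up to scalars of the closure.\<close>

definition conj_pair :: "'a::finite_field^6 \<Rightarrow> 'a alg_closure^3 \<Rightarrow> bool" where
  "conj_pair f l \<longleftrightarrow> l \<noteq> 0 \<and> frob_vec (frob_vec l) = l \<and> (\<nexists>k. frob_vec l = k *s l)
     \<and> (\<exists>k. k \<noteq> 0 \<and> ext_vec f = k *s lin_mult l (frob_vec l))"

lemma lin_mult_0 [simp]: "lin_mult 0 m = 0" "lin_mult l 0 = 0"
  by (rule form_eqI; simp add: qeval_lin_mult)+

lemma lin_mult_eq_0_imp: "lin_mult l m = 0 \<Longrightarrow> l = 0 \<or> m = 0"
proof (rule ccontr)
  assume e: "lin_mult l m = 0" and n: "\<not> (l = 0 \<or> m = 0)"
  obtain a b where ab: "scalar_product l a \<noteq> 0" "scalar_product m b \<noteq> 0"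
    using n exists_nonperp by metis
  have q: "scalar_product l x * scalar_product m x = 0" for x
    using qeval_lin_mult[of l m x] e by simp
  have p: "scalar_product l x * scalar_product m y + scalar_product l y * scalar_product m x = 0" for x y
    using qpolar_lin_mult[of l m x y] e by (simp add: qpolar_def)
  show False using q[of a] q[of b] p[of a b] ab by auto
qed

lemma real_pair_nonzero: "real_pair f l m \<Longrightarrow> f \<noteq> 0"
  using lin_mult_eq_0_imp by (auto simp: real_pair_def)

lemma conj_pair_nonzero: "conj_pair f l \<Longrightarrow> f \<noteq> 0"
  using lin_mult_eq_0_imp by (fastforce simp: conj_pair_def)

lemma sing_real_pair: "real_pair f l m \<Longrightarrow> sing f y \<longleftrightarrow> scalar_product l y = 0 \<and> scalar_product m y = 0"
  by (simp add: real_pair_def sing_lin_mult)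

lemma sing_conj_pair:
  "conj_pair f l \<Longrightarrow> sing f y \<longleftrightarrow> scalar_product l (ext_vec y) = 0 \<and> scalar_product (frob_vec l) (ext_vec y) = 0"
proof -
  assume "conj_pair f l"
  then obtain k where "l \<noteq> 0" "k \<noteq> 0" "ext_vec f = k *s lin_mult l (frob_vec l)"
    by (auto simp: conj_pair_def)
  then have "sing (ext_vec f) (ext_vec y) \<longleftrightarrow> scalar_product l (ext_vec y) = 0 \<and> scalar_product (frob_vec l) (ext_vec y) = 0"
    by (simp add: sing_smult sing_lin_mult)
  then show ?thesis by (simp only: sing_ext_vec)
qed

text \<open>A multiple of a square is singular at two different points, but two distinct lines have
  only one point in common.\<close>

lemma real_pair_not_rep: "real_pair f l m \<Longrightarrow> \<not> rep f"
proof
  assume f: "real_pair f l m" "rep f"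
  obtain y y' where y: "y \<noteq> 0" "\<nexists>k. y' = k *s y" "sing f y" "sing f y'"
    using rep_two_sing[OF f(2)] .
  then show False
    using f(1) common_perp_unique[of l m y y'] unfolding sing_real_pair[OF f(1)] real_pair_def by blast
qed

lemma conj_pair_not_rep: "conj_pair f l \<Longrightarrow> \<not> rep f"
proof
  assume f: "conj_pair f l" "rep f"
  obtain y y' where y: "y \<noteq> 0" "\<nexists>k. y' = k *s y" "sing f y" "sing f y'"
    using rep_two_sing[OF f(2)] .
  then have "\<exists>k. ext_vec y' = k *s ext_vec y"
    using f(1) common_perp_unique[of l "frob_vec l" "ext_vec y" "ext_vec y'"]
    unfolding sing_conj_pair[OF f(1)] conj_pair_def by auto
  then show False using y ext_vec_multiple by blast
qed

lemma vec_mult_injective: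
  fixes N :: "'k::field^3^3"
  assumes "N ** M = mat 1"
  shows "l v* N = 0 \<longleftrightarrow> l = 0" and "(m v* N = k *s (l v* N)) \<longleftrightarrow> m = k *s l"
proof -
  have i: "(x v* N) v* M = x" for x
    using assms by (simp add: vector_matrix_mul_assoc)
  show "l v* N = 0 \<longleftrightarrow> l = 0"
    by (metis i vector_matrix_mult_0)
  have "k *s (l v* N) = (k *s l) v* N"
    by (simp add: vec_eq_iff vector_matrix_mult_def sum_3 algebra_simps)
  then show "(m v* N = k *s (l v* N)) \<longleftrightarrow> m = k *s l"
    by (metis i)
qed

lemma vector_matrix_frob: "frob_vec l v* ext_mat N = frob_vec (l v* ext_mat N)"
  by (simp add: vec_eq_iff vector_matrix_mult_def sum_3)

lemma real_pair_pullback: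
  assumes "real_pair f l m" "N ** M = mat 1"
  shows "real_pair (pullback N f) (l v* N) (m v* N)"
  using assms by (simp add: real_pair_def pullback_lin_mult vec_mult_injective[OF assms(2)])

lemma conj_pair_pullback:
  assumes "conj_pair f l" "N ** M = mat 1"
  shows "conj_pair (pullback N f) (l v* ext_mat N)"
proof -
  have e: "ext_mat N ** ext_mat M = mat 1"
    using assms(2) by (simp add: ext_mat_mat flip: ext_mat_mult)
  show ?thesis
    using assms(1) unfolding conj_pair_def ext_vec_pullback
    by (auto simp: pullback_lin_mult pullback_smult vec_mult_injective[OF e] simp flip: vector_matrix_frob)
qed

text \<open>Only the second and third variables occur. A root \<open>r\<close> of the dehomogenized
  quadratic is taken in the closure: if \<open>fr\<close> fixes it the form factors rationally,
  otherwise its factors are conjugate over GF(q^2). Taking a root instead of a discriminant keeps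
  characteristic 2 within the argument.\<close>

lemma binary_form_cases:
  fixes f :: "'a::finite_field^6"
  assumes f: "f$1 = 0" "f$4 = 0" "f$5 = 0" "f \<noteq> 0" "\<not> rep f"
  shows "(\<exists>l m. real_pair f l m) \<or> (\<exists>l. conj_pair f l)"
proof -
  have real: "real_pair f l m" if "f = lin_mult l m" for l m
  proof -
    have "l \<noteq> 0 \<and> m \<noteq> 0"
      using that f(4) by auto
    moreover have "\<nexists>k. m = k *s l"
    proof
      assume "\<exists>k. m = k *s l"
      then obtain k where "m = k *s l" by blast
      then have "f = k *s lin_mult l l"
        using that lin_mult_scale[of 1 l k l] by simp
      then show False using f(5) by (auto simp: rep_def)
    qed
    ultimately show ?thesis using that by (simp add: real_pair_def)
  qed
  show ?thesis
  proof (cases "f$2 = 0")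
    case True
    have "f = lin_mult (vector [0,0,1]) (vector [0, f$6, f$3])"
      using f True by (simp add: vec_eq_iff forall_6 lin_mult_def)
    then show ?thesis using real by blast
  next
    case False
    define a b c where "a = to_ac (f$2)" and "b = to_ac (f$3)" and "c = to_ac (f$6)"
    have a: "a \<noteq> 0" "fr a = a" "fr b = b" "fr c = c" using False by (simp_all add: a_def b_def c_def)
    have "Polynomial.degree [:b, c, a:] > 0" using a by simp
    then obtain r where "poly [:b, c, a:] r = 0"
      using alg_closed_imp_poly_has_root by blast
    then have r: "a * r^2 + c * r + b = 0"
      by (simp add: power2_eq_square algebra_simps)
    show ?thesis
    proof (cases "fr r = r")
      case True
      then obtain k where k: "r = to_ac k" by (metis fr_fixed_iff imageE)
      have "to_ac (f$2 * k^2 + f$6 * k + f$3) = 0"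
        using r by (simp add: a_def b_def c_def k)
      then have k0: "f$2 * k^2 + f$6 * k + f$3 = 0"
        by (simp only: to_ac_eq_0_iff)
      then have "f$3 = - (f$2 * k^2 + f$6 * k)"
        by (metis add.commute eq_neg_iff_add_eq_0)
      then have "f = lin_mult (vector [0,1,- k]) (vector [0, f$2, f$6 + f$2 * k])"
        using f by (simp add: vec_eq_iff forall_6 lin_mult_def power2_eq_square algebra_simps)
      then show ?thesis using real by blast
    next
      case False
      have r': "a * (fr r)^2 + c * fr r + b = 0"
        using arg_cong[OF r, of fr] a by simp
      \<comment> \<open>Both \<open>r\<close> and \<open>fr r\<close> are roots; subtracting their
        equations gives the sum of the roots, and conjugating that relation gives
        \<open>fr (fr r) = r\<close>.\<close>
      have "(r - fr r) * (a * (r + fr r) + c) = (a * r^2 + c * r + b) - (a * (fr r)^2 + c * fr r + b)"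
        by (simp add: power2_eq_square algebra_simps)
      then have s: "a * (r + fr r) + c = 0"
        using r r' False by auto
      then have c: "c = - (a * (r + fr r))"
        by (metis add.commute eq_neg_iff_add_eq_0)
      have "b = - (a * r^2 + c * r)"
        using r by (metis add.commute eq_neg_iff_add_eq_0)
      also have "\<dots> = a * (r * fr r)"
        unfolding c by (simp add: power2_eq_square algebra_simps)
      finally have b: "b = a * (r * fr r)" .
      have "a * (fr r + fr (fr r)) + c = 0"
        using arg_cong[OF s, of fr] a by simp
      then have "a * (fr r + fr (fr r)) + c = a * (r + fr r) + c"
        by (simp only: s)
      then have "a * (fr (fr r)) = a * r"
        by (simp add: distrib_left add.commute)
      then have rr: "fr (fr r) = r" using a by simp
      define l :: "'a alg_closure^3" where "l = vector [0, 1, - r]"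
      have fl: "frob_vec l = vector [0, 1, - fr r]"
        by (simp add: l_def vec_eq_iff forall_3)
      have "conj_pair f l"
        unfolding conj_pair_def
      proof (intro conjI)
        show "l \<noteq> 0" by (simp add: l_def vec_eq_iff forall_3)
        show "frob_vec (frob_vec l) = l" by (simp add: l_def vec_eq_iff forall_3 rr)
        show "\<nexists>k. frob_vec l = k *s l"
          unfolding fl using False by (auto simp: l_def vec_eq_iff forall_3)
        have "ext_vec f = a *s lin_mult l (frob_vec l)"
          unfolding fl using f b c by (simp add: l_def vec_eq_iff forall_6 lin_mult_def a_def b_def c_def algebra_simps)
        then show "\<exists>k. k \<noteq> 0 \<and> ext_vec f = k *s lin_mult l (frob_vec l)"
          using a by blast
      qed
      then show ?thesis by blast
    qed
  qed
qed

text \<open>Moving the vertex to (1,0,0) leaves a binary form in the other two variables.\<close>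

lemma sing_form_cases:
  fixes f :: "'a::finite_field^6"
  assumes f: "f \<noteq> 0" "\<not> rep f" and y: "sing f y" "y \<noteq> 0"
  shows "(\<exists>l m. real_pair f l m) \<or> (\<exists>l. conj_pair f l)"
proof -
  obtain y' where "\<nexists>k. y' = k *s y"
    using exists_not_multiple by blast
  then obtain M :: "'a^3^3" where M: "det M \<noteq> 0" "column 1 M = y"
    using extend_to_frame[OF y(2)] by metis
  obtain N where N: "N ** M = mat 1" "M ** N = mat 1" "\<And>f :: 'a^6. pullback N (pullback M f) = f"
    using pullback_inverse[OF M(1)] by metis
  have y': "y = M *v vector [1,0,0]"
    using M by (simp add: matrix_vector_columns)
  define g where "g = pullback M f"
  have "sing g (vector [1,0,0])"
    using y(1) unfolding g_def sing_pullback[OF M(1)] y'[symmetric] .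
  then have q: "qeval g (vector [1,0,0]) = 0" and p: "qpolar g x (vector [1,0,0]) = 0" for x
    by (simp_all add: sing_def)
  have "g \<noteq> 0" using f(1) N(3)[of f] by (auto simp: g_def)
  moreover have "\<not> rep g" using f(2) N(3)[of f] rep_pullback[of g N] by (auto simp: g_def)
  moreover have "g$1 = 0" "g$4 = 0" "g$5 = 0"
    using q p[of "vector [0,1,0]"] p[of "vector [0,0,1]"] by (simp_all add: qeval_def qpolar_expand)
  ultimately have "(\<exists>l m. real_pair g l m) \<or> (\<exists>l. conj_pair g l)"
    using binary_form_cases by blast
  then show ?thesis
    using real_pair_pullback[OF _ N(1)] conj_pair_pullback[OF _ N(1)] N(3)[of f] unfolding g_def by metis
qed

lemma real_pair_biline:
  assumes f: "real_pair f l m"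
  shows "biline (quadric (f :: 'a::finite_field^6))" "y \<noteq> 0 \<Longrightarrow> sing f y \<Longrightarrow> biline_centered (vec.span {y}) (quadric f)"
proof -
  have l: "l \<noteq> 0" "m \<noteq> 0" "\<nexists>k. m = k *s l" "f = lin_mult l m"
    using f by (auto simp: real_pair_def)
  then have n: "line l \<noteq> line m" by (simp add: line_eq_iff)
  show "biline (quadric f)"
    unfolding biline_def using l n by blast
  assume "y \<noteq> 0" "sing f y"
  then have "line l \<inter> line m = {vec.span {y}}"
    using l line_Int_line[OF l(1,3)] sing_real_pair[OF f] by blast
  then show "biline_centered (vec.span {y}) (quadric f)"
    unfolding biline_centered_def using l n by blast
qed

lemma biline_real_pair:
  assumes "biline Q"
  obtains f l m where "Q = quadric f" "real_pair f l m"
proof -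
  obtain l m where l: "l \<noteq> 0" "m \<noteq> 0" "line l \<noteq> line m" "Q = quadric (lin_mult l m)"
    using assms by (auto simp: biline_def)
  then have "real_pair (lin_mult l m) l m"
    by (simp add: real_pair_def line_eq_iff)
  then show thesis using that l by blast
qed

lemma conj_pair_imag_biline:
  assumes f: "conj_pair f l"
  shows "imag_biline (quadric f)" "y \<noteq> 0 \<Longrightarrow> sing f y \<Longrightarrow> imag_biline_centered (vec.span {y}) (quadric f)"
proof -
  obtain k where l: "l \<noteq> 0" "frob_vec (frob_vec l) = l" "\<nexists>k. frob_vec l = k *s l" "k \<noteq> 0" "ext_vec f = k *s lin_mult l (frob_vec l)"
    using f by (auto simp: conj_pair_def)
  then have n: "line l \<noteq> line (frob_vec l)" by (simp add: line_eq_iff)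
  have q: "quadric f \<in> quadrics"
    using conj_pair_nonzero[OF f] by (auto simp: quadrics_def)
  have e: "ext_quadric (quadric f) = quadric (lin_mult l (frob_vec l))"
    using l by (simp add: ext_quadric_quadric quadric_smult)
  have o: "over_GF 2 l" using l by (simp add: over_GF_2_iff)
  show "imag_biline (quadric f)"
    unfolding imag_biline_def using l(1) n q e o by blast
  assume y: "y \<noteq> 0" "sing f y"
  then have "line l \<inter> line (frob_vec l) = {ext_point (vec.span {y})}"
    unfolding ext_point_span using line_Int_line[OF l(1,3), of "ext_vec y"] sing_conj_pair[OF f] by simp
  moreover have "vec.span {y} \<in> proj_points" using y by (auto simp: proj_points_def)
  ultimately show "imag_biline_centered (vec.span {y}) (quadric f)"
    unfolding imag_biline_centered_def using l(1) n q e o by blast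
qed

lemma imag_biline_conj_pair:
  assumes "imag_biline Q"
  obtains f l where "Q = quadric f" "conj_pair f l"
proof -
  obtain l where l: "l \<noteq> 0" "over_GF 2 l" "line l \<noteq> line (frob_vec l)" "ext_quadric Q = quadric (lin_mult l (frob_vec l))"
    and "Q \<in> quadrics"
    using assms by (auto simp: imag_biline_def)
  then obtain f where f: "Q = quadric f" "f \<noteq> 0" by (auto simp: quadrics_def)
  have "quadric (lin_mult l (frob_vec l)) = quadric (ext_vec f)"
    using l(4) f by (simp add: ext_quadric_quadric)
  then have "\<exists>k. k \<noteq> 0 \<and> ext_vec f = k *s lin_mult l (frob_vec l)"
    by (simp add: quadric_eq_iff)
  then have "conj_pair f l"
    using l by (simp add: conj_pair_def line_eq_iff over_GF_2_iff)
  then show thesis using that f by blast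
qed

text \<open>All that is used of either kind of centered bi-line: its form is singular at the center.
  This lets the two kinds share one argument in \<open>center_plane\<close>.\<close>

lemma centered_imp:
  assumes "biline_centered A Q \<or> imag_biline_centered A Q"
  shows "\<exists>f y. Q = quadric f \<and> A = vec.span {y} \<and> y \<noteq> 0 \<and> sing f y \<and> f \<noteq> 0"
  using assms
proof
  assume "biline_centered A Q"
  then obtain l m where l: "l \<noteq> 0" "m \<noteq> 0" "line l \<noteq> line m" "Q = quadric (lin_mult l m)" "line l \<inter> line m = {A}"
    by (auto simp: biline_centered_def)
  then have f: "real_pair (lin_mult l m) l m"
    by (simp add: real_pair_def line_eq_iff)
  have "A \<in> line l" "A \<in> line m" using l by auto
  then obtain y where y: "A = vec.span {y}" "y \<noteq> 0" "scalar_product l y = 0" "scalar_product m y = 0"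
    using span_singleton_in_line by (auto simp: line_def proj_points_def) (metis insertI1 vec.span_base)
  then show ?thesis
    using l f sing_real_pair[OF f] real_pair_nonzero[OF f] by blast
next
  assume c: "imag_biline_centered A Q"
  then obtain y where y: "A = vec.span {y}" "y \<noteq> 0"
    by (auto simp: imag_biline_centered_def proj_points_def)
  obtain l where l: "l \<noteq> 0" "over_GF 2 l" "line l \<noteq> line (frob_vec l)" "ext_quadric Q = quadric (lin_mult l (frob_vec l))"
     "line l \<inter> line (frob_vec l) = {vec.span {ext_vec y}}"
    and "Q \<in> quadrics"
    using c y by (auto simp: imag_biline_centered_def ext_point_span)
  then obtain f where f: "Q = quadric f" "f \<noteq> 0" by (auto simp: quadrics_def)
  have "quadric (lin_mult l (frob_vec l)) = quadric (ext_vec f)"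
    using l(4) f by (simp add: ext_quadric_quadric)
  then have "\<exists>k. k \<noteq> 0 \<and> ext_vec f = k *s lin_mult l (frob_vec l)"
    by (simp add: quadric_eq_iff)
  then have p: "conj_pair f l"
    using l by (simp add: conj_pair_def line_eq_iff over_GF_2_iff)
  have "vec.span {ext_vec y} \<in> line l" "vec.span {ext_vec y} \<in> line (frob_vec l)"
    using l(5) by auto
  then have "sing f y"
    using y(2) by (simp add: sing_conj_pair[OF p] span_singleton_in_line)
  then show ?thesis using f y by blast
qed

lemma subspace_sing: "vec.subspace {f. sing f y}"
  by (rule vec.subspaceI) (simp_all add: sing_def qeval_plus qeval_smult qpolar_plus qpolar_smult, simp add: qpolar_def)

lemma card_vanishing_coords:
  "card {f :: 'a::finite_field^6. f$1 = 0 \<and> f$4 = 0 \<and> f$5 = 0} = CARD('a) ^ 3"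
proof -
  have "bij_betw (\<lambda>u :: 'a^3. vector [0, u$1, u$2, 0, 0, u$3] :: 'a^6) UNIV {f. f$1 = 0 \<and> f$4 = 0 \<and> f$5 = 0}"
  proof (rule bij_betw_byWitness[of _ "\<lambda>f. vector [f$2, f$3, f$6]"])
  qed (auto simp: vec_eq_iff forall_3 forall_6)
  from bij_betw_same_card[OF this] show ?thesis by simp
qed

lemma card_sing:
  fixes y :: "'a::finite_field^3"
  assumes "y \<noteq> 0"
  shows "card {f. sing f y} = CARD('a) ^ 3"
proof -
  obtain y' where "\<nexists>k. y' = k *s y"
    using exists_not_multiple by blast
  then obtain M :: "'a^3^3" where M: "det M \<noteq> 0" "column 1 M = y"
    using extend_to_frame[OF assms] by metis
  obtain N where N: "\<And>f :: 'a^6. pullback N (pullback M f) = f" "\<And>f :: 'a^6. pullback M (pullback N f) = f"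
    using pullback_inverse[OF M(1)] by metis
  have y': "M *v vector [1,0,0] = y"
    using M by (simp add: matrix_vector_columns)
  have e: "sing g (vector [1,0,0]) \<longleftrightarrow> g$1 = 0 \<and> g$4 = 0 \<and> g$5 = 0" for g :: "'a^6"
  proof
    assume "sing g (vector [1,0,0])"
    then have "qeval g (vector [1,0,0]) = 0" "qpolar g (vector [0,1,0]) (vector [1,0,0]) = 0" "qpolar g (vector [0,0,1]) (vector [1,0,0]) = 0"
      by (simp_all add: sing_def)
    then show "g$1 = 0 \<and> g$4 = 0 \<and> g$5 = 0" by (simp add: qeval_def qpolar_expand)
  qed (simp add: sing_def qeval_def qpolar_expand)
  have "bij_betw (pullback M) {f. sing f y} {f. f$1 = 0 \<and> f$4 = 0 \<and> f$5 = 0}"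
  proof (rule bij_betw_byWitness[of _ "pullback N"])
    show "pullback M ` {f. sing f y} \<subseteq> {f. f$1 = 0 \<and> f$4 = 0 \<and> f$5 = 0}"
      unfolding e[symmetric] using sing_pullback[OF M(1)] y' by auto
    show "pullback N ` {f. f$1 = 0 \<and> f$4 = 0 \<and> f$5 = 0} \<subseteq> {f. sing f y}"
    proof -
      have "sing g (vector [1,0,0]) \<longleftrightarrow> sing (pullback N g) y" for g
        using sing_pullback[OF M(1), of "pullback N g" "vector [1,0,0]"] by (simp only: N(2) y')
      then show ?thesis
        unfolding e[symmetric] by blast
    qed
  qed (simp_all add: N)
  from bij_betw_same_card[OF this] show ?thesis by (simp add: card_vanishing_coords)
qed

lemma veronese_quadric_image: "veronese ` {quadric f |f. f \<in> U \<and> f \<noteq> 0} = subspace_points U"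
  if "vec.subspace U"
proof -
  have *: "vec.span {f} \<subseteq> U \<longleftrightarrow> f \<in> U" for f
    using that by (meson subset_iff vec.span_minimal insertI1 vec.span_base empty_subsetI insert_subset)
  have "veronese ` {quadric f |f. f \<in> U \<and> f \<noteq> 0} = {vec.span {f} |f. f \<in> U \<and> f \<noteq> 0}"
    by (auto simp: veronese_quadric image_iff) (metis veronese_quadric)
  also have "\<dots> = subspace_points U"
    unfolding subspace_points_def proj_points_def using * by blast
  finally show ?thesis .
qed

text \<open>The classification of singular forms turns the list of quadrics defining
  \<open>nucleus_plane\<close> into one linear condition on the form, so these points do form a
  projective subspace.\<close>

lemma nucleus_quadrics:
  fixes y :: "'a::finite_field^3"
  assumes y: "y \<noteq> 0"
  shows "{Q. repeated_line_through (vec.span {y}) Q \<or> biline_centered (vec.span {y}) Q \<or> imag_biline_centered (vec.span {y}) Q}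
    = {quadric f |f. f \<in> {f. sing f y} \<and> f \<noteq> 0}" (is "?A = ?B")
proof (intro equalityI subsetI)
  fix Q assume "Q \<in> ?A"
  then consider "repeated_line_through (vec.span {y}) Q" | "biline_centered (vec.span {y}) Q \<or> imag_biline_centered (vec.span {y}) Q"
    by blast
  then show "Q \<in> ?B"
  proof cases
    case 1
    then obtain l where l: "l \<noteq> 0" "Q = quadric (lin_mult l l)" "vec.span {y} \<in> line l"
      by (auto simp: repeated_line_through_def)
    then have "sing (lin_mult l l) y"
      using y by (simp add: sing_lin_mult span_singleton_in_line)
    moreover have "lin_mult l l \<noteq> 0" using lin_mult_eq_0_imp l by blast
    ultimately show ?thesis using l by blast
  next
    case 2
    then obtain f y' where f: "Q = quadric f" "vec.span {y} = vec.span {y'}" "sing f y'" "f \<noteq> 0"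
      using centered_imp by metis
    have "y \<in> vec.span {y'}" using f(2) vec.span_base by blast
    then obtain k where "y = k *s y'" by (auto simp: vec.span_singleton)
    then show ?thesis using f sing_scale by blast
  qed
next
  fix Q assume "Q \<in> ?B"
  then obtain f where f: "Q = quadric f" "sing f y" "f \<noteq> 0" by blast
  show "Q \<in> ?A"
  proof (cases "rep f")
    case True
    then obtain k l where kl: "f = k *s lin_mult l l" by (auto simp: rep_def)
    with f have k: "k \<noteq> 0" and l: "l \<noteq> 0" by auto
    then have "sing (lin_mult l l) y" using f kl sing_smult by blast
    then have "vec.span {y} \<in> line l" using l y by (simp add: sing_lin_mult span_singleton_in_line)
    moreover have "Q = quadric (lin_mult l l)" using f kl k by (simp add: quadric_smult)
    ultimately show ?thesis using l by (auto simp: repeated_line_through_def)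
  next
    case False
    then have "(\<exists>l m. real_pair f l m) \<or> (\<exists>l. conj_pair f l)"
      using sing_form_cases f y by blast
    then show ?thesis
      using real_pair_biline(2) conj_pair_imag_biline(2) f y by blast
  qed
qed

lemma nucleus_plane_eq:
  fixes y :: "'a::finite_field^3"
  assumes "y \<noteq> 0"
  shows "nucleus_plane (vec.span {y}) = subspace_points {f. sing f y}"
  unfolding nucleus_plane_def nucleus_quadrics[OF assms] by (rule veronese_quadric_image[OF subspace_sing])

text \<open>By the classification a form with a vertex is, up to a factor, a product of two linear
  forms over the closure, where \<open>disc_lin_mult\<close> applies.\<close>

lemma disc_sing_eq_0:
  fixes f :: "'a::finite_field^6"
  assumes "sing f y" "y \<noteq> 0"
  shows "disc f = 0"
proof -
  consider "f = 0" | "rep f" | l m where "real_pair f l m" | l where "conj_pair f l"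
    using sing_form_cases assms by blast
  then show ?thesis
  proof cases
    case 4
    then obtain k where "ext_vec f = k *s lin_mult l (frob_vec l)" by (auto simp: conj_pair_def)
    then have "disc (ext_vec f) = 0" by (simp add: disc_smult disc_lin_mult)
    then show ?thesis by (simp add: disc_ext_vec)
  qed (auto simp: rep_def real_pair_def disc_smult disc_lin_mult, simp add: disc_def)
qed

lemma real_pair_sing:
  assumes "real_pair f l m"
  obtains y where "y \<noteq> 0" "sing f y"
proof -
  have "cross l m \<noteq> 0" "scalar_product l (cross l m) = 0" "scalar_product m (cross l m) = 0"
    using assms cross_eq_0_imp[of l m] by (auto simp: real_pair_def cross_perp)
  then show thesis using that sing_real_pair[OF assms] by blast
qed

text \<open>The cross product \<open>z\<close> of two conjugate lines is sent to \<open>- z\<close>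
  by Frobenius, which swaps them. Dividing by a nonzero entry makes it rational.\<close>

lemma conj_pair_sing:
  assumes "conj_pair f l"
  obtains y where "y \<noteq> 0" "sing f y"
proof -
  define z where "z = cross l (frob_vec l)"
  have z: "z \<noteq> 0" using assms cross_eq_0_imp[of l "frob_vec l"] by (auto simp: z_def conj_pair_def)
  have "frob_vec z = cross (frob_vec l) (frob_vec (frob_vec l))"
    by (simp add: z_def cross_def vec_eq_iff forall_3)
  also have "\<dots> = - z"
    using assms by (simp add: z_def conj_pair_def cross_def vec_eq_iff forall_3 algebra_simps)
  finally have fz: "fr (z $ i) = - (z $ i)" for i
    by (simp add: vec_eq_iff)
  obtain i where i: "z $ i \<noteq> 0" using z by (auto simp: vec_eq_iff)
  define u where "u = inverse (z $ i) *s z"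
  have "frob_vec u = u" by (simp add: u_def vec_eq_iff fz)
  then obtain y where y: "u = ext_vec y" using frob_vec_fixed_imp by blast
  have "u \<noteq> 0" using z i by (simp add: u_def)
  then have "y \<noteq> 0" using y by auto
  moreover have "sing f y"
    unfolding sing_conj_pair[OF assms] y[symmetric]
    by (simp add: u_def z_def scalar_product_scale cross_perp)
  ultimately show thesis using that by blast
qed

lemma conicI:
  fixes f :: "'a::finite_field^6"
  assumes "disc f \<noteq> 0"
  shows "conic (quadric f)"
proof -
  have "f \<noteq> 0" using assms by (auto simp: disc_def)
  then have q: "quadric f \<in> quadrics" by (auto simp: quadrics_def)
  have d: "disc g \<noteq> 0" if "quadric f = quadric g" for g
    using that assms by (auto simp: quadric_eq_iff disc_smult)
  have "\<not> repeated_line (quadric f)"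
    using d disc_lin_mult unfolding repeated_line_def by metis
  moreover have "\<not> biline (quadric f)"
    using d disc_lin_mult unfolding biline_def by metis
  moreover have "\<not> imag_biline (quadric f)"
  proof
    assume "imag_biline (quadric f)"
    then obtain g l where g: "quadric f = quadric g" "conj_pair g l" by (rule imag_biline_conj_pair)
    then obtain y where "y \<noteq> 0" "sing g y" using conj_pair_sing by blast
    then have "disc g = 0" by (metis disc_sing_eq_0)
    then show False using d g by blast
  qed
  ultimately show ?thesis using q by (simp add: conic_def)
qed

lemma span_in_zero_locus:
  assumes "x \<noteq> 0"
  shows "vec.span {x} \<in> zero_locus (quadric f) \<longleftrightarrow> qeval f x = 0"
proof
  assume "vec.span {x} \<in> zero_locus (quadric f)"
  then show "qeval f x = 0"
    using quadric_self[of f] vec.span_base[of x "{x}"] by (auto simp: zero_locus_def)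
next
  assume "qeval f x = 0"
  then show "vec.span {x} \<in> zero_locus (quadric f)"
    using assms by (auto simp: zero_locus_def proj_points_def quadric_def vec.span_singleton qeval_smult qeval_scale)
qed

definition triangle :: "'a::finite_field alg_closure^3 \<Rightarrow> ('a alg_closure^3) set set" where
  "triangle w = {vec.span {w}, vec.span {frob_vec w}, vec.span {frob_vec (frob_vec w)}}"

text \<open>A rational form vanishing at \<open>v\<close> also vanishes at the conjugates, and
  \<open>through_disc\<close> makes every nonzero such form a conic. The bundle is thus a full
  linear net.\<close>

lemma (in cubic_frame) conics_through_triangle:
  "{Q. conic Q \<and> triangle v \<subseteq> zero_locus (ext_quadric Q)} = {quadric f |f. f \<in> through v \<and> f \<noteq> 0}"
proof (intro equalityI subsetI)
  fix Q assume Q: "Q \<in> {Q. conic Q \<and> triangle v \<subseteq> zero_locus (ext_quadric Q)}"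
  then obtain f where f: "Q = quadric f" "f \<noteq> 0" by (auto simp: conic_def quadrics_def)
  have "vec.span {v} \<in> zero_locus (quadric (ext_vec f))"
    using Q f by (simp add: triangle_def ext_quadric_quadric)
  then have "f \<in> through v"
    using span_in_zero_locus[OF v_nonzero] by (simp add: through_def)
  then show "Q \<in> {quadric f |f. f \<in> through v \<and> f \<noteq> 0}" using f by blast
next
  fix Q assume "Q \<in> {quadric f |f. f \<in> through v \<and> f \<noteq> 0}"
  then obtain f where f: "Q = quadric f" "f \<in> through v" "f \<noteq> 0" by blast
  have "conic Q" using f conicI through_disc by blast
  moreover have "triangle v \<subseteq> zero_locus (ext_quadric Q)"
    using f v_nonzero by (simp add: triangle_def ext_quadric_quadric span_in_zero_locus through_def qeval_frob_vec)
  ultimately show "Q \<in> {Q. conic Q \<and> triangle v \<subseteq> zero_locus (ext_quadric Q)}" by blast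
qed

section \<open>Classes of matrices modulo scalars and their actions\<close>

definition pcls :: "'k::field^3^3 \<Rightarrow> ('k^3^3) set" where
  "pcls N = {mat c ** N |c. c \<noteq> 0}"

lemma mat_mult_mult_vec: "(mat c ** N) *v x = c *s ((N :: 'k::field^3^3) *v x)"
  by (simp add: matrix_vector_mul_assoc[symmetric] mat_mult_vec)

lemma pullback_mat_mult: "pullback (mat c ** (N :: 'k::field^3^3)) f = c^2 *s pullback N f"
  by (rule form_eqI) (simp add: qeval_pullback qeval_smult mat_mult_mult_vec qeval_scale)

text \<open>The inverse matrix appears because \<open>act_quadric\<close> asks that the pullback of
  the image quadric be the given one.\<close>

lemma act_quadric_pcls:
  fixes N :: "'k::field^3^3"
  assumes "N ** N' = mat 1" "N' ** N = mat 1"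
  shows "act_quadric (pcls N) (quadric f) = quadric (pullback N' f)"
proof (intro equalityI subsetI)
  fix b assume "b \<in> act_quadric (pcls N) (quadric f)"
  then obtain c k where "c \<noteq> 0" "k \<noteq> 0" "c^2 *s pullback N b = k *s f"
    by (auto simp: act_quadric_def pcls_def quadric_def pullback_mat_mult)
  then have "pullback N b = (k / c^2) *s f"
    by (simp add: vec_eq_iff field_simps)
  then have "pullback N' (pullback N b) = (k / c^2) *s pullback N' f"
    by (simp add: pullback_smult)
  then have "b = (k / c^2) *s pullback N' f"
    by (simp add: pullback_pullback assms)
  then show "b \<in> quadric (pullback N' f)"
    using \<open>c \<noteq> 0\<close> \<open>k \<noteq> 0\<close> by (auto simp: quadric_def intro!: exI[of _ "k / c^2"])
next
  fix b assume "b \<in> quadric (pullback N' f)"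
  then obtain k where "k \<noteq> 0" "b = k *s pullback N' f" by (auto simp: quadric_def)
  then have "pullback N b \<in> quadric f"
    by (auto simp: quadric_def pullback_smult pullback_pullback assms)
  moreover have "N \<in> pcls N" by (auto simp: pcls_def intro!: exI[of _ 1])
  ultimately show "b \<in> act_quadric (pcls N) (quadric f)" by (auto simp: act_quadric_def)
qed

lemma mult_vec_scale: "(N :: 'k::field^3^3) *v (k *s x) = k *s (N *v x)"
  by (simp add: vec_eq_iff matrix_vector_mult_def sum_3 algebra_simps)

lemma pcls_self: "(N :: 'k::field^3^3) \<in> pcls N"
  unfolding pcls_def by (auto intro: exI[of _ 1])

lemma act_point_pcls: "act_point (pcls N) (vec.span {x}) = vec.span {(N :: 'k::field^3^3) *v x}"
proof (intro equalityI subsetI)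
  fix z assume "z \<in> act_point (pcls N) (vec.span {x})"
  then obtain c k where "z = (mat c ** N) *v (k *s x)"
    by (auto simp: act_point_def pcls_def vec.span_singleton)
  then have "z = (c * k) *s (N *v x)"
    by (simp add: mat_mult_mult_vec mult_vec_scale)
  then show "z \<in> vec.span {N *v x}"
    by (simp add: vec.span_base vec.span_scale)
next
  fix z assume "z \<in> vec.span {N *v x}"
  then obtain k where "z = N *v (k *s x)"
    by (auto simp: vec.span_singleton mult_vec_scale)
  moreover have "k *s x \<in> vec.span {x}"
    by (simp add: vec.span_base vec.span_scale)
  ultimately show "z \<in> act_point (pcls N) (vec.span {x})"
    unfolding act_point_def using pcls_self[of N] by blast
qed

lemma plane_of_act:
  fixes N :: "'a::finite_field^3^3"
  assumes "det N \<noteq> 0"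
  shows "veronese ` (act_quadric (pcls N) ` {quadric f |f. f \<in> through w \<and> f \<noteq> 0}) = subspace_points (through (ext_mat N *v w))"
proof -
  obtain N' where N: "N ** N' = mat 1" "N' ** N = mat 1" "\<And>f :: 'a^6. pullback N' (pullback N f) = f" "\<And>f :: 'a^6. pullback N (pullback N' f) = f"
    using pullback_inverse[OF assms] by metis
  have t: "f \<in> through w \<longleftrightarrow> pullback N' f \<in> through (ext_mat N *v w)" for f
  proof -
    have "ext_mat N' *v (ext_mat N *v w) = w"
      using N by (simp add: matrix_vector_mul_assoc ext_mat_mat flip: ext_mat_mult)
    then show ?thesis by (simp add: through_def ext_vec_pullback qeval_pullback)
  qed
  have "act_quadric (pcls N) ` {quadric f |f. f \<in> through w \<and> f \<noteq> 0} = {quadric f |f. f \<in> through (ext_mat N *v w) \<and> f \<noteq> 0}"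
    (is "?A = ?B")
  proof (intro equalityI subsetI)
    fix Q assume "Q \<in> ?A"
    then obtain f where f: "f \<in> through w" "f \<noteq> 0" "Q = quadric (pullback N' f)"
      by (auto simp: act_quadric_pcls[OF N(1,2)])
    moreover have "pullback N' f \<noteq> 0" using f N(4)[of f] by auto
    ultimately show "Q \<in> ?B" using t by blast
  next
    fix Q assume "Q \<in> ?B"
    then obtain f where f: "f \<in> through (ext_mat N *v w)" "f \<noteq> 0" "Q = quadric f" by blast
    have "pullback N f \<in> through w" using f t[of "pullback N f"] N by simp
    moreover have "pullback N f \<noteq> 0" using f N(3)[of f] by auto
    moreover have "Q = act_quadric (pcls N) (quadric (pullback N f))"
      by (simp add: act_quadric_pcls[OF N(1,2)] N f)
    ultimately show "Q \<in> ?A" by blast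
  qed
  then show ?thesis
    by (simp only: veronese_quadric_image[OF subspace_through])
qed

section \<open>Singer subgroups\<close>

lemma group_GL3: "Group.group (GL3 :: ('k::field^3^3) monoid)"
proof (rule groupI)
  fix x y z :: "'k^3^3"
  assume "x \<in> carrier GL3" "y \<in> carrier GL3"
  then show "x \<otimes>\<^bsub>GL3\<^esub> y \<in> carrier GL3"
    by (simp add: GL3_def invertible_det_nz det_mul)
next
  fix x :: "'k^3^3" assume "x \<in> carrier GL3"
  then obtain y where "x ** y = mat 1" "y ** x = mat 1"
    by (auto simp: GL3_def invertible_def)
  then show "\<exists>y\<in>carrier GL3. y \<otimes>\<^bsub>GL3\<^esub> x = \<one>\<^bsub>GL3\<^esub>"
    by (auto simp: GL3_def invertible_def)
qed (auto simp: GL3_def matrix_mul_assoc invertible_det_nz)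

lemma mat_mult_comm: "mat c ** N = N ** mat c" for N :: "'k::field^3^3"
  by (simp add: vec_eq_iff matrix_matrix_mult_def mat_def forall_3 sum_3)

lemma mat_mat_mult: "mat c ** (mat d :: 'k::field^3^3) = mat (c * d)"
  by (simp add: vec_eq_iff matrix_matrix_mult_def mat_def forall_3 sum_3)

lemma det_mat3: "det (mat c :: 'k::field^3^3) = c^3"
  by (simp add: det_3 mat_def power3_eq_cube)

lemma normal_scalars3: "normal scalars3 (GL3 :: ('k::field^3^3) monoid)"
proof (rule group.normalI[OF group_GL3])
  show "subgroup scalars3 (GL3 :: ('k^3^3) monoid)"
  proof (rule group.subgroupI[OF group_GL3])
    show "scalars3 \<subseteq> carrier (GL3 :: ('k^3^3) monoid)"
      by (auto simp: scalars3_def GL3_def invertible_det_nz det_mat3)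
    show "scalars3 \<noteq> ({} :: ('k^3^3) set)"
      by (auto simp: scalars3_def intro: exI[of _ 1])
    show "a \<otimes>\<^bsub>GL3\<^esub> b \<in> scalars3" if "a \<in> scalars3" "b \<in> scalars3" for a b :: "'k^3^3"
      using that by (auto simp: scalars3_def GL3_def mat_mat_mult)
    show "inv\<^bsub>GL3\<^esub> a \<in> scalars3" if a: "a \<in> scalars3" for a :: "'k^3^3"
    proof -
      obtain c where c: "c \<noteq> 0" "a = mat c"
        using a by (auto simp: scalars3_def)
      have "inv\<^bsub>GL3\<^esub> a = mat (inverse c)"
        by (rule group.inv_equality[OF group_GL3])
           (use c in \<open>auto simp: GL3_def mat_mat_mult invertible_det_nz det_mat3\<close>)
      then show ?thesis using c by (auto simp: scalars3_def)
    qed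
  qed
  show "\<forall>x\<in>carrier GL3. scalars3 #>\<^bsub>GL3\<^esub> x = x <#\<^bsub>GL3\<^esub> (scalars3 :: ('k^3^3) set)"
    by (auto simp: r_coset_def l_coset_def scalars3_def GL3_def mat_mult_comm)
qed

lemma group_PGL3: "Group.group (PGL3 :: ('k::field^3^3) set monoid)"
  unfolding PGL3_def by (rule normal.factorgroup_is_group[OF normal_scalars3])

lemma r_coset_scalars3: "scalars3 #>\<^bsub>GL3\<^esub> N = pcls (N :: 'k::field^3^3)"
  by (auto simp: r_coset_def scalars3_def GL3_def pcls_def)

lemma carrier_GL3: "carrier GL3 = {N :: 'k::field^3^3. det N \<noteq> 0}"
  by (simp add: GL3_def invertible_det_nz)

lemma carrier_PGL3: "carrier PGL3 = {pcls N |N :: 'k::field^3^3. det N \<noteq> 0}"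
  unfolding PGL3_def carrier_FactGroup carrier_GL3 by (auto simp: r_coset_scalars3)

lemma mult_PGL3:
  fixes M N :: "'k::field^3^3"
  assumes "det M \<noteq> 0" "det N \<noteq> 0"
  shows "pcls M \<otimes>\<^bsub>PGL3\<^esub> pcls N = pcls (M ** N)"
  unfolding PGL3_def mult_FactGroup r_coset_scalars3[symmetric]
  by (subst normal.rcos_sum[OF normal_scalars3]) (use assms in \<open>auto simp: GL3_def invertible_det_nz\<close>)

lemma one_PGL3: "\<one>\<^bsub>PGL3\<^esub> = pcls (mat 1 :: 'k::field^3^3)"
  by (auto simp: PGL3_def scalars3_def pcls_def)

lemma inv_PGL3:
  fixes M N :: "'k::field^3^3"
  assumes "N ** M = mat 1" "det M \<noteq> 0" "det N \<noteq> 0"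
  shows "inv\<^bsub>PGL3\<^esub> (pcls M) = pcls N"
  by (rule group.inv_equality[OF group_PGL3]) (use assms in \<open>auto simp: mult_PGL3 one_PGL3 carrier_PGL3\<close>)

text \<open>Transfers a generator from the group structure on \<open>S\<close> to the ambient group,
  so that any subgroup containing this one element contains \<open>S\<close>.\<close>

lemma cyclic_subgroup_generator:
  assumes "Group.group G" "subgroup S G" "cyclic_group (subgroup_generated G S)"
  obtains x where "x \<in> S" "S \<subseteq> generate G {x}"
proof -
  interpret G: Group.group G by fact
  interpret S: subgroup S G by fact
  define H where "H = subgroup_generated G S"
  interpret H: Group.group H unfolding H_def by simp
  have cH: "carrier H = S" by (simp add: H_def)
  obtain x where x: "x \<in> carrier H" "subgroup_generated H {x} = H"
    using assms(3) by (auto simp: cyclic_group_def H_def)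
  have "S = generate H {x}"
    using x carrier_subgroup_generated[of H "{x}"] by (simp add: cH)
  moreover have "y \<in> generate G {x}" if "y \<in> generate H {x}" for y
    using that
  proof (induction rule: generate.induct)
    case one
    then show ?case by (simp add: H_def generate.one)
  next
    case (incl h)
    then show ?case by (rule generate.incl)
  next
    case (inv h)
    then have "inv\<^bsub>H\<^esub> h = inv\<^bsub>G\<^esub> h"
      using x by (simp add: H_def)
    then show ?case using inv by (simp add: generate.inv)
  next
    case (eng h1 h2)
    then show ?case by (simp add: H_def generate.eng)
  qed
  ultimately show thesis
    using that x(1) cH by blast
qed

section \<open>Eigenvectors over the cubic extension\<close>

lemma det_eq_0_kernel:
  fixes A :: "'k::field^3^3"
  assumes "det A = 0"
  obtains x where "x \<noteq> 0" "A *v x = 0"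
proof -
  have "\<not> invertible A" using assms by (simp add: invertible_det_nz)
  then have "\<nexists>B. B ** A = mat 1"
    using invertible_left_inverse[of A] by blast
  then show thesis
    using that by (auto simp: matrix_left_invertible_ker)
qed

definition charpoly3 :: "'k::field^3^3 \<Rightarrow> 'k \<Rightarrow> 'k" where
  "charpoly3 A x = x^3 - (A$1$1 + A$2$2 + A$3$3) * x^2
     + (A$1$1 * A$2$2 - A$1$2 * A$2$1 + A$1$1 * A$3$3 - A$1$3 * A$3$1 + A$2$2 * A$3$3 - A$2$3 * A$3$2) * x - det A"

lemma det_charpoly3: "det (mat x - A) = charpoly3 A x"
  by (simp add: det_3 mat_def charpoly3_def power2_eq_square power3_eq_cube algebra_simps)

lemma charpoly3_eigenvector:
  fixes A :: "'k::field^3^3"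
  assumes "charpoly3 A x = 0"
  obtains v where "v \<noteq> 0" "A *v v = x *s v"
proof -
  obtain v where "v \<noteq> 0" "(mat x - A) *v v = 0"
    using det_eq_0_kernel assms unfolding det_charpoly3[symmetric] by blast
  then show thesis
    using that by (simp add: matrix_vector_mult_diff_rdistrib mat_mult_vec)
qed

lemma charpoly3_ext_mat:
  "charpoly3 (ext_mat A) (fr x) = fr (charpoly3 (ext_mat A) x)" "charpoly3 (ext_mat A) (to_ac k) = to_ac (charpoly3 A k)"
  by (simp_all add: charpoly3_def det_ext_mat)

lemma monic_cubic_two_roots:
  fixes a b :: "'k::field"
  assumes "a^3 - t * a^2 + s * a - d = 0" "b^3 - t * b^2 + s * b - d = 0" "a \<noteq> b"
  shows "a^2 + a * b + b^2 - t * (a + b) + s = 0"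
proof -
  have "(a - b) * (a^2 + a * b + b^2 - t * (a + b) + s) = (a^3 - t * a^2 + s * a - d) - (b^3 - t * b^2 + s * b - d)"
    by (simp add: power2_eq_square power3_eq_cube algebra_simps)
  then show ?thesis using assms by simp
qed

lemma monic_cubic_third_root:
  fixes a b :: "'k::field"
  assumes a: "a^3 - t * a^2 + s * a - d = 0" and b: "b^3 - t * b^2 + s * b - d = 0" and ab: "a \<noteq> b"
    and m: "m = t - a - b"
  shows "m^3 - t * m^2 + s * m - d = 0"
proof -
  have "m^3 - t * m^2 + s * m - d = (a^3 - t * a^2 + s * a - d)
      + (m - a) * (a^2 + a * b + b^2 - t * (a + b) + s)"
    unfolding m by (simp add: power2_eq_square power3_eq_cube algebra_simps)
  then show ?thesis using a monic_cubic_two_roots[OF a b ab] by simp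
qed

lemma monic_cubic_sum_roots:
  fixes a b c :: "'k::field"
  assumes a: "a^3 - t * a^2 + s * a - d = 0" and b: "b^3 - t * b^2 + s * b - d = 0" and c: "c^3 - t * c^2 + s * c - d = 0"
    and "a \<noteq> b" "a \<noteq> c" "b \<noteq> c"
  shows "c = t - a - b"
proof -
  have "(b - c) * (a + b + c - t) = (a^2 + a * b + b^2 - t * (a + b) + s) - (a^2 + a * c + c^2 - t * (a + c) + s)"
    by (simp add: power2_eq_square algebra_simps)
  then have "a + b + c - t = 0"
    using monic_cubic_two_roots[OF a b] monic_cubic_two_roots[OF a c] assms by simp
  then show ?thesis by (simp add: algebra_simps)
qed

lemma vandermonde_zero:
  fixes a b c :: "'k::field"
  assumes "x + y + z = 0" "a * x + b * y + c * z = 0" "a^2 * x + b^2 * y + c^2 * z = 0"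
    and "a \<noteq> b" "a \<noteq> c" "b \<noteq> c"
  shows "x = 0" "y = 0" "z = 0"
proof -
  have "(a - b) * (a - c) * x = (a^2 * x + b^2 * y + c^2 * z) - (b + c) * (a * x + b * y + c * z) + b * c * (x + y + z)"
    "(b - a) * (b - c) * y = (a^2 * x + b^2 * y + c^2 * z) - (a + c) * (a * x + b * y + c * z) + a * c * (x + y + z)"
    "(c - a) * (c - b) * z = (a^2 * x + b^2 * y + c^2 * z) - (a + b) * (a * x + b * y + c * z) + a * b * (x + y + z)"
    by (simp_all add: power2_eq_square algebra_simps)
  then show "x = 0" "y = 0" "z = 0" using assms by simp_all
qed

text \<open>The characteristic polynomial has no root in GF(q), so Frobenius moves its roots in a
  cycle of length 3. The eigenvectors for three distinct conjugate eigenvalues are independent by a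
  Vandermonde argument.\<close>

lemma no_eigenvector_imp_cubic_frame:
  fixes M :: "'a::finite_field^3^3"
  assumes no: "\<And>y k. M *v y = k *s y \<Longrightarrow> y = 0"
  obtains v l where "cubic_frame v" "ext_mat M *v v = l *s v"
proof -
  define A where "A = ext_mat M"
  define t s d where "t = A$1$1 + A$2$2 + A$3$3"
    and "s = A$1$1 * A$2$2 - A$1$2 * A$2$1 + A$1$1 * A$3$3 - A$1$3 * A$3$1 + A$2$2 * A$3$3 - A$2$3 * A$3$2"
    and "d = det A"
  have cp: "charpoly3 A x = x^3 - t * x^2 + s * x - d" for x
    by (simp add: charpoly3_def t_def s_def d_def)
  have ft: "fr t = t" by (simp add: t_def A_def)
  have nf: "fr x \<noteq> x" if "charpoly3 A x = 0" for x
  proof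
    assume "fr x = x"
    then obtain k where "x = to_ac k" by (metis fr_fixed_iff imageE)
    then have "charpoly3 M k = 0"
      using that by (simp add: A_def charpoly3_ext_mat)
    then show False using charpoly3_eigenvector no by metis
  qed
  have "Polynomial.degree [:- d, s, - t, 1:] > 0" by simp
  then obtain l where "poly [:- d, s, - t, 1:] l = 0"
    using alg_closed_imp_poly_has_root by blast
  then have l0: "charpoly3 A l = 0"
    by (simp add: cp power2_eq_square power3_eq_cube algebra_simps)
  have l1: "charpoly3 A (fr l) = 0" and l2: "charpoly3 A (fr (fr l)) = 0" and l3: "charpoly3 A (fr (fr (fr l))) = 0"
    using l0 unfolding A_def charpoly3_ext_mat by simp_all
  have n1: "fr l \<noteq> l" using nf[OF l0] .
  have n2: "fr (fr l) \<noteq> l"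
  proof
    assume e: "fr (fr l) = l"
    \<comment> \<open>If \<open>fr\<close> swapped two roots, the third one, trace minus their sum,
      would be rational.\<close>
    define m where "m = t - l - fr l"
    have "charpoly3 A m = 0"
      unfolding cp by (rule monic_cubic_third_root[OF l0[unfolded cp] l1[unfolded cp] _ m_def]) (use n1 in auto)
    moreover have "fr m = m" by (simp add: m_def ft e)
    ultimately show False using nf by blast
  qed
  have n3: "fr (fr (fr l)) = l"
  proof (rule ccontr)
    assume n: "fr (fr (fr l)) \<noteq> l"
    \<comment> \<open>Both this element and \<open>l\<close> are the root that completes
      \<open>fr l\<close> and \<open>fr (fr l)\<close>.\<close>
    have "fr (fr (fr l)) = t - fr l - fr (fr l)"
      by (rule monic_cubic_sum_roots[OF l1[unfolded cp] l2[unfolded cp] l3[unfolded cp]]) (use n1 n2 in auto)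
    moreover have "l = t - fr l - fr (fr l)"
      by (rule monic_cubic_sum_roots[OF l1[unfolded cp] l2[unfolded cp] l0[unfolded cp]]) (use n1 n2 in auto)
    ultimately show False using n by simp
  qed
  obtain w where w: "w \<noteq> 0" "A *v w = l *s w"
    using charpoly3_eigenvector[OF l0] .
  obtain i where i: "w $ i \<noteq> 0" using w by (auto simp: vec_eq_iff)
  \<comment> \<open>Frobenius applied three times preserves the eigenspace of \<open>l\<close> and
    so multiplies \<open>v\<close> by a scalar; the entry 1 forces that scalar to be 1.\<close>
  define v where "v = inverse (w $ i) *s w"
  have v: "v $ i = 1" "A *v v = l *s v"
    using i w by (simp_all add: v_def mult_vec_scale mult.commute)
  then have v0: "v \<noteq> 0" by auto
  have v1: "A *v frob_vec v = fr l *s frob_vec v"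
    using arg_cong[OF v(2), of frob_vec] by (simp add: A_def)
  have v2: "A *v frob_vec (frob_vec v) = fr (fr l) *s frob_vec (frob_vec v)"
    using arg_cong[OF v1, of frob_vec] by (simp add: A_def)
  have v3: "A *v frob_vec (frob_vec (frob_vec v)) = l *s frob_vec (frob_vec (frob_vec v))"
    using arg_cong[OF v2, of frob_vec] by (simp add: A_def n3)
  have Az: "A *v (frame v *v z) = frame v *v vector [l * z$1, fr l * z$2, fr (fr l) * z$3]" for z
    by (simp add: frame_mult_vec matrix_vector_right_distrib mult_vec_scale v(2) v1 v2 mult.commute)
  have det: "det (frame v) \<noteq> 0"
  proof
    assume "det (frame v) = 0"
    then obtain z where z: "z \<noteq> 0" "frame v *v z = 0"
      using det_eq_0_kernel by blast
    have e0: "z$1 * v$j + z$2 * fr (v$j) + z$3 * fr (fr (v$j)) = 0" for j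
      using arg_cong[OF z(2), of "\<lambda>x. x $ j"] by (simp add: frame_mult_vec)
    have az: "frame v *v vector [l * z$1, fr l * z$2, fr (fr l) * z$3] = 0"
      using Az[of z] z(2) by simp
    have e1: "l * (z$1 * v$j) + fr l * (z$2 * fr (v$j)) + fr (fr l) * (z$3 * fr (fr (v$j))) = 0" for j
      using arg_cong[OF az, of "\<lambda>x. x $ j"] by (simp add: frame_mult_vec mult.assoc)
    have "frame v *v vector [l * (l * z$1), fr l * (fr l * z$2), fr (fr l) * (fr (fr l) * z$3)] = 0"
      using Az[of "vector [l * z$1, fr l * z$2, fr (fr l) * z$3]"] az by simp
    from arg_cong[OF this, of "\<lambda>x. x $ j" for j]
    have e2: "l^2 * (z$1 * v$j) + (fr l)^2 * (z$2 * fr (v$j)) + (fr (fr l))^2 * (z$3 * fr (fr (v$j))) = 0" for j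
      by (simp add: frame_mult_vec power2_eq_square mult.assoc)
    have "z$1 * v$i = 0" "z$2 * fr (v$i) = 0" "z$3 * fr (fr (v$i)) = 0"
      using vandermonde_zero[OF e0 e1 e2] n1 n2 by (metis fr_eq_iff)+
    then have "z = 0" using v(1) by (simp add: vec_eq_iff forall_3)
    then show False using z(1) by simp
  qed
  obtain z where z: "frob_vec (frob_vec (frob_vec v)) = frame v *v z"
    using invertible_mult_vec_surj[OF det] by blast
  have "frame v *v vector [l * z$1, fr l * z$2, fr (fr l) * z$3] = frame v *v (l *s z)"
    using v3 unfolding z Az by (simp add: mult_vec_scale)
  then have "vector [l * z$1, fr l * z$2, fr (fr l) * z$3] = l *s z"
    unfolding invertible_mult_vec_eq_iff[OF det] .
  then have "z$2 = 0" "z$3 = 0"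
    using n1 n2 by (auto simp: vec_eq_iff forall_3)
  then have f3: "frob_vec (frob_vec (frob_vec v)) = z$1 *s v"
    unfolding z frame_mult_vec by simp
  have "z$1 = 1"
    using arg_cong[OF f3, of "\<lambda>x. x $ i"] v(1) by simp
  then have "cubic_frame v"
    using f3 det by (simp add: cubic_frame_def)
  then show thesis
    using that v(2) by (simp add: A_def)
qed

lemma pcls_scale:
  fixes N :: "'k::field^3^3"
  assumes "k \<noteq> 0"
  shows "pcls (mat k ** N) = pcls N"
proof (intro equalityI subsetI)
  fix K assume "K \<in> pcls (mat k ** N)"
  then show "K \<in> pcls N"
    using assms by (auto simp: pcls_def matrix_mul_assoc mat_mat_mult)
next
  fix K assume "K \<in> pcls N"
  then obtain d where "d \<noteq> 0" "K = mat d ** N" by (auto simp: pcls_def)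
  then show "K \<in> pcls (mat k ** N)"
    using assms by (auto simp: pcls_def matrix_mul_assoc mat_mat_mult intro!: exI[of _ "d / k"])
qed

context cubic_frame begin

lemma eigen_frob:
  assumes "ext_mat N *v v = l *s v"
  shows "ext_mat N *v frob_vec v = fr l *s frob_vec v"
    "ext_mat N *v frob_vec (frob_vec v) = fr (fr l) *s frob_vec (frob_vec v)"
proof -
  show *: "ext_mat N *v frob_vec v = fr l *s frob_vec v"
    using arg_cong[OF assms, of frob_vec] by simp
  show "ext_mat N *v frob_vec (frob_vec v) = fr (fr l) *s frob_vec (frob_vec v)"
    using arg_cong[OF *, of frob_vec] by simp
qed

lemma eigen_cubic:
  assumes "ext_mat N *v v = l *s v"
  shows "l \<in> cubic"
proof -
  have "l *s v = fr (fr (fr l)) *s v"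
    using arg_cong[OF eigen_frob(2)[OF assms], of frob_vec] assms by (simp add: cubic_v)
  then have "fr (fr (fr l)) = l"
    using v_nonzero by simp
  then show ?thesis
    using v_nonzero by (simp add: cubic_def)
qed

lemma eigen_nonzero:
  assumes "ext_mat N *v v = l *s v" "det N \<noteq> 0"
  shows "l \<noteq> 0"
proof
  assume "l = 0"
  then have "ext_mat N *v v = ext_mat N *v 0"
    using assms(1) by simp
  then show False
    using v_nonzero assms(2) invertible_mult_vec_eq_iff[of "ext_mat N" v 0] by (simp add: det_ext_mat)
qed

text \<open>In the frame such a matrix is diagonal with entries \<open>l\<close> and its conjugates,
  hence multiplies the coordinate \<open>s\<close> by \<open>l\<close>.\<close>

lemma eigen_pt:
  assumes "ext_mat N *v v = l *s v" "s \<in> cubic"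
  shows "N *v pt s = pt (l * s)"
proof -
  have ls: "l * s \<in> cubic" using eigen_cubic assms by (simp add: cubic_intros)
  have "ext_vec (N *v pt s) = ext_vec (pt (l * s))"
    unfolding ext_mat_mult_vec[symmetric] ext_pt[OF assms(2)] ext_pt[OF ls]
    by (simp add: matrix_vector_right_distrib mult_vec_scale assms(1) eigen_frob[OF assms(1)] mult.commute)
  then show ?thesis by (simp only: ext_vec_eq_iff)
qed

lemma eigen_coeffs:
  assumes "ext_mat N *v v = l *s v"
  shows "c0 (pullback N f) = l^2 * c0 f" "c1 (pullback N f) = l * fr l * c1 f"
  unfolding c0_def c1_def ext_vec_pullback qeval_pullback qpolar_pullback assms eigen_frob(1)[OF assms]
  by (simp_all add: qeval_scale qpolar_scale_right qpolar_sym[of _ "l *s v"] qpolar_sym[of _ v])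

lemma matrix_eqI:
  assumes "ext_mat N *v v = ext_mat M *v v"
  shows "N = M"
proof -
  have 1: "ext_mat N *v frob_vec v = ext_mat M *v frob_vec v"
    using arg_cong[OF assms, of frob_vec] by simp
  have 2: "ext_mat N *v frob_vec (frob_vec v) = ext_mat M *v frob_vec (frob_vec v)"
    using arg_cong[OF 1, of frob_vec] by simp
  have "ext_mat N *v (frame v *v z) = ext_mat M *v (frame v *v z)" for z
    by (simp add: frame_mult_vec matrix_vector_right_distrib mult_vec_scale assms 1 2)
  then have *: "ext_mat N *v x = ext_mat M *v x" for x
    using invertible_mult_vec_surj[OF det_frame] by metis
  show ?thesis
    using *[of "vector [1,0,0]"] *[of "vector [0,1,0]"] *[of "vector [0,0,1]"]
    by (simp add: vec_eq_iff forall_3 matrix_vector_mult_def sum_3)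
qed

lemma vertices_distinct: "\<nexists>k. frob_vec v = k *s v" "\<nexists>k. frob_vec (frob_vec v) = k *s v"
    "\<nexists>k. frob_vec (frob_vec v) = k *s frob_vec v"
  using frame_coords_eq[of 0 1 0 _ 0 0] frame_coords_eq[of 0 0 1 _ 0 0] frame_coords_eq[of 0 0 1 0 _ 0] by fastforce+

lemma span_eq_imp: "vec.span {x} = vec.span {y} \<Longrightarrow> \<exists>k. x = k *s (y :: 'k::field^'n)"
  using vec.span_base[of x "{x}"] by (auto simp: vec.span_singleton)

lemma card_triangle: "card (triangle v) = 3"
proof -
  have "vec.span {frob_vec v} \<noteq> vec.span {v}" "vec.span {frob_vec (frob_vec v)} \<noteq> vec.span {v}"
    "vec.span {frob_vec (frob_vec v)} \<noteq> vec.span {frob_vec v}"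
    using vertices_distinct span_eq_imp by blast+
  then show ?thesis by (auto simp: triangle_def)
qed

lemma is_triangle_triangle: "is_triangle (triangle v)"
  unfolding is_triangle_def
proof (intro conjI)
  show "triangle v \<subseteq> GF_points 3"
    using v_nonzero by (auto simp: triangle_def GF_points_def over_GF_3_iff cubic_v)
  show "card (triangle v) = 3" by (rule card_triangle)
  show "\<not> (\<exists>l. l \<noteq> 0 \<and> triangle v \<subseteq> line l)"
  proof
    assume "\<exists>l. l \<noteq> 0 \<and> triangle v \<subseteq> line l"
    then obtain l where l: "l \<noteq> 0" "triangle v \<subseteq> line l" by blast
    then have s: "scalar_product l v = 0" "scalar_product l (frob_vec v) = 0" "scalar_product l (frob_vec (frob_vec v)) = 0"
      using v_nonzero by (simp_all add: triangle_def span_singleton_in_line)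
    have "scalar_product l (frame v *v z) = z$1 * scalar_product l v + z$2 * scalar_product l (frob_vec v)
        + z$3 * scalar_product l (frob_vec (frob_vec v))" for z
      by (simp add: frame_mult_vec scalar_product_3 algebra_simps)
    then have "scalar_product l (frame v *v z) = 0" for z
      by (simp add: s)
    then have "scalar_product l x = 0" for x
      using invertible_mult_vec_surj[OF det_frame] by metis
    then show False using exists_nonperp[OF l(1)] by blast
  qed
qed

text \<open>Off the triangle at least two frame coordinates are nonzero. If the two diagonal
  matrices send such a point to the same image, then two of the conjugates of
  \<open>r = m / l\<close> coincide, so \<open>r\<close> lies in GF(q) and the matrices differ by a
  scalar.\<close>

lemma orbit_inj:
  assumes x: "x \<noteq> 0" "vec.span {x} \<notin> triangle v"
    and l: "ext_mat N *v v = l *s v" "det N \<noteq> 0" and m: "ext_mat M *v v = m *s v" "det M \<noteq> 0"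
    and eq: "vec.span {ext_mat N *v x} = vec.span {ext_mat M *v x}"
  shows "pcls N = pcls M"
proof -
  obtain z where z: "x = frame v *v z"
    using invertible_mult_vec_surj[OF det_frame] by blast
  have xz: "x = z$1 *s v + z$2 *s frob_vec v + z$3 *s frob_vec (frob_vec v)"
    by (simp add: z frame_mult_vec)
  have im: "ext_mat K *v x = (k * z$1) *s v + (fr k * z$2) *s frob_vec v + (fr (fr k) * z$3) *s frob_vec (frob_vec v)"
    if "ext_mat K *v v = k *s v" for K k
    unfolding xz by (simp add: matrix_vector_right_distrib mult_vec_scale that eigen_frob[OF that] mult.commute)
  obtain k where "ext_mat M *v x = k *s (ext_mat N *v x)"
    using span_eq_imp[OF eq[symmetric]] by blast
  then have "(m * z$1) *s v + (fr m * z$2) *s frob_vec v + (fr (fr m) * z$3) *s frob_vec (frob_vec v)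
      = (k * (l * z$1)) *s v + (k * (fr l * z$2)) *s frob_vec v + (k * (fr (fr l) * z$3)) *s frob_vec (frob_vec v)"
    unfolding im[OF l(1)] im[OF m(1)] by (simp add: vec.scale_right_distrib)
  from frame_coords_eq[OF this]
  have e: "m * z$1 = k * (l * z$1)" "fr m * z$2 = k * (fr l * z$2)" "fr (fr m) * z$3 = k * (fr (fr l) * z$3)"
    by auto
  have lm: "l \<in> cubic" "m \<in> cubic" "l \<noteq> 0" "m \<noteq> 0"
    using eigen_cubic eigen_nonzero l m by auto
  define r where "r = m / l"
  have r: "r \<in> cubic" "m = r * l" using lm by (simp_all add: r_def cubic_intros)
  have e': "z$1 \<noteq> 0 \<Longrightarrow> r = k" "z$2 \<noteq> 0 \<Longrightarrow> fr r = k" "z$3 \<noteq> 0 \<Longrightarrow> fr (fr r) = k"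
    using e lm unfolding r(2) by auto
  have two: "\<not> (z$2 = 0 \<and> z$3 = 0)" "\<not> (z$1 = 0 \<and> z$3 = 0)" "\<not> (z$1 = 0 \<and> z$2 = 0)"
  proof -
    show "\<not> (z$2 = 0 \<and> z$3 = 0)"
    proof
      assume "z$2 = 0 \<and> z$3 = 0"
      then have "x = z$1 *s v" by (simp add: xz)
      then show False using x span_singleton_eq[of "z$1" v] by (auto simp: triangle_def)
    qed
    show "\<not> (z$1 = 0 \<and> z$3 = 0)"
    proof
      assume "z$1 = 0 \<and> z$3 = 0"
      then have "x = z$2 *s frob_vec v" by (simp add: xz)
      then show False using x span_singleton_eq[of "z$2" "frob_vec v"] by (auto simp: triangle_def)
    qed
    show "\<not> (z$1 = 0 \<and> z$2 = 0)"
    proof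
      assume "z$1 = 0 \<and> z$2 = 0"
      then have "x = z$3 *s frob_vec (frob_vec v)" by (simp add: xz)
      then show False using x span_singleton_eq[of "z$3" "frob_vec (frob_vec v)"] by (auto simp: triangle_def)
    qed
  qed
  have "fr r = r"
    using e' two fr_fr_fixed_imp[OF r(1)] by (metis fr_eq_iff)
  then obtain c where c: "r = to_ac c" by (metis fr_fixed_iff imageE)
  have "c \<noteq> 0" using c r lm by auto
  have "ext_mat M *v v = ext_mat (mat c ** N) *v v"
    by (simp add: ext_mat_mult ext_mat_mat mat_mult_mult_vec l m r c)
  then have M: "M = mat c ** N" by (rule matrix_eqI)
  show ?thesis
    unfolding M by (rule pcls_scale[OF \<open>c \<noteq> 0\<close>, symmetric])
qed

lemma act_ext_pcls:
  "act_point (ext_mat ` pcls N) (vec.span {x}) = vec.span {ext_mat N *v x}"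
proof (intro equalityI subsetI)
  fix z assume "z \<in> act_point (ext_mat ` pcls N) (vec.span {x})"
  then obtain c k where "z = ext_mat (mat c ** N) *v (k *s x)"
    by (auto simp: act_point_def pcls_def vec.span_singleton)
  then have "z = (to_ac c * k) *s (ext_mat N *v x)"
    by (simp add: ext_mat_mult ext_mat_mat mat_mult_mult_vec mult_vec_scale)
  then show "z \<in> vec.span {ext_mat N *v x}"
    by (simp add: vec.span_base vec.span_scale)
next
  fix z assume "z \<in> vec.span {ext_mat N *v x}"
  then obtain k where "z = ext_mat N *v (k *s x)"
    by (auto simp: vec.span_singleton mult_vec_scale)
  moreover have "k *s x \<in> vec.span {x}"
    by (simp add: vec.span_base vec.span_scale)
  ultimately show "z \<in> act_point (ext_mat ` pcls N) (vec.span {x})"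
    unfolding act_point_def using pcls_self[of N] by blast
qed

end

text \<open>What later arguments use of the Singer group: its classes are exactly the
  multiplications by nonzero elements of GF(q^3), and its triangle is that of
  \<open>v\<close>.\<close>

locale singer = cubic_frame v for v :: "'a::finite_field alg_closure^3" +
  fixes S :: "('a^3^3) set set"
  assumes S_eigen: "g \<in> S \<Longrightarrow> \<exists>N l. det N \<noteq> 0 \<and> g = pcls N \<and> ext_mat N *v v = l *s v"
    and S_all: "u \<in> cubic \<Longrightarrow> u \<noteq> 0 \<Longrightarrow> \<exists>N. det N \<noteq> 0 \<and> pcls N \<in> S \<and> ext_mat N *v v = u *s v"
    and triangle_S: "singer_triangle S = triangle v"

text \<open>A rational eigenvector of a generator would be a fixed point, making the generator
  trivial by regularity. So the generator has an eigenvector over GF(q^3), which all its powers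
  share; transitivity then yields every multiplication.\<close>

lemma singer_subgroup_imp_singer:
  fixes S :: "('a::finite_field^3^3) set set"
  assumes S: "singer_subgroup S"
  obtains v where "singer v S"
proof -
  interpret G: Group.group "PGL3 :: ('a^3^3) set monoid" by (rule group_PGL3)
  have sub: "subgroup S PGL3" and cyc: "cyclic_group (subgroup_generated PGL3 S)" and card: "card S = CARD('a)^2 + CARD('a) + 1"
    and reg: "\<And>P P'. P \<in> proj_points \<Longrightarrow> P' \<in> proj_points \<Longrightarrow> \<exists>!g. g \<in> S \<and> act_point g P = P'"
    using S by (auto simp: singer_subgroup_def)
  have q2: "CARD('a) \<ge> 2" by (rule card_finite_field_ge_2)
  have q4: "CARD('a)^2 \<ge> 2^2" using q2 by (rule power_mono) simp
  obtain x where x: "x \<in> S" "S \<subseteq> generate PGL3 {x}"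
    using cyclic_subgroup_generator[OF group_PGL3 sub cyc] .
  have one: "pcls (mat 1) \<in> S"
    using subgroup.one_closed[OF sub] by (simp add: one_PGL3)
  obtain M where M: "x = pcls M" "det M \<noteq> 0"
    using subgroup.subset[OF sub] x(1) by (auto simp: carrier_PGL3)
  have "y = 0" if e: "M *v y = k *s y" for y k
  proof (rule ccontr)
    assume y: "y \<noteq> 0"
    then have P: "vec.span {y} \<in> proj_points" by (auto simp: proj_points_def)
    have "k \<noteq> 0"
      using e y invertible_mult_vec_eq_iff[OF M(2), of y 0] by auto
    then have "act_point x (vec.span {y}) = vec.span {y}"
      by (simp add: M(1) act_point_pcls e span_singleton_eq)
    moreover have "act_point (pcls (mat 1)) (vec.span {y}) = vec.span {y}"
      by (simp add: act_point_pcls)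
    ultimately have "x = pcls (mat 1)"
      using reg[OF P P] x(1) one by blast
    then have "S \<subseteq> {pcls (mat 1)}"
      using x(2) G.generate_one by (simp add: one_PGL3)
    then have "card S \<le> 1"
      using card_mono[of "{pcls (mat 1 :: 'a^3^3)}" S] by simp
    then show False using card q2 by simp
  qed
  then obtain v l where v: "cubic_frame v" and l: "ext_mat M *v v = l *s v"
    using no_eigenvector_imp_cubic_frame[of M] by metis
  interpret cubic_frame v by fact
  \<comment> \<open>All classes with eigenvector \<open>v\<close>; being a subgroup that contains
    the generator, it contains \<open>S\<close>.\<close>
  define E where "E = {pcls N |N. det N \<noteq> 0 \<and> (\<exists>l. ext_mat N *v v = l *s v)}"
  have "subgroup E PGL3"
  proof (rule G.subgroupI)
    show "E \<subseteq> carrier PGL3" by (auto simp: E_def carrier_PGL3)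
    show "E \<noteq> {}" using l M by (auto simp: E_def)
    show "inv\<^bsub>PGL3\<^esub> a \<in> E" if a: "a \<in> E" for a
    proof -
      obtain N l where N: "a = pcls N" "det N \<noteq> 0" "ext_mat N *v v = l *s v"
        using a by (auto simp: E_def)
      obtain N' where N': "det N' \<noteq> 0" "N ** N' = mat 1" "N' ** N = mat 1"
        using pullback_inverse[OF N(2)] by metis
      have "l *s (ext_mat N' *v v) = ext_mat N' *v (ext_mat N *v v)"
        by (simp add: N(3) mult_vec_scale)
      also have "\<dots> = v"
        using N'(3) by (simp add: matrix_vector_mul_assoc ext_mat_mat flip: ext_mat_mult)
      finally have "inverse l *s v = inverse l *s (l *s (ext_mat N' *v v))" by simp
      then have "ext_mat N' *v v = inverse l *s v"
        using eigen_nonzero[OF N(3,2)] by simp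
      then have "pcls N' \<in> E" using N' by (auto simp: E_def)
      then show ?thesis
        using inv_PGL3[OF N'(3) N(2) N'(1)] N(1) by simp
    qed
    show "a \<otimes>\<^bsub>PGL3\<^esub> b \<in> E" if a: "a \<in> E" and b: "b \<in> E" for a b
    proof -
      obtain N l where N: "a = pcls N" "det N \<noteq> 0" "ext_mat N *v v = l *s v"
        using a by (auto simp: E_def)
      obtain K k where K: "b = pcls K" "det K \<noteq> 0" "ext_mat K *v v = k *s v"
        using b by (auto simp: E_def)
      have "ext_mat (N ** K) *v v = (k * l) *s v"
        by (simp add: ext_mat_mult K N mult_vec_scale flip: matrix_vector_mul_assoc)
      then have "pcls (N ** K) \<in> E" using N K by (auto simp: E_def det_mul)
      then show ?thesis using N K by (simp add: mult_PGL3)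
    qed
  qed
  then have SE: "S \<subseteq> E"
    using x(2) G.generate_subgroup_incl[of "{x}" E] l M by (auto simp: E_def)
  have S_eigen: "\<exists>N l. det N \<noteq> 0 \<and> g = pcls N \<and> ext_mat N *v v = l *s v" if "g \<in> S" for g
    using SE that by (auto simp: E_def)
  have S_all: "\<exists>N. det N \<noteq> 0 \<and> pcls N \<in> S \<and> ext_mat N *v v = u *s v" if u: "u \<in> cubic" "u \<noteq> 0" for u
  proof -
    have p: "vec.span {pt 1} \<in> proj_points" "vec.span {pt u} \<in> proj_points"
      using u by (auto simp: proj_points_def pt_eq_0_iff cubic_intros)
    \<comment> \<open>The element taking \<open>pt 1\<close> to \<open>pt u\<close> multiplies by
      \<open>u\<close> up to a factor in GF(q), which a change of representative removes.\<close>
    obtain g where g: "g \<in> S" "act_point g (vec.span {pt 1}) = vec.span {pt u}"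
      using reg[OF p] by blast
    obtain N l where N: "det N \<noteq> 0" "g = pcls N" "ext_mat N *v v = l *s v"
      using S_eigen[OF g(1)] by blast
    have lc: "l \<in> cubic" using eigen_cubic[OF N(3)] .
    have "vec.span {pt u} = vec.span {pt l}"
      using g(2) eigen_pt[OF N(3), of 1] by (simp add: N(2) act_point_pcls cubic_intros)
    then obtain k where "pt u = k *s pt l"
      using span_eq_imp by blast
    then have "pt u = pt (to_ac k * l)"
      using lc by (simp add: pt_scale)
    then have k: "u = to_ac k * l"
      using u lc by (simp add: pt_eq_iff cubic_intros)
    have k0: "k \<noteq> 0" using k u by auto
    have "pcls (mat k ** N) = pcls N"
      by (rule pcls_scale[OF k0])
    then have "pcls (mat k ** N) \<in> S" using g N by simp
    moreover have "det (mat k ** N) \<noteq> 0" using k0 N by (simp add: det_mul det_mat3)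
    moreover have "ext_mat (mat k ** N) *v v = u *s v"
      by (simp add: ext_mat_mult ext_mat_mat mat_mult_mult_vec N k)
    ultimately show ?thesis by blast
  qed
  have fix_tri: "act_point (ext_mat ` g) ` triangle v = triangle v" if g: "g \<in> S" for g
  proof -
    obtain N l where N: "det N \<noteq> 0" "g = pcls N" "ext_mat N *v v = l *s v"
      using S_eigen[OF g] by blast
    have "l \<noteq> 0" using eigen_nonzero N by blast
    then show ?thesis
      by (simp add: triangle_def N(2) act_ext_pcls N(3) eigen_frob[OF N(3)] span_singleton_eq)
  qed
  have "singer_triangle S = triangle v"
    unfolding singer_triangle_def
  proof (rule the_equality)
    show "is_triangle (triangle v) \<and> (\<forall>g\<in>S. act_point (ext_mat ` g) ` triangle v = triangle v)"
      using is_triangle_triangle fix_tri by blast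
  next
    fix T assume T: "is_triangle T \<and> (\<forall>g\<in>S. act_point (ext_mat ` g) ` T = T)"
    then have cT: "card T = 3" and "T \<subseteq> GF_points 3" by (auto simp: is_triangle_def)
    have "T \<subseteq> triangle v"
    proof
      fix P assume P: "P \<in> T"
      then obtain x where x: "x \<noteq> 0" "P = vec.span {x}"
        using \<open>T \<subseteq> GF_points 3\<close> by (auto simp: GF_points_def)
      show "P \<in> triangle v"
      proof (rule ccontr)
        assume "P \<notin> triangle v"
        then have nP: "vec.span {x} \<notin> triangle v" using x by simp
        \<comment> \<open>A vertex of an invariant triangle outside \<open>triangle v\<close> would
          have an orbit of \<open>q^2 + q + 1\<close> points, at least 7, inside a set of
          three.\<close>
        have "inj_on (\<lambda>g. act_point (ext_mat ` g) P) S"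
        proof (rule inj_onI)
          fix g h assume g: "g \<in> S" and h: "h \<in> S" and e: "act_point (ext_mat ` g) P = act_point (ext_mat ` h) P"
          obtain N l where N: "det N \<noteq> 0" "g = pcls N" "ext_mat N *v v = l *s v"
            using S_eigen[OF g] by blast
          obtain K k where K: "det K \<noteq> 0" "h = pcls K" "ext_mat K *v v = k *s v"
            using S_eigen[OF h] by blast
          show "g = h"
            using orbit_inj[OF x(1) nP N(3,1) K(3,1)] e by (simp add: N(2) K(2) x(2) act_ext_pcls)
        qed
        moreover have "(\<lambda>g. act_point (ext_mat ` g) P) ` S \<subseteq> T"
          using T P by blast
        ultimately have "card S \<le> card T"
          using cT by (metis card.infinite card_inj_on_le zero_neq_numeral)
        then show False using card cT q2 q4 by simp
      qed
    qed
    then show "T = triangle v"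
      using cT card_triangle card_subset_eq[of "triangle v" T] by (simp add: triangle_def)
  qed
  then have "singer v S"
    by unfold_locales (use S_eigen S_all in auto)
  then show thesis by (rule that)
qed

section \<open>The four families in coordinates\<close>

lemma (in cubic_frame) dot_pt:
  assumes "s \<in> cubic"
  shows "to_ac (scalar_product l (pt s)) = tr (scalar_product (ext_vec l) v * s)"
proof -
  have "to_ac (scalar_product l (pt s)) = scalar_product (ext_vec l) (ext_vec (pt s))"
    by (simp add: scalar_product_3)
  also have "\<dots> = s * scalar_product (ext_vec l) v + fr s * scalar_product (ext_vec l) (frob_vec v)
      + fr (fr s) * scalar_product (ext_vec l) (frob_vec (frob_vec v))"
    unfolding ext_pt[OF assms] by (simp add: scalar_product_3 algebra_simps)
  also have "\<dots> = tr (scalar_product (ext_vec l) v * s)"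
    unfolding scalar_product_frob tr_def by (simp add: mult.commute)
  finally show ?thesis .
qed

text \<open>Two independent points \<open>w\<close> and \<open>r * w\<close> of the line with
  equation \<open>tr (c * s) = 0\<close>; independence over GF(q) is the statement that
  \<open>r\<close> is not in GF(q).\<close>

lemma (in cubic_frame) two_trace_zeros:
  fixes c :: "'a alg_closure"
  assumes "c \<in> cubic"
  obtains w r where "w \<in> cubic" "w \<noteq> 0" "r \<in> cubic" "fr r \<noteq> r" "tr (c * w) = 0" "tr (c * (r * w)) = 0"
proof -
  obtain l :: "'a^3" where l: "scalar_product (ext_vec l) v = c"
    using dot_surj[OF assms] .
  obtain y y' where y: "y \<noteq> 0" "\<nexists>k. y' = k *s y" "scalar_product l y = 0" "scalar_product l y' = 0"
    using exists_two_perps by metis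
  obtain w where w: "w \<in> cubic" "y = pt w" by (rule pt_surj)
  obtain w' where w': "w' \<in> cubic" "y' = pt w'" by (rule pt_surj)
  have w0: "w \<noteq> 0" using w y(1) by auto
  define r where "r = w' / w"
  have r: "r \<in> cubic" "w' = r * w" using w w' w0 by (simp_all add: r_def cubic_intros)
  have "fr r \<noteq> r"
  proof
    assume "fr r = r"
    then obtain k where "r = to_ac k" by (metis fr_fixed_iff imageE)
    then have "y' = k *s y" using w w' r by (simp add: pt_scale)
    then show False using y by blast
  qed
  moreover have "tr (c * w) = 0" "tr (c * (r * w)) = 0"
    using dot_pt[OF w(1), of l] dot_pt[OF w'(1), of l] y w w' r by (simp_all add: l)
  ultimately show thesis using that w(1) w0 r(1) by blast
qed

context singer begin

definition mulmat :: "'a alg_closure \<Rightarrow> 'a^3^3" where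
  "mulmat u = (SOME N. det N \<noteq> 0 \<and> pcls N \<in> S \<and> ext_mat N *v v = u *s v)"

lemma mulmat:
  assumes "u \<in> cubic" "u \<noteq> 0"
  shows "det (mulmat u) \<noteq> 0" "pcls (mulmat u) \<in> S" "ext_mat (mulmat u) *v v = u *s v"
  using someI_ex[OF S_all[OF assms]] unfolding mulmat_def by blast+

definition tw :: "'a alg_closure \<Rightarrow> 'a^6 \<Rightarrow> 'a^6" where
  "tw u f = pullback (mulmat u) f"

lemma tw_coeffs:
  assumes "u \<in> cubic" "u \<noteq> 0"
  shows "c0 (tw u f) = u^2 * c0 f" "c1 (tw u f) = u * fr u * c1 f"
  using eigen_coeffs[OF mulmat(3)[OF assms]] by (simp_all add: tw_def)

lemma tw_1: "tw 1 f = f"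
  by (simp add: form_eq_iff tw_coeffs cubic_intros)

lemma tw_tw:
  assumes "u \<in> cubic" "u \<noteq> 0" "w \<in> cubic" "w \<noteq> 0"
  shows "tw u (tw w f) = tw (u * w) f"
  using assms by (simp add: form_eq_iff tw_coeffs cubic_intros power_mult_distrib)

lemma tw_eq_0_iff: "u \<in> cubic \<Longrightarrow> u \<noteq> 0 \<Longrightarrow> tw u f = 0 \<longleftrightarrow> f = 0"
  by (simp add: form_eq_0_iff tw_coeffs)

lemma rep_tw:
  assumes "u \<in> cubic" "u \<noteq> 0"
  shows "rep (tw u f) \<longleftrightarrow> rep f"
proof
  assume "rep (tw u f)"
  then have "rep (tw (inverse u) (tw u f))"
    unfolding tw_def[of "inverse u"] by (rule rep_pullback)
  then show "rep f"
    using assms by (simp add: tw_tw cubic_intros tw_1)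
qed (simp add: tw_def rep_pullback)

lemma sing_tw:
  assumes "u \<in> cubic" "u \<noteq> 0" "s \<in> cubic"
  shows "sing (tw u f) (pt s) \<longleftrightarrow> sing f (pt (u * s))"
  unfolding tw_def sing_pullback[OF mulmat(1)[OF assms(1,2)]] eigen_pt[OF mulmat(3)[OF assms(1,2)] assms(3)] ..

lemma orbit_eq: "quadric_orbit S (quadric f) = {quadric (tw u f) |u. u \<in> cubic \<and> u \<noteq> 0}"
proof -
  \<comment> \<open>Acting on quadrics is pullback by the inverse, whence \<open>inverse l\<close>;
    over a whole orbit this only reparametrizes the multiplier.\<close>
  have *: "act_quadric (pcls N) (quadric f) = quadric (tw (inverse l) f)"
    if N: "det N \<noteq> 0" "ext_mat N *v v = l *s v" for N l
  proof -
    have l: "l \<in> cubic" "l \<noteq> 0" using eigen_cubic eigen_nonzero N by auto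
    then have il: "inverse l \<in> cubic" "inverse l \<noteq> 0" by (simp_all add: cubic_intros)
    obtain N' where N': "N ** N' = mat 1" "N' ** N = mat 1"
      using pullback_inverse[OF N(1)] by metis
    have "ext_mat (N ** mulmat (inverse l)) *v v = ext_mat (N ** N') *v v"
      using l by (simp add: ext_mat_mult mulmat(3)[OF il] mult_vec_scale N N'(1) ext_mat_mat
          flip: matrix_vector_mul_assoc)
    then have "N ** mulmat (inverse l) = N ** N'" by (rule matrix_eqI)
    then have "N' ** (N ** mulmat (inverse l)) = N' ** (N ** N')" by simp
    then have "mulmat (inverse l) = N'"
      by (simp add: matrix_mul_assoc N'(2))
    then show ?thesis by (simp add: act_quadric_pcls[OF N'] tw_def)
  qed
  show ?thesis
  proof (intro equalityI subsetI)
    fix Q assume "Q \<in> quadric_orbit S (quadric f)"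
    then obtain g where g: "g \<in> S" "Q = act_quadric g (quadric f)"
      by (auto simp: quadric_orbit_def)
    obtain N l where N: "det N \<noteq> 0" "g = pcls N" "ext_mat N *v v = l *s v"
      using S_eigen[OF g(1)] by blast
    have "l \<in> cubic" "l \<noteq> 0" using eigen_cubic eigen_nonzero N by auto
    then have "inverse l \<in> cubic" "inverse l \<noteq> 0" by (simp_all add: cubic_intros)
    then show "Q \<in> {quadric (tw u f) |u. u \<in> cubic \<and> u \<noteq> 0}"
      using g(2) *[OF N(1,3)] N(2) by blast
  next
    fix Q assume "Q \<in> {quadric (tw u f) |u. u \<in> cubic \<and> u \<noteq> 0}"
    then obtain u where u: "u \<in> cubic" "u \<noteq> 0" "Q = quadric (tw u f)" by blast
    then have iu: "inverse u \<in> cubic" "inverse u \<noteq> 0" by (simp_all add: cubic_intros)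
    have "act_quadric (pcls (mulmat (inverse u))) (quadric f) = Q"
      using *[OF mulmat(1,3)[OF iu]] u by simp
    then show "Q \<in> quadric_orbit S (quadric f)"
      using mulmat(2)[OF iu] by (auto simp: quadric_orbit_def)
  qed
qed

lemma tw_in_bplane:
  assumes g: "base g" and u: "u \<in> cubic" "u \<noteq> 0" "tr (c * u) = 0"
  shows "tw u g \<in> bplane g c"
proof -
  have "c * u^2 + fr c * (u * fr u) + fr (fr (c * (u * fr u))) = u * tr (c * u)"
    by (simp add: tr_def cubicD[OF u(1)] power2_eq_square algebra_simps)
  then show ?thesis
    using u base_c0[OF g] base_c1[OF g] by (simp add: bplane_def tw_coeffs)
qed

text \<open>A line over GF(2) has just three points, so exactly the multipliers \<open>w\<close>,
  \<open>r * w\<close> and \<open>(1 + r) * w\<close> are used. Their squares in the tensor sense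
  are three points of a conic, hence independent, and the count \<open>q^3\<close> forces
  equality.\<close>

lemma span_tw:
  assumes g: "base g" and c: "c \<in> cubic" "c \<noteq> 0"
  shows "vec.span {tw u g |u. u \<in> cubic \<and> u \<noteq> 0 \<and> tr (c * u) = 0} = bplane g c" (is "vec.span ?T = _")
proof (rule card_seteq)
  show "finite (bplane g c)" by simp
  show "vec.span ?T \<subseteq> bplane g c"
    by (rule vec.span_minimal[OF _ subspace_bplane]) (use tw_in_bplane[OF g] in blast)
  obtain w r where w: "w \<in> cubic" "w \<noteq> 0" and r: "r \<in> cubic" "fr r \<noteq> r"
    and t: "tr (c * w) = 0" "tr (c * (r * w)) = 0"
    using two_trace_zeros[OF c(1)] .
  have r0: "r \<noteq> 0" "1 + r \<noteq> 0"
    using r(2) by (auto simp: add_eq_0_iff)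
  define f1 f2 f3 where "f1 = tw w g" and "f2 = tw (r * w) g" and "f3 = tw ((1 + r) * w) g"
  have "tr (c * ((1 + r) * w)) = tr (c * w) + tr (c * (r * w))"
    by (simp add: tr_def algebra_simps)
  then have t3: "tr (c * ((1 + r) * w)) = 0"
    using t by simp
  have m: "f1 \<in> ?T" "f2 \<in> ?T" "f3 \<in> ?T"
  proof -
    have "r * w \<in> cubic" "r * w \<noteq> 0" "(1 + r) * w \<in> cubic" "(1 + r) * w \<noteq> 0"
      using w r r0 by (simp_all add: cubic_intros)
    then show "f1 \<in> ?T" "f2 \<in> ?T" "f3 \<in> ?T"
      unfolding f1_def f2_def f3_def using w t t3 by blast+
  qed
  have F0: "c0 f1 = w^2 * c0 g" "c0 f2 = (r * w)^2 * c0 g" "c0 f3 = ((1 + r) * w)^2 * c0 g"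
    and F1: "c1 f1 = w * fr w * c1 g" "c1 f2 = r * w * fr (r * w) * c1 g" "c1 f3 = (1 + r) * w * fr ((1 + r) * w) * c1 g"
    using w r r0 unfolding f1_def f2_def f3_def by (simp_all only: tw_coeffs cubic_intros no_zero_divisors simp_thms)
  define h :: "'a^3 \<Rightarrow> 'a^6" where "h z = z$1 *s f1 + z$2 *s f2 + z$3 *s f3" for z
  have "inj h"
  proof (rule injI)
    fix z z' assume e: "h z = h z'"
    define x where "x = z - z'"
    define x1 x2 x3 where "x1 = to_ac (x$1)" and "x2 = to_ac (x$2)" and "x3 = to_ac (x$3)"
    have "h x = 0"
      using e unfolding h_def x_def by (simp add: vec_eq_iff algebra_simps)
    then have e0: "c0 (h x) = 0" and e1: "c1 (h x) = 0"
      by (simp_all add: form_eq_0_iff)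
    have "c0 (h x) = w^2 * c0 g * (x1 + x2 * r^2 + x3 * (1 + r)^2)"
      unfolding h_def x1_def x2_def x3_def c0_linear F0
      by (simp add: power2_eq_square algebra_simps)
    with e0 have A: "x1 + x2 * r^2 + x3 * (1 + r)^2 = 0"
      using w base_c0[OF g] by simp
    have "c1 (h x) = w * fr w * c1 g * (x1 + x2 * (r * fr r) + x3 * ((1 + r) * (1 + fr r)))"
      unfolding h_def x1_def x2_def x3_def c1_linear F1
      by (simp add: algebra_simps)
    with e1 have B: "x1 + x2 * (r * fr r) + x3 * ((1 + r) * (1 + fr r)) = 0"
      using w base_c1[OF g] by simp
    \<comment> \<open>The difference of relations \<open>A\<close> and \<open>B\<close> has the
      nonzero factor \<open>r - fr r\<close>. Doing the same with the resulting relation and its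
      conjugate isolates \<open>x2 + x3\<close>.\<close>
    have "(r - fr r) * (x2 * r + x3 * (1 + r)) =
        (x1 + x2 * r^2 + x3 * (1 + r)^2) - (x1 + x2 * (r * fr r) + x3 * ((1 + r) * (1 + fr r)))"
      by (simp add: power2_eq_square algebra_simps)
    then have C: "x2 * r + x3 * (1 + r) = 0"
      using A B r(2) by auto
    have D: "x2 * fr r + x3 * (1 + fr r) = 0"
      using arg_cong[OF C, of fr] by (simp add: x2_def x3_def)
    have "(r - fr r) * (x2 + x3) = (x2 * r + x3 * (1 + r)) - (x2 * fr r + x3 * (1 + fr r))"
      by (simp add: algebra_simps)
    then have E: "x2 + x3 = 0" using C D r(2) by auto
    have "x3 = (x2 * r + x3 * (1 + r)) - (x2 + x3) * r"
      by (simp add: algebra_simps)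
    then have x3: "x3 = 0" using C E by simp
    then have x2: "x2 = 0" using E by simp
    have "x1 = 0" using A x2 x3 by simp
    then have "x = 0" using x2 x3 by (simp add: x1_def x2_def x3_def vec_eq_iff forall_3)
    then show "z = z'" by (simp add: x_def)
  qed
  have "range h \<subseteq> vec.span ?T"
  proof
    fix k assume "k \<in> range h"
    then obtain z :: "'a^3" where k: "k = z$1 *s f1 + z$2 *s f2 + z$3 *s f3" by (auto simp: h_def)
    show "k \<in> vec.span ?T"
      unfolding k by (intro vec.span_add vec.span_scale vec.span_base m)
  qed
  then have "card (range h) \<le> card (vec.span ?T)"
    by (intro card_mono) auto
  moreover have "card (range h) = CARD('a) ^ 3"
    using card_image[OF \<open>inj h\<close>] by simp
  ultimately show "card (bplane g c) \<le> card (vec.span ?T)"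
    using card_bplane[OF g c] by simp
qed

text \<open>With \<open>n\<close> the norm of \<open>u\<close>, the product of
  \<open>inverse u\<close> and its conjugate is \<open>fr (fr u) / n\<close>. The equation of the
  conic becomes linear in \<open>u\<close>, and conjugating under the trace brings it to the stated
  form.\<close>

lemma conic_through_inverse:
  assumes h: "h \<in> through v" and u: "u \<in> cubic" "u \<noteq> 0"
  shows "qeval h (pt (inverse u)) = 0 \<longleftrightarrow> tr (fr (c1 h) * u) = 0"
proof -
  define n where "n = u * fr u * fr (fr u)"
  have fn: "fr n = n" using cubicD[OF u(1)] by (simp add: n_def mult_ac)
  have n0: "n \<noteq> 0" using u by (simp add: n_def)
  have iu: "inverse u \<in> cubic" using u by (simp add: cubic_intros)
  have "to_ac (qeval h (pt (inverse u))) = tr (c1 h * inverse u * fr (inverse u))"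
    using qeval_pt[OF iu, of h] h by (simp add: through_eq)
  also have "c1 h * inverse u * fr (inverse u) = c1 h * fr (fr u) / n"
    using u by (simp add: n_def field_simps)
  also have "tr (c1 h * fr (fr u) / n) = tr (c1 h * fr (fr u)) / n"
    by (simp add: tr_def fn add_divide_distrib)
  also have "tr (c1 h * fr (fr u)) = tr (fr (c1 h * fr (fr u)))"
    by (rule tr_fr[symmetric]) (use u in \<open>simp add: cubic_simps\<close>)
  also have "fr (c1 h * fr (fr u)) = fr (c1 h) * u"
    using cubicD[OF u(1)] by simp
  finally show ?thesis using n0 by (metis divide_eq_0_iff to_ac_eq_0_iff)
qed

text \<open>\<open>P\<close> stands for \<open>biline_centered\<close> or \<open>imag_biline_centered\<close>. The center of the image of \<open>f\<close> under
  multiplication by \<open>u\<close> is \<open>pt (s / u)\<close>, and inversion maps the conics of the bundle to lines.\<close>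

lemma center_plane:
  fixes P :: "('a^3) set \<Rightarrow> ('a^6) set \<Rightarrow> bool"
  assumes f: "f \<noteq> 0" "\<not> rep f" and s: "s \<in> cubic" "s \<noteq> 0" "sing f (pt s)"
    and P1: "\<And>A Q. P A Q \<Longrightarrow> biline_centered A Q \<or> imag_biline_centered A Q"
    and P2: "\<And>u y. u \<in> cubic \<Longrightarrow> u \<noteq> 0 \<Longrightarrow> y \<noteq> 0 \<Longrightarrow> sing (tw u f) y \<Longrightarrow> P (vec.span {y}) (quadric (tw u f))"
    and h: "h \<in> through v" "h \<noteq> 0"
  shows "proj_span (veronese ` {\<beta> \<in> quadric_orbit S (quadric f). \<exists>A\<in>zero_locus (quadric h). P A \<beta>})
      = subspace_points (bplane (tw s f) (fr (c1 h)))"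
    and "base (tw s f)"
proof -
  define g where "g = tw s f"
  define c where "c = fr (c1 h)"
  have "c1 h \<noteq> 0" using h by (auto simp: form_eq_0_iff through_eq)
  then have c: "c \<in> cubic" "c \<noteq> 0" by (simp_all add: c_def cubic_simps)
  have "sing g (pt 1)" using s by (simp add: g_def sing_tw cubic_intros)
  then have g: "base g" using f s by (simp add: base_def g_def tw_eq_0_iff rep_tw)
  then show "base (tw s f)" by (simp add: g_def)
  have tg: "tw u g = tw (u * s) f" if "u \<in> cubic" "u \<noteq> 0" for u
    using that s by (simp add: g_def tw_tw)
  have cen: "(\<exists>A\<in>zero_locus (quadric h). P A (quadric (tw u g))) \<longleftrightarrow> tr (c * u) = 0"
    if u: "u \<in> cubic" "u \<noteq> 0" for u
  proof -
    \<comment> \<open>The vertex of \<open>tw u g\<close>, as \<open>g\<close> has its vertex at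
      \<open>pt 1\<close>. Membership of the center in the conic is decided here alone, because
      \<open>tw u g\<close> has no second vertex.\<close>
    define y where "y = pt (inverse u)"
    have iu: "inverse u \<in> cubic" "inverse u \<noteq> 0" using u by (simp_all add: cubic_intros)
    have y0: "y \<noteq> 0" using iu by (simp add: y_def pt_eq_0_iff)
    have sy: "sing (tw u g) y"
      using \<open>sing g (pt 1)\<close> u iu by (simp add: y_def sing_tw)
    have nr: "\<not> rep (tw u g)" "tw u g \<noteq> 0"
      using g u by (simp_all add: base_def rep_tw tw_eq_0_iff)
    have "(\<exists>A\<in>zero_locus (quadric h). P A (quadric (tw u g))) \<longleftrightarrow> qeval h y = 0"
    proof
      assume "\<exists>A\<in>zero_locus (quadric h). P A (quadric (tw u g))"
      then obtain A where A: "A \<in> zero_locus (quadric h)" "P A (quadric (tw u g))" by blast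
      obtain f' x where x: "quadric (tw u g) = quadric f'" "A = vec.span {x}" "x \<noteq> 0" "sing f' x"
        using centered_imp[OF P1[OF A(2)]] by blast
      obtain k where k: "k \<noteq> 0" "f' = k *s tw u g" using x(1) by (auto simp: quadric_eq_iff)
      then have "sing (tw u g) x" using x(4) sing_smult by blast
      then obtain d where "y = d *s x" using sing_unique[of "tw u g" x y] sy x(3) nr by blast
      moreover have "qeval h x = 0" using A(1) x span_in_zero_locus by blast
      ultimately show "qeval h y = 0" by (simp add: qeval_scale)
    next
      assume "qeval h y = 0"
      then have "vec.span {y} \<in> zero_locus (quadric h)" using y0 span_in_zero_locus by blast
      moreover have "P (vec.span {y}) (quadric (tw u g))"
        using P2[of "u * s" y] u s y0 sy by (simp add: tg cubic_intros)
      ultimately show "\<exists>A\<in>zero_locus (quadric h). P A (quadric (tw u g))" by blast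
    qed
    then show ?thesis
      unfolding y_def c_def using conic_through_inverse[OF h(1) u] by simp
  qed
  have orb: "quadric_orbit S (quadric f) = {quadric (tw u g) |u. u \<in> cubic \<and> u \<noteq> 0}"
  proof (intro equalityI subsetI)
    fix Q assume "Q \<in> quadric_orbit S (quadric f)"
    then obtain u where u: "u \<in> cubic" "u \<noteq> 0" "Q = quadric (tw u f)" by (auto simp: orbit_eq)
    then have "Q = quadric (tw (u / s) g)" "u / s \<in> cubic" "u / s \<noteq> 0"
      using s by (simp_all add: tg cubic_intros)
    then show "Q \<in> {quadric (tw u g) |u. u \<in> cubic \<and> u \<noteq> 0}" by blast
  next
    fix Q assume "Q \<in> {quadric (tw u g) |u. u \<in> cubic \<and> u \<noteq> 0}"
    then obtain u where u: "u \<in> cubic" "u \<noteq> 0" "Q = quadric (tw u g)" by blast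
    then have "Q = quadric (tw (u * s) f)" "u * s \<in> cubic" "u * s \<noteq> 0"
      using s by (simp_all add: tg cubic_intros)
    then show "Q \<in> quadric_orbit S (quadric f)" unfolding orbit_eq by blast
  qed
  define T where "T = {tw u g |u. u \<in> cubic \<and> u \<noteq> 0 \<and> tr (c * u) = 0}"
  have "{\<beta> \<in> quadric_orbit S (quadric f). \<exists>A\<in>zero_locus (quadric h). P A \<beta>} = quadric ` T"
    unfolding orb T_def using cen by blast
  then have "\<Union> (veronese ` {\<beta> \<in> quadric_orbit S (quadric f). \<exists>A\<in>zero_locus (quadric h). P A \<beta>}) = (\<Union>f\<in>T. vec.span {f})"
    by (simp add: veronese_quadric)
  moreover have "vec.span (\<Union>f\<in>T. vec.span {f}) = vec.span T"
  proof (rule antisym)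
    show "vec.span (\<Union>f\<in>T. vec.span {f}) \<subseteq> vec.span T"
      by (rule vec.span_minimal[OF _ vec.subspace_span]) (use vec.span_mono[of "{_}" T] in blast)
    show "vec.span T \<subseteq> vec.span (\<Union>f\<in>T. vec.span {f})"
      by (rule vec.span_mono) (use vec.span_base in blast)
  qed
  moreover have "vec.span T = bplane g c"
    unfolding T_def by (rule span_tw[OF g c])
  ultimately show "proj_span (veronese ` {\<beta> \<in> quadric_orbit S (quadric f). \<exists>A\<in>zero_locus (quadric h). P A \<beta>})
      = subspace_points (bplane (tw s f) (fr (c1 h)))"
    by (simp add: proj_span_def g_def c_def)
qed

lemma circumscribed_bundle_eq: "circumscribed_bundle S = {quadric f |f. f \<in> through v \<and> f \<noteq> 0}"
  unfolding circumscribed_bundle_def triangle_S by (rule conics_through_triangle)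

lemma planes_C_eq: "planes_C S = {subspace_points (through (ext_mat N *v v)) |N. det N \<noteq> 0}"
proof -
  have "planes_C S = {veronese ` (act_quadric (pcls N) ` {quadric f |f. f \<in> through v \<and> f \<noteq> 0}) |N. det N \<noteq> 0}"
    unfolding planes_C_def circumscribed_bundle_eq carrier_PGL3 by blast
  also have "\<dots> = {subspace_points (through (ext_mat N *v v)) |N. det N \<noteq> 0}"
    by (intro Collect_cong iff_exI rev_conj_cong refl) (simp add: plane_of_act)
  finally show ?thesis .
qed

lemma real_pair_tw: "real_pair f l m \<Longrightarrow> u \<in> cubic \<Longrightarrow> u \<noteq> 0 \<Longrightarrow> \<exists>l m. real_pair (tw u f) l m"
  using real_pair_pullback pullback_inverse[OF mulmat(1)] unfolding tw_def by metis

lemma conj_pair_tw: "conj_pair f l \<Longrightarrow> u \<in> cubic \<Longrightarrow> u \<noteq> 0 \<Longrightarrow> \<exists>l. conj_pair (tw u f) l"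
  using conj_pair_pullback pullback_inverse[OF mulmat(1)] unfolding tw_def by metis

lemma real_pair_plane:
  assumes f: "real_pair f l m" and s: "s \<in> cubic" "s \<noteq> 0" "sing f (pt s)" and h: "h \<in> through v" "h \<noteq> 0"
  shows "proj_span (veronese ` {\<beta> \<in> quadric_orbit S (quadric f). \<exists>A\<in>zero_locus (quadric h). biline_centered A \<beta>})
      = subspace_points (bplane (tw s f) (fr (c1 h)))"
    and "base (tw s f)"
proof -
  have c: "biline_centered A Q \<or> imag_biline_centered A Q" if "biline_centered A Q" for A Q
    using that by blast
  have t: "biline_centered (vec.span {y}) (quadric (tw u f))" if "u \<in> cubic" "u \<noteq> 0" "y \<noteq> 0" "sing (tw u f) y" for u y
    using real_pair_biline(2) real_pair_tw[OF f] that by blast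
  note * = center_plane[where P = biline_centered, OF real_pair_nonzero[OF f] real_pair_not_rep[OF f] s c t h]
  show "proj_span (veronese ` {\<beta> \<in> quadric_orbit S (quadric f). \<exists>A\<in>zero_locus (quadric h). biline_centered A \<beta>})
      = subspace_points (bplane (tw s f) (fr (c1 h)))"
    by (rule *(1))
  show "base (tw s f)"
    by (rule *(2))
qed

lemma conj_pair_plane:
  assumes f: "conj_pair f l" and s: "s \<in> cubic" "s \<noteq> 0" "sing f (pt s)" and h: "h \<in> through v" "h \<noteq> 0"
  shows "proj_span (veronese ` {\<beta> \<in> quadric_orbit S (quadric f). \<exists>A\<in>zero_locus (quadric h). imag_biline_centered A \<beta>})
      = subspace_points (bplane (tw s f) (fr (c1 h)))"
    and "base (tw s f)"
proof -
  have c: "biline_centered A Q \<or> imag_biline_centered A Q" if "imag_biline_centered A Q" for A Q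
    using that by blast
  have t: "imag_biline_centered (vec.span {y}) (quadric (tw u f))" if "u \<in> cubic" "u \<noteq> 0" "y \<noteq> 0" "sing (tw u f) y" for u y
    using conj_pair_imag_biline(2) conj_pair_tw[OF f] that by blast
  note * = center_plane[where P = imag_biline_centered, OF conj_pair_nonzero[OF f] conj_pair_not_rep[OF f] s c t h]
  show "proj_span (veronese ` {\<beta> \<in> quadric_orbit S (quadric f). \<exists>A\<in>zero_locus (quadric h). imag_biline_centered A \<beta>})
      = subspace_points (bplane (tw s f) (fr (c1 h)))"
    by (rule *(1))
  show "base (tw s f)"
    by (rule *(2))
qed

lemma sing_point_pt:
  assumes "y \<noteq> 0" "sing f y"
  obtains s where "s \<in> cubic" "s \<noteq> 0" "sing f (pt s)"
proof -
  obtain s where "s \<in> cubic" "y = pt s" by (rule pt_surj)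
  then show thesis using that[of s] assms by (cases "s = 0") auto
qed

lemma planes_ei_eq: "planes_e S \<union> planes_i S = {subspace_points (bplane g c) |g c. base g \<and> c \<in> cubic \<and> c \<noteq> 0}"
proof (intro equalityI subsetI)
  have c: "fr (c1 h) \<in> cubic \<and> fr (c1 h) \<noteq> 0" if "h \<in> through v" "h \<noteq> 0" for h
    using that by (auto simp: form_eq_0_iff through_eq cubic_simps)
  fix \<pi> assume "\<pi> \<in> planes_e S \<union> planes_i S"
  then show "\<pi> \<in> {subspace_points (bplane g c) |g c. base g \<and> c \<in> cubic \<and> c \<noteq> 0}"
  proof
    assume "\<pi> \<in> planes_e S"
    then obtain \<beta> C where b: "biline \<beta>" "C \<in> circumscribed_bundle S"
      "\<pi> = proj_span (veronese ` {\<beta>' \<in> quadric_orbit S \<beta>. \<exists>A\<in>zero_locus C. biline_centered A \<beta>'})"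
      unfolding planes_e_def by blast
    obtain f l m where f: "\<beta> = quadric f" "real_pair f l m" using b(1) by (rule biline_real_pair)
    obtain h where h: "C = quadric h" "h \<in> through v" "h \<noteq> 0" using b(2) unfolding circumscribed_bundle_eq by blast
    obtain y where "y \<noteq> 0" "sing f y" using real_pair_sing[OF f(2)] .
    then obtain s where s: "s \<in> cubic" "s \<noteq> 0" "sing f (pt s)" by (rule sing_point_pt)
    show ?thesis
      unfolding b(3) f(1) h(1) real_pair_plane(1)[OF f(2) s h(2,3)]
      using real_pair_plane(2)[OF f(2) s h(2,3)] c[OF h(2,3)] by blast
  next
    assume "\<pi> \<in> planes_i S"
    then obtain \<beta> C where b: "imag_biline \<beta>" "C \<in> circumscribed_bundle S"
      "\<pi> = proj_span (veronese ` {\<beta>' \<in> quadric_orbit S \<beta>. \<exists>A\<in>zero_locus C. imag_biline_centered A \<beta>'})"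
      unfolding planes_i_def by blast
    obtain f l where f: "\<beta> = quadric f" "conj_pair f l" using b(1) by (rule imag_biline_conj_pair)
    obtain h where h: "C = quadric h" "h \<in> through v" "h \<noteq> 0" using b(2) unfolding circumscribed_bundle_eq by blast
    obtain y where "y \<noteq> 0" "sing f y" using conj_pair_sing[OF f(2)] .
    then obtain s where s: "s \<in> cubic" "s \<noteq> 0" "sing f (pt s)" by (rule sing_point_pt)
    show ?thesis
      unfolding b(3) f(1) h(1) conj_pair_plane(1)[OF f(2) s h(2,3)]
      using conj_pair_plane(2)[OF f(2) s h(2,3)] c[OF h(2,3)] by blast
  qed
next
  fix \<pi> assume "\<pi> \<in> {subspace_points (bplane g c) |g c. base g \<and> c \<in> cubic \<and> c \<noteq> 0}"
  then obtain g c where g: "\<pi> = subspace_points (bplane g c)" "base g" "c \<in> cubic" "c \<noteq> 0" by blast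
  \<comment> \<open>The conic of the bundle whose plane has \<open>fr (c1 h) = c\<close> as its
    line.\<close>
  obtain h where h: "c0 h = 0" "c1 h = fr (fr c)"
    using form_exists[of 0 "fr (fr c)"] g(3) by (auto simp: cubic_intros)
  have ch: "fr (c1 h) = c" using h g(3) by (simp add: cubicD)
  have hv: "h \<in> through v" "h \<noteq> 0"
    using h g(4) by (auto simp: through_eq form_eq_0_iff)
  have C: "quadric h \<in> circumscribed_bundle S" unfolding circumscribed_bundle_eq using hv by blast
  have s: "(1 :: 'a alg_closure) \<in> cubic" "(1 :: 'a alg_closure) \<noteq> 0" "sing g (pt 1)"
    using g(2) by (simp_all add: base_def cubic_intros)
  have "pt 1 \<noteq> 0" by (simp add: pt_eq_0_iff cubic_intros)
  then consider l m where "real_pair g l m" | l where "conj_pair g l"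
    using sing_form_cases[of g "pt 1"] g(2) by (auto simp: base_def)
  then show "\<pi> \<in> planes_e S \<union> planes_i S"
  proof cases
    case 1
    have "\<pi> = proj_span (veronese ` {\<beta> \<in> quadric_orbit S (quadric g). \<exists>A\<in>zero_locus (quadric h). biline_centered A \<beta>})"
      using real_pair_plane(1)[OF 1 s hv] by (simp add: g(1) tw_1 ch)
    then have "\<pi> \<in> planes_e S"
      unfolding planes_e_def using real_pair_biline(1)[OF 1] C by blast
    then show ?thesis by blast
  next
    case 2
    have "\<pi> = proj_span (veronese ` {\<beta> \<in> quadric_orbit S (quadric g). \<exists>A\<in>zero_locus (quadric h). imag_biline_centered A \<beta>})"
      using conj_pair_plane(1)[OF 2 s hv] by (simp add: g(1) tw_1 ch)
    then have "\<pi> \<in> planes_i S"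
      unfolding planes_i_def using conj_pair_imag_biline(1)[OF 2] C by blast
    then show ?thesis by blast
  qed
qed

lemma planes_N_eq: "(planes_N :: ('a^6) set set set) = {subspace_points {f. sing f y} |y. y \<noteq> 0}"
proof -
  have "(planes_N :: ('a^6) set set set) = {nucleus_plane (vec.span {y}) |y. y \<noteq> 0}"
    unfolding planes_N_def proj_points_def by blast
  also have "\<dots> = {subspace_points {f. sing f y} |y. y \<noteq> 0}"
    by (intro Collect_cong iff_exI rev_conj_cong refl) (simp add: nucleus_plane_eq)
  finally show ?thesis .
qed

end

section \<open>Counting the planes\<close>

lemma card_by_fibres:
  assumes "finite A" "\<And>x. x \<in> A \<Longrightarrow> card {y \<in> A. F y = F x} = k"
  shows "card A = k * card (F ` A)"
proof -
  have "card A = (\<Sum>b\<in>F ` A. card {y \<in> A. F y = b})"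
    using sum.image_gen[OF assms(1), of "\<lambda>_. 1::nat" F] by simp
  also have "\<dots> = (\<Sum>b\<in>F ` A. k)"
    using assms(2) by (intro sum.cong refl) auto
  finally show ?thesis by simp
qed

lemma distinct_subspace_points:
  fixes U V :: "('a::finite_field^'n) set"
  assumes "vec.subspace U" "vec.subspace V" "card U = CARD('a) ^ 3" "thin (U \<inter> V)"
  shows "subspace_points U \<noteq> subspace_points V"
proof
  assume "subspace_points U = subspace_points V"
  then have "U = V" using subspace_points_eq_imp assms by blast
  then show False using assms not_thin_card_cube[of U] by simp
qed

lemma card_span_pair:
  fixes x y :: "'a::finite_field^'n"
  shows "x \<noteq> 0 \<Longrightarrow> card (vec.span {x}) = CARD('a)"
    and "x \<noteq> 0 \<Longrightarrow> y \<notin> vec.span {x} \<Longrightarrow> card (vec.span {y, x}) = CARD('a)^2"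
proof -
  show 1: "card (vec.span {x}) = CARD('a)" if "x \<noteq> 0"
    using card_span_insert[of x "{}"] that by simp
  show "card (vec.span {y, x}) = CARD('a)^2" if "x \<noteq> 0" "y \<notin> vec.span {x}"
    using card_span_insert[of y "{x}"] that 1 by (simp add: power2_eq_square)
qed

lemma span_pair_iff: "z \<in> vec.span {y, x} \<longleftrightarrow> (\<exists>a b. z = a *s x + b *s (y :: 'k::field^'n))"
  by (auto simp: vec.span_insert vec.span_singleton image_iff algebra_simps) (metis add.commute)+

lemma det_columns_iff:
  fixes M :: "'k::field^3^3"
  shows "det M \<noteq> 0 \<longleftrightarrow> column 1 M \<noteq> 0 \<and> column 2 M \<notin> vec.span {column 1 M} \<and> column 3 M \<notin> vec.span {column 2 M, column 1 M}"
proof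
  assume d: "det M \<noteq> 0"
  have inj: "z = 0" if "z$1 *s column 1 M + z$2 *s column 2 M + z$3 *s column 3 M = 0" for z :: "'k^3"
    using that invertible_mult_vec_eq_iff[OF d, of z 0] by (simp add: matrix_vector_columns)
  have "column 1 M \<noteq> 0"
    using inj[of "vector [1,0,0]"] by (auto simp: vec_eq_iff forall_3)
  moreover have "column 2 M \<notin> vec.span {column 1 M}"
  proof
    assume "column 2 M \<in> vec.span {column 1 M}"
    then obtain k where "column 2 M = k *s column 1 M" by (auto simp: vec.span_singleton)
    then show False using inj[of "vector [k,-1,0]"] by (simp add: vec_eq_iff forall_3)
  qed
  moreover have "column 3 M \<notin> vec.span {column 2 M, column 1 M}"
  proof
    assume "column 3 M \<in> vec.span {column 2 M, column 1 M}"
    then obtain a b where "column 3 M = a *s column 1 M + b *s column 2 M" by (auto simp: span_pair_iff)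
    then show False using inj[of "vector [a,b,-1]"] by (simp add: vec_eq_iff forall_3)
  qed
  ultimately show "column 1 M \<noteq> 0 \<and> column 2 M \<notin> vec.span {column 1 M} \<and> column 3 M \<notin> vec.span {column 2 M, column 1 M}"
    by blast
next
  assume c: "column 1 M \<noteq> 0 \<and> column 2 M \<notin> vec.span {column 1 M} \<and> column 3 M \<notin> vec.span {column 2 M, column 1 M}"
  show "det M \<noteq> 0"
  proof
    assume "det M = 0"
    then obtain z where z: "z \<noteq> 0" "M *v z = 0" by (rule det_eq_0_kernel)
    then have e: "z$1 *s column 1 M + z$2 *s column 2 M + z$3 *s column 3 M = 0"
      by (simp add: matrix_vector_columns)
    have e': "z$1 * (column 1 M)$i + z$2 * (column 2 M)$i + z$3 * (column 3 M)$i = 0" for i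
      using arg_cong[OF e, of "\<lambda>x. x $ i"] by simp
    have z3: "z$3 = 0"
    proof (rule ccontr)
      assume n: "z$3 \<noteq> 0"
      have "column 3 M $ i = (- z$1 / z$3) * column 1 M $ i + (- z$2 / z$3) * column 2 M $ i" for i
        using e'[of i] n by (simp add: field_simps eq_neg_iff_add_eq_0)
      then have "column 3 M = (- z$1 / z$3) *s column 1 M + (- z$2 / z$3) *s column 2 M"
        by (simp add: vec_eq_iff)
      then show False using c span_pair_iff by blast
    qed
    have z2: "z$2 = 0"
    proof (rule ccontr)
      assume n: "z$2 \<noteq> 0"
      have "column 2 M $ i = (- z$1 / z$2) * column 1 M $ i" for i
        using e'[of i] n z3 by (simp add: field_simps eq_neg_iff_add_eq_0)
      then have "column 2 M = (- z$1 / z$2) *s column 1 M"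
        by (simp add: vec_eq_iff)
      then have "column 2 M \<in> vec.span {column 1 M}"
        unfolding vec.span_singleton by blast
      then show False using c by blast
    qed
    have "z$1 = 0" using e z2 z3 c by simp
    then show False using z(1) z2 z3 by (simp add: vec_eq_iff forall_3)
  qed
qed

text \<open>The columns are chosen one after another outside the span of the previous ones.\<close>

lemma card_GL3:
  "card {M :: 'a::finite_field^3^3. det M \<noteq> 0}
    = (CARD('a)^3 - 1) * ((CARD('a)^3 - CARD('a)) * (CARD('a)^3 - CARD('a)^2))"
proof -
  define T where "T = (SIGMA x : UNIV - {0}. SIGMA y : UNIV - vec.span {x}. UNIV - vec.span {y, x :: 'a^3})"
  define cols where "cols M = (column 1 M, column 2 M, column 3 M)" for M :: "'a^3^3"
  define mk where "mk = (\<lambda>(x, y, z). transpose (vector [x, y, z]) :: 'a^3^3)"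
  have col: "column 1 (mk (x, y, z)) = x" "column 2 (mk (x, y, z)) = y" "column 3 (mk (x, y, z)) = z" for x y z
    by (auto simp: vec_eq_iff forall_3 transpose_def column_def mk_def)
  have mk_cols: "mk (cols M) = M" for M
    by (simp add: vec_eq_iff forall_3 transpose_def column_def mk_def cols_def)
  have T_iff: "(column 1 M, column 2 M, column 3 M) \<in> T \<longleftrightarrow> det M \<noteq> 0" for M
    unfolding T_def det_columns_iff by simp
  have "bij_betw cols {M. det M \<noteq> 0} T"
  proof (rule bij_betw_byWitness[of _ mk])
    show "\<forall>t\<in>T. cols (mk t) = t"
      by (auto simp: col cols_def)
    show "mk ` T \<subseteq> {M. det M \<noteq> 0}"
    proof clarify
      fix x y z assume "(x, y, z) \<in> T" "det (mk (x, y, z)) = 0"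
      then show False using T_iff[of "mk (x, y, z)"] by (simp add: col)
    qed
    show "\<forall>M\<in>{M. det M \<noteq> 0}. mk (cols M) = M"
      by (simp add: mk_cols)
    show "cols ` {M. det M \<noteq> 0} \<subseteq> T"
      by (auto simp: cols_def T_iff)
  qed
  from bij_betw_same_card[OF this] have "card {M :: 'a^3^3. det M \<noteq> 0} = card T" .
  also have "\<dots> = (\<Sum>x\<in>UNIV - {0 :: 'a^3}. card (SIGMA y : UNIV - vec.span {x}. UNIV - vec.span {y, x}))"
    unfolding T_def by (rule card_SigmaI) auto
  also have "\<dots> = (\<Sum>x\<in>UNIV - {0 :: 'a^3}. (CARD('a)^3 - CARD('a)) * (CARD('a)^3 - CARD('a)^2))"
  proof (rule sum.cong[OF refl])
    fix x :: "'a^3" assume "x \<in> UNIV - {0}"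
    then have x: "x \<noteq> 0" by simp
    have "card (SIGMA y : UNIV - vec.span {x}. UNIV - vec.span {y, x}) = (\<Sum>y\<in>UNIV - vec.span {x}. card (UNIV - vec.span {y, x}))"
      by (rule card_SigmaI) auto
    also have "\<dots> = (\<Sum>y\<in>UNIV - vec.span {x}. CARD('a)^3 - CARD('a)^2)"
      using x by (intro sum.cong refl) (simp add: card_Diff_subset card_span_pair)
    also have "\<dots> = (CARD('a)^3 - CARD('a)) * (CARD('a)^3 - CARD('a)^2)"
      using x by (simp add: card_Diff_subset card_span_pair)
    finally show "card (SIGMA y : UNIV - vec.span {x}. UNIV - vec.span {y, x}) = (CARD('a)^3 - CARD('a)) * (CARD('a)^3 - CARD('a)^2)" .
  qed
  also have "\<dots> = (CARD('a)^3 - 1) * ((CARD('a)^3 - CARD('a)) * (CARD('a)^3 - CARD('a)^2))"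
    by (simp add: card_Diff_subset)
  finally show ?thesis .
qed

lemma card_perp:
  fixes y :: "'a::finite_field^3"
  assumes "y \<noteq> 0"
  shows "card {l. scalar_product l y = 0} = CARD('a)^2"
proof -
  have add: "scalar_product (l + m) y = scalar_product l y + scalar_product m y"
    "scalar_product (l - m) y = scalar_product l y - scalar_product m y" for l m
    by (simp_all add: scalar_product_3 algebra_simps)
  have "card (UNIV :: ('a^3) set) = card {l. scalar_product l y = 0} * card ((\<lambda>l. scalar_product l y) ` UNIV)"
  proof (rule card_by_fibres)
    fix x :: "'a^3"
    have "bij_betw (\<lambda>l. l - x) {l \<in> UNIV. scalar_product l y = scalar_product x y} {l. scalar_product l y = 0}"
      by (rule bij_betw_byWitness[of _ "\<lambda>l. l + x"]) (auto simp: add)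
    then show "card {l \<in> UNIV. scalar_product l y = scalar_product x y} = card {l. scalar_product l y = 0}"
      by (rule bij_betw_same_card)
  qed simp
  moreover have "(\<lambda>l. scalar_product l y) ` UNIV = UNIV"
  proof -
    obtain x where x: "scalar_product y x \<noteq> 0" using exists_nonperp[OF assms] by blast
    have "c = scalar_product ((c / scalar_product y x) *s x) y" for c
      using x by (simp add: scalar_product_scale scalar_product_sym[of x])
    then show ?thesis by blast
  qed
  ultimately have "CARD('a) * CARD('a)^2 = CARD('a) * card {l. scalar_product l y = 0}"
    by (simp add: power3_eq_cube power2_eq_square mult_ac)
  moreover have "CARD('a) > 0" using card_finite_field_ge_2[where ?'a = 'a] by linarith
  ultimately show ?thesis by simp
qed

text \<open>Both squares are singular exactly along their line, so the lines agree and the linear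
  forms are proportional.\<close>

lemma lin_mult_square_eq_imp:
  fixes l l' :: "'k::field^3"
  assumes "k *s lin_mult l l = k' *s lin_mult l' l'" "k \<noteq> 0" "k' \<noteq> 0" "l \<noteq> 0" "l' \<noteq> 0"
  shows "\<exists>c. c \<noteq> 0 \<and> l' = c *s l \<and> k = k' * c^2"
proof -
  have s: "scalar_product l z = 0 \<longleftrightarrow> scalar_product l' z = 0" for z
    using assms sing_smult[of k "lin_mult l l" z] sing_smult[of k' "lin_mult l' l'" z]
    by (simp add: sing_lin_mult)
  obtain y y' where y: "y \<noteq> 0" "\<nexists>k. y' = k *s y" "scalar_product l y = 0" "scalar_product l y' = 0"
    using exists_two_perps by metis
  obtain a b where "l = a *s cross y y'" "l' = b *s cross y y'"
    using perp_cross[OF y(1,2)] y s by metis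
  with assms obtain c where c: "c \<noteq> 0" "l' = c *s l"
    by (metis vec.scale_zero_left vec.scale_scale nonzero_divide_eq_eq divide_eq_0_iff)
  have "k *s lin_mult l l = (k' * c^2) *s lin_mult l l"
    using assms(1) unfolding c(2) lin_mult_scale by (simp add: power2_eq_square mult_ac)
  then have "k = k' * c^2"
    using lin_mult_eq_0_imp[of l l] assms(4) by auto
  then show ?thesis using c by blast
qed

text \<open>There are \<open>(q - 1) * (q^2 - 1)\<close> pairs of a factor and a nonzero linear form
  vanishing at \<open>y\<close>. Each product arises from \<open>q - 1\<close> pairs, since
  \<open>k\<close> and \<open>l\<close> may be replaced by \<open>k / c^2\<close> and
  \<open>c *s l\<close>; the zero form accounts for the remaining one.\<close>

lemma card_rep_sing:
  fixes y :: "'a::finite_field^3"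
  assumes y: "y \<noteq> 0"
  shows "card {f. sing f y \<and> rep f} = CARD('a)^2"
proof -
  define L where "L = {l. scalar_product l y = 0} - {0}"
  define F where "F = (\<lambda>(k, l). k *s lin_mult l l :: 'a^6)"
  have q: "CARD('a) \<ge> 2" by (rule card_finite_field_ge_2)
  have cL: "card L = CARD('a)^2 - 1"
    by (simp add: L_def card_Diff_subset card_perp[OF y])
  have "card ((UNIV - {0 :: 'a}) \<times> L) = (CARD('a) - 1) * card (F ` ((UNIV - {0}) \<times> L))"
  proof (rule card_by_fibres)
    fix p assume "p \<in> (UNIV - {0 :: 'a}) \<times> L"
    then obtain k l where p: "p = (k, l)" "k \<noteq> 0" "l \<in> L" "l \<noteq> 0" by (auto simp: L_def)
    have "{p' \<in> (UNIV - {0}) \<times> L. F p' = F p} = (\<lambda>c. (k / c^2, c *s l)) ` (UNIV - {0})"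
    proof (intro equalityI subsetI)
      fix p' assume p': "p' \<in> {p' \<in> (UNIV - {0}) \<times> L. F p' = F p}"
      obtain k' l' where k': "p' = (k', l')" by fastforce
      then have "k' \<noteq> 0" "l' \<noteq> 0" "k *s lin_mult l l = k' *s lin_mult l' l'"
        using p' by (auto simp: F_def p L_def)
      then obtain c where "c \<noteq> 0" "l' = c *s l" "k = k' * c^2"
        using lin_mult_square_eq_imp p by metis
      then show "p' \<in> (\<lambda>c. (k / c^2, c *s l)) ` (UNIV - {0})"
        by (intro image_eqI[of _ _ c]) (auto simp: k')
    next
      fix p' assume "p' \<in> (\<lambda>c. (k / c^2, c *s l)) ` (UNIV - {0})"
      then obtain c where "c \<noteq> 0" "p' = (k / c^2, c *s l)" by auto
      then show "p' \<in> {p' \<in> (UNIV - {0}) \<times> L. F p' = F p}"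
        using p by (auto simp: L_def F_def scalar_product_scale lin_mult_scale power2_eq_square)
    qed
    moreover have "inj_on (\<lambda>c. (k / c^2, c *s l)) (UNIV - {0})"
      using p(4) by (auto simp: inj_on_def)
    ultimately show "card {p' \<in> (UNIV - {0}) \<times> L. F p' = F p} = CARD('a) - 1"
      by (simp add: card_image card_Diff_subset)
  qed simp
  then have "(CARD('a) - 1) * (CARD('a)^2 - 1) = (CARD('a) - 1) * card (F ` ((UNIV - {0}) \<times> L))"
    by (simp add: card_cartesian_product card_Diff_subset cL)
  then have cF: "card (F ` ((UNIV - {0}) \<times> L)) = CARD('a)^2 - 1"
    using q by simp
  have z: "0 \<notin> F ` ((UNIV - {0}) \<times> L)"
    using lin_mult_eq_0_imp by (fastforce simp: F_def L_def)
  have "{f. sing f y \<and> rep f} = insert 0 (F ` ((UNIV - {0}) \<times> L))"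
  proof (intro equalityI subsetI)
    fix f assume f: "f \<in> {f. sing f y \<and> rep f}"
    then obtain k l where kl: "f = k *s lin_mult l l" by (auto simp: rep_def)
    show "f \<in> insert 0 (F ` ((UNIV - {0}) \<times> L))"
    proof (cases "f = 0")
      case False
      then have "k \<noteq> 0" "l \<noteq> 0" using kl by auto
      then have "scalar_product l y = 0" using f kl sing_smult[of k "lin_mult l l" y] by (simp add: sing_lin_mult)
      then have "(k, l) \<in> (UNIV - {0}) \<times> L" "f = F (k, l)"
        using \<open>k \<noteq> 0\<close> \<open>l \<noteq> 0\<close> kl by (auto simp: L_def F_def)
      then show ?thesis by blast
    qed simp
  next
    fix f assume "f \<in> insert 0 (F ` ((UNIV - {0}) \<times> L))"
    then consider "f = 0" | k l where "f = k *s lin_mult l l" "k \<noteq> 0" "l \<noteq> 0" "scalar_product l y = 0"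
      by (auto simp: F_def L_def)
    then show "f \<in> {f. sing f y \<and> rep f}"
    proof cases
      case 1
      have "rep (0 :: 'a^6)" unfolding rep_def by (metis vec.scale_zero_left)
      then show ?thesis using 1 vec.subspace_0[OF subspace_sing] by auto
    next
      case 2
      then show ?thesis by (auto simp: rep_def sing_smult sing_lin_mult)
    qed
  qed
  then have "card {f. sing f y \<and> rep f} = Suc (CARD('a)^2 - 1)"
    using z cF by simp
  then show ?thesis using q by simp
qed

lemma card_nonzero_multiples:
  fixes x :: "'a::finite_field^'n"
  assumes "x \<noteq> 0"
  shows "card ((\<lambda>k. k *s x) ` (UNIV - {0})) = CARD('a) - 1"
proof -
  have "inj_on (\<lambda>k. k *s x) (UNIV - {0})" using assms by (auto simp: inj_on_def)
  then show ?thesis by (simp add: card_image card_Diff_subset)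
qed

lemma sing_multiple_iff: "k \<noteq> 0 \<Longrightarrow> {f. sing f (k *s y)} = {f. sing f (y :: 'k::field^3)}"
proof -
  assume "k \<noteq> 0"
  then have "sing f y" if "sing f (k *s y)" for f
    using sing_scale[OF that, of "inverse k"] by simp
  then show ?thesis using sing_scale by blast
qed

lemma thin_sing_sing:
  fixes y y' :: "'a::finite_field^3"
  assumes "y \<noteq> 0" "y' \<noteq> 0" "subspace_points {f. sing f y} \<noteq> subspace_points {f. sing f y'}"
  shows "thin ({f. sing f y} \<inter> {f. sing f y'})"
proof (rule thin_sing_two_points[OF assms(1)])
  show "\<nexists>k. y' = k *s y"
  proof
    assume "\<exists>k. y' = k *s y"
    then obtain k where "y' = k *s y" by blast
    then show False using assms sing_multiple_iff[of k y] by auto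
  qed
qed

lemma card_planes_N:
  "(CARD('a) - 1) * card {subspace_points {f :: 'a::finite_field^6. sing f y} |y. y \<noteq> 0} = CARD('a)^3 - 1"
proof -
  define F where "F y = subspace_points {f :: 'a^6. sing f y}" for y
  have "card (UNIV - {0 :: 'a^3}) = (CARD('a) - 1) * card (F ` (UNIV - {0}))"
  proof (rule card_by_fibres)
    fix y :: "'a^3" assume "y \<in> UNIV - {0}"
    then have y: "y \<noteq> 0" by simp
    have "{y' \<in> UNIV - {0}. F y' = F y} = (\<lambda>k. k *s y) ` (UNIV - {0})"
    proof (intro equalityI subsetI)
      fix y' assume y': "y' \<in> {y' \<in> UNIV - {0}. F y' = F y}"
      have "\<exists>k. y' = k *s y"
      proof (rule ccontr)
        assume "\<nexists>k. y' = k *s y"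
        then have "F y \<noteq> F y'"
          unfolding F_def by (intro distinct_subspace_points subspace_sing card_sing thin_sing_two_points y)
        then show False using y' by simp
      qed
      then obtain k where "y' = k *s y" by blast
      then show "y' \<in> (\<lambda>k. k *s y) ` (UNIV - {0})" using y' by auto
    qed (use y in \<open>auto simp: F_def sing_multiple_iff\<close>)
    then show "card {y' \<in> UNIV - {0}. F y' = F y} = CARD('a) - 1"
      using card_nonzero_multiples[OF y] by simp
  qed simp
  moreover have "F ` (UNIV - {0}) = {subspace_points {f :: 'a^6. sing f y} |y. y \<noteq> 0}"
    unfolding F_def by blast
  ultimately show ?thesis by (simp add: card_Diff_subset)
qed

context cubic_frame begin

lemma cubic_frame_image:
  assumes "det N \<noteq> 0"
  shows "cubic_frame (ext_mat N *v v)"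
proof
  show "frob_vec (frob_vec (frob_vec (ext_mat N *v v))) = ext_mat N *v v"
    by (simp add: cubic_v)
  have "frame (ext_mat N *v v) = ext_mat N ** frame v"
    by (simp add: vec_eq_iff forall_3 matrix_matrix_mult_def matrix_vector_mult_def sum_3)
  then show "det (frame (ext_mat N *v v)) \<noteq> 0"
    using assms det_frame by (simp add: det_mul det_ext_mat)
qed

lemma image_surj:
  assumes w: "\<And>i. w $ i \<in> cubic"
  obtains N where "ext_mat N *v v = w"
proof -
  obtain r1 where r1: "scalar_product (ext_vec r1) v = w $ 1" using dot_surj[OF w] .
  obtain r2 where r2: "scalar_product (ext_vec r2) v = w $ 2" using dot_surj[OF w] .
  obtain r3 where r3: "scalar_product (ext_vec r3) v = w $ 3" using dot_surj[OF w] .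
  have "ext_mat (vector [r1, r2, r3]) *v v = w"
    using r1 r2 r3 by (simp add: vec_eq_iff forall_3 matrix_vector_mult_def sum_3 scalar_product_3)
  then show thesis by (rule that)
qed

text \<open>All representatives over GF(q^3) of the three vertices, that is, the vectors of frames
  which define the same net of conics as \<open>v\<close>.\<close>

definition companions :: "('a alg_closure^3) set" where
  "companions = (\<lambda>k. k *s v) ` (cubic - {0}) \<union> (\<lambda>k. k *s frob_vec v) ` (cubic - {0})
     \<union> (\<lambda>k. k *s frob_vec (frob_vec v)) ` (cubic - {0})"

lemma card_companions: "card companions = 3 * (CARD('a)^3 - 1)"
proof -
  have c: "card ((\<lambda>k. k *s w) ` (cubic - {0})) = CARD('a)^3 - 1" if "w \<noteq> 0" for w :: "'a alg_closure^3"
  proof -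
    have "inj_on (\<lambda>k. k *s w) (cubic - {0})" using that by (auto simp: inj_on_def)
    then have "card ((\<lambda>k. k *s w) ` (cubic - {0})) = card (cubic - {0 :: 'a alg_closure})" by (rule card_image)
    also have "\<dots> = card (cubic :: 'a alg_closure set) - card {0 :: 'a alg_closure}"
      by (rule card_Diff_subset) (auto simp: cubic_intros)
    finally show ?thesis by (simp add: card_cubic)
  qed
  have d: "(\<lambda>k. k *s w) ` (cubic - {0}) \<inter> (\<lambda>k. k *s u) ` (cubic - {0}) = {}"
    if "\<nexists>k. u = k *s w" for w u :: "'a alg_closure^3"
  proof (rule ccontr)
    assume "\<not> ?thesis"
    then obtain k l where "k \<noteq> 0" "l \<noteq> 0" "k *s w = l *s u" by auto
    then have "inverse l *s (k *s w) = inverse l *s (l *s u)" by simp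
    then have "u = (inverse l * k) *s w" using \<open>l \<noteq> 0\<close> by simp
    then show False using that by blast
  qed
  have fin: "finite ((\<lambda>k. k *s w) ` (cubic - {0}))" for w :: "'a alg_closure^3"
    using finite_cubic by blast
  show ?thesis
    unfolding companions_def
    using d[OF vertices_distinct(1)] d[OF vertices_distinct(2)] d[OF vertices_distinct(3)] v_nonzero
    by (simp add: card_Un_disjoint fin c Int_Un_distrib2 finite_Un)
qed

lemma through_companion: "w \<in> companions \<Longrightarrow> through w = through v"
  unfolding companions_def by (elim UnE imageE) (simp_all add: through_scale through_frob)

lemma companion_nth_cubic: "w \<in> companions \<Longrightarrow> w $ i \<in> cubic"
  unfolding companions_def by (auto simp: cubic_intros v_nth_cubic)

lemma companion_frame:
  assumes "w \<in> companions"
  shows "det (frame w) \<noteq> 0"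
proof -
  have sc: "det (frame (k *s u)) = k * fr k * fr (fr k) * det (frame u)" for k and u :: "'a alg_closure^3"
    by (simp add: det_3 algebra_simps)
  have cyc: "det (frame (frob_vec v)) = det (frame v)"
    using v_nth_cubic by (simp add: det_3 cubicD algebra_simps)
  have cyc2: "det (frame (frob_vec (frob_vec v))) = det (frame v)"
    using v_nth_cubic by (simp add: det_3 cubicD algebra_simps)
  show ?thesis
    using assms det_frame unfolding companions_def by (auto simp: sc cyc cyc2)
qed

lemma multiple_of_cubic:
  assumes "w = k *s u" "\<And>i. w $ i \<in> cubic" "\<And>i. u $ i \<in> cubic" "u \<noteq> (0 :: 'a alg_closure^3)"
  shows "k \<in> cubic"
proof -
  obtain i where "u $ i \<noteq> 0" using assms(4) by (auto simp: vec_eq_iff)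
  then have "k = w $ i / u $ i" using assms(1) by simp
  then show ?thesis by (metis cubic_intros(4) assms(2,3))
qed

lemma thin_through_or_companion:
  assumes w: "cubic_frame w"
  shows "w \<in> companions \<or> thin (through v \<inter> through w)"
proof (rule disjCI)
  interpret w: cubic_frame w by fact
  assume n: "\<not> thin (through v \<inter> through w)"
  have mult: "w \<in> (\<lambda>k. k *s u) ` (cubic - {0})" if ex: "\<exists>k. w = k *s u" and u: "\<And>i. u $ i \<in> cubic" "u \<noteq> 0" for u
  proof -
    obtain k where k: "w = k *s u" using ex by blast
    have "k \<noteq> 0" using k w.v_nonzero by auto
    moreover have "k \<in> cubic"
      using multiple_of_cubic[OF k w.v_nth_cubic u] .
    ultimately show ?thesis using k by blast
  qed
  have "(\<exists>k. w = k *s v) \<or> (\<exists>k. w = k *s frob_vec v) \<or> (\<exists>k. w = k *s frob_vec (frob_vec v))"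
    using n thin_through_through[OF w] by blast
  then show "w \<in> companions"
    unfolding companions_def using mult[of v] mult[of "frob_vec v"] mult[of "frob_vec (frob_vec v)"]
    by (auto simp: v_nth_cubic v_nonzero cubic_intros)
qed

lemma card_matrices_companions: "card {M. ext_mat M *v v \<in> cubic_frame.companions (ext_mat N *v v)} = 3 * (CARD('a)^3 - 1)"
  if N: "det N \<noteq> 0"
proof -
  interpret w: cubic_frame "ext_mat N *v v" by (rule cubic_frame_image[OF N])
  have "bij_betw (\<lambda>M. ext_mat M *v v) {M. ext_mat M *v v \<in> w.companions} w.companions"
  proof (rule bij_betw_imageI)
    show "inj_on (\<lambda>M. ext_mat M *v v) {M. ext_mat M *v v \<in> w.companions}"
      by (rule inj_onI) (rule matrix_eqI)
    show "(\<lambda>M. ext_mat M *v v) ` {M. ext_mat M *v v \<in> w.companions} = w.companions"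
    proof (intro equalityI subsetI)
      fix u assume u: "u \<in> w.companions"
      obtain M where "ext_mat M *v v = u"
        using image_surj[OF w.companion_nth_cubic[OF u]] .
      then show "u \<in> (\<lambda>M. ext_mat M *v v) ` {M. ext_mat M *v v \<in> w.companions}"
        using u by blast
    qed auto
  qed
  from bij_betw_same_card[OF this] show ?thesis by (simp add: w.card_companions)
qed

text \<open>Two matrices give the same plane exactly if they send \<open>v\<close> to companions of
  each other. The fibre size is \<open>q - 1\<close> scalars times a stabilizer of order
  \<open>3 (q^2 + q + 1)\<close> in PGL(3,q).\<close>

lemma card_planes_C:
  "3 * (CARD('a)^3 - 1) * card {subspace_points (through (ext_mat N *v v)) |N. det N \<noteq> 0}
    = (CARD('a)^3 - 1) * ((CARD('a)^3 - CARD('a)) * (CARD('a)^3 - CARD('a)^2))"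
proof -
  define F where "F N = subspace_points (through (ext_mat N *v v))" for N
  have "card {N :: 'a^3^3. det N \<noteq> 0} = (3 * (CARD('a)^3 - 1)) * card (F ` {N. det N \<noteq> 0})"
  proof (rule card_by_fibres)
    fix N :: "'a^3^3" assume "N \<in> {N. det N \<noteq> 0}"
    then have N: "det N \<noteq> 0" by simp
    interpret w: cubic_frame "ext_mat N *v v" by (rule cubic_frame_image[OF N])
    have "{M \<in> {N. det N \<noteq> 0}. F M = F N} = {M. ext_mat M *v v \<in> w.companions}"
    proof (intro equalityI subsetI)
      fix M assume M: "M \<in> {M \<in> {N. det N \<noteq> 0}. F M = F N}"
      then have "\<not> thin (through (ext_mat N *v v) \<inter> through (ext_mat M *v v))"
        using distinct_subspace_points[OF subspace_through subspace_through w.card_through, of "ext_mat M *v v"]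
        by (auto simp: F_def)
      then show "M \<in> {M. ext_mat M *v v \<in> w.companions}"
        using w.thin_through_or_companion cubic_frame_image M by blast
    next
      fix M assume "M \<in> {M. ext_mat M *v v \<in> w.companions}"
      then have M: "ext_mat M *v v \<in> w.companions" by simp
      have "frame (ext_mat M *v v) = ext_mat M ** frame v"
        by (simp add: vec_eq_iff forall_3 matrix_matrix_mult_def matrix_vector_mult_def sum_3)
      then have "det M \<noteq> 0"
        using w.companion_frame[OF M] by (auto simp: det_mul det_ext_mat)
      then show "M \<in> {M \<in> {N. det N \<noteq> 0}. F M = F N}"
        using w.through_companion[OF M] by (simp add: F_def)
    qed
    then show "card {M \<in> {N. det N \<noteq> 0}. F M = F N} = 3 * (CARD('a)^3 - 1)"
      using card_matrices_companions[OF N] by simp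
  qed simp
  moreover have "F ` {N. det N \<noteq> 0} = {subspace_points (through (ext_mat N *v v)) |N. det N \<noteq> 0}"
    unfolding F_def by blast
  ultimately show ?thesis by (simp only: card_GL3)
qed

text \<open>From the \<open>q^3\<close> forms singular at \<open>pt 1\<close> remove the
  \<open>q^2\<close> multiples of squares, the zero form among them.\<close>

lemma card_base: "card {g. base g} = CARD('a)^3 - CARD('a)^2"
proof -
  have p: "pt 1 \<noteq> 0" by (simp add: pt_eq_0_iff cubic_intros)
  have "{g. base g} = {g. sing g (pt 1)} - {g. sing g (pt 1) \<and> rep g}"
    unfolding base_def by (auto simp: rep_def)
  then have "card {g. base g} = card {g. sing g (pt 1)} - card {g. sing g (pt 1) \<and> rep g}"
    by (simp only:) (rule card_Diff_subset, auto)
  then show ?thesis by (simp add: card_sing[OF p] card_rep_sing[OF p])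
qed

lemma bplane_slopes_eq:
  assumes "base g" "base g'" "c \<noteq> 0" "c' \<noteq> 0" "slopeA g c = slopeA g' c'" "slopeB g c = slopeB g' c'"
  shows "bplane g c = bplane g' c'"
  using bplane_iff[OF assms(1,3)] bplane_iff[OF assms(2,4)] assms(5,6) by auto

lemma base_smult: "k \<noteq> 0 \<Longrightarrow> base g \<Longrightarrow> base (k *s g)"
proof -
  assume k: "k \<noteq> 0" and g: "base g"
  have "rep g" if r: "rep (k *s g)"
  proof -
    obtain a l where "k *s g = a *s lin_mult l l" using r by (auto simp: rep_def)
    then have "inverse k *s (k *s g) = inverse k *s (a *s lin_mult l l)" by simp
    then have "g = (inverse k * a) *s lin_mult l l" using k by simp
    then show ?thesis unfolding rep_def by blast
  qed
  then show ?thesis using k g by (auto simp: base_def sing_smult)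
qed

text \<open>By \<open>slopes_inj\<close> a plane determines \<open>g\<close> and \<open>c\<close> up
  to independent factors in GF(q).\<close>

lemma card_planes_ei:
  "(CARD('a) - 1)^2 * card {subspace_points (bplane g c) |g c. base g \<and> c \<in> cubic \<and> c \<noteq> 0}
    = (CARD('a)^3 - CARD('a)^2) * (CARD('a)^3 - 1)"
proof -
  define F where "F = (\<lambda>(g, c). subspace_points (bplane g c))"
  define A where "A = {g. base g} \<times> (cubic - {0 :: 'a alg_closure})"
  have "card A = (CARD('a) - 1)^2 * card (F ` A)"
  proof (rule card_by_fibres)
    show "finite A" unfolding A_def using finite_cubic by (intro finite_cartesian_product) auto
    fix p assume "p \<in> A"
    then obtain g c where p: "p = (g, c)" "base g" "c \<in> cubic" "c \<noteq> 0" by (auto simp: A_def)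
    have g0: "g \<noteq> 0" using p by (simp add: base_def)
    have "{p' \<in> A. F p' = F p} = (\<lambda>(k, l). (k *s g, to_ac l * c)) ` ((UNIV - {0}) \<times> (UNIV - {0}))"
    proof (intro equalityI subsetI)
      fix p' assume p': "p' \<in> {p' \<in> A. F p' = F p}"
      then obtain g' c' where p'': "p' = (g', c')" "base g'" "c' \<in> cubic" "c' \<noteq> 0" by (auto simp: A_def)
      have "\<not> thin (bplane g c \<inter> bplane g' c')"
        using distinct_subspace_points[OF subspace_bplane subspace_bplane card_bplane[OF p(2-4)], of g' c'] p' p p''
        by (auto simp: F_def)
      then have "slopeA g c = slopeA g' c'" "slopeB g c = slopeB g' c'"
        using thin_bplane_bplane p p'' by blast+
      then obtain k l where "g' = k *s g" "c' = to_ac l * c"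
        using slopes_inj p p'' by metis
      moreover have "k \<noteq> 0" "l \<noteq> 0" using calculation p'' by (auto simp: base_def)
      ultimately show "p' \<in> (\<lambda>(k, l). (k *s g, to_ac l * c)) ` ((UNIV - {0}) \<times> (UNIV - {0}))"
        by (auto simp: p'')
    next
      fix p' assume "p' \<in> (\<lambda>(k, l). (k *s g, to_ac l * c)) ` ((UNIV - {0}) \<times> (UNIV - {0}))"
      then obtain k l where kl: "k \<noteq> 0" "l \<noteq> 0" "p' = (k *s g, to_ac l * c)" by auto
      have b: "base (k *s g)" using base_smult kl p by blast
      have "bplane (k *s g) (to_ac l * c) = bplane g c"
        by (rule bplane_slopes_eq) (use b p kl in \<open>simp_all add: slopeA_def slopeB_def c0_linear c1_linear\<close>)
      then show "p' \<in> {p' \<in> A. F p' = F p}"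
        using kl p b by (auto simp: A_def F_def cubic_intros)
    qed
    moreover have "inj_on (\<lambda>(k, l). (k *s g, to_ac l * c)) ((UNIV - {0}) \<times> (UNIV - {0}))"
      using g0 p by (auto simp: inj_on_def)
    ultimately show "card {p' \<in> A. F p' = F p} = (CARD('a) - 1)^2"
      by (simp add: card_image card_cartesian_product card_Diff_subset power2_eq_square)
  qed
  moreover have "card A = (CARD('a)^3 - CARD('a)^2) * (CARD('a)^3 - 1)"
  proof -
    have "card (cubic - {0 :: 'a alg_closure}) = card (cubic :: 'a alg_closure set) - card {0 :: 'a alg_closure}"
      by (rule card_Diff_subset) (auto simp: cubic_intros)
    then show ?thesis by (simp add: A_def card_cartesian_product card_base card_cubic)
  qed
  moreover have "F ` A = {subspace_points (bplane g c) |g c. base g \<and> c \<in> cubic \<and> c \<noteq> 0}"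
    unfolding F_def A_def by auto
  ultimately show ?thesis by simp
qed

end

theorem theorem7p3:
  fixes S :: "('a::finite_field ^ 3 ^ 3) set set" and q :: nat
    and \<P> :: "('a ^ 6) set set set"
  assumes q: "q = CARD('a)"
    and S: "singer_subgroup S"
    and \<P>: "\<P> = planes_C S \<union> planes_i S \<union> planes_e S \<union> planes_N"
  shows "(\<forall>\<pi>\<in>\<P>. is_plane \<pi>) \<and>
    real (card \<P>) = real q ^ 3 * (real q ^ 2 - 1) * (real q - 1) / 3
      + (real q ^ 2 + 1) * (real q ^ 2 + real q + 1) \<and>
    (\<forall>\<pi>\<in>\<P>. \<forall>\<sigma>\<in>\<P>. \<pi> \<noteq> \<sigma> \<longrightarrow> card (\<pi> \<inter> \<sigma>) \<le> 1)"
proof -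
  obtain v where "singer v S" using singer_subgroup_imp_singer[OF S] .
  then interpret singer v S .
  define FC where "FC = {subspace_points (through (ext_mat N *v v)) |N. det N \<noteq> 0}"
  define FP where "FP = {subspace_points (bplane g c) |g c. base g \<and> c \<in> cubic \<and> c \<noteq> 0}"
  define FN where "FN = {subspace_points {f :: 'a^6. sing f y} |y. y \<noteq> 0}"
  have P: "\<P> = FC \<union> FP \<union> FN"
    unfolding \<P> FC_def FP_def FN_def planes_C_eq[symmetric] planes_ei_eq[symmetric] planes_N_eq[symmetric] by blast

  define \<U> where "\<U> = {through (ext_mat N *v v) |N. det N \<noteq> 0} \<union> {bplane g c |g c. base g \<and> c \<in> cubic \<and> c \<noteq> 0}
      \<union> {{f :: 'a^6. sing f y} |y. y \<noteq> 0}"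
  have PU: "\<P> = subspace_points ` \<U>"
  proof -
    have "FC = subspace_points ` {through (ext_mat N *v v) |N. det N \<noteq> 0}"
      unfolding FC_def by blast
    moreover have "FP = subspace_points ` {bplane g c |g c. base g \<and> c \<in> cubic \<and> c \<noteq> 0}"
      unfolding FP_def by blast
    moreover have "FN = subspace_points ` {{f :: 'a^6. sing f y} |y. y \<noteq> 0}"
      unfolding FN_def by blast
    ultimately show ?thesis by (simp only: P \<U>_def image_Un)
  qed
  have U: "vec.subspace U \<and> card U = CARD('a)^3" if "U \<in> \<U>" for U
    using that unfolding \<U>_def
    by (auto simp: subspace_through subspace_bplane subspace_sing card_bplane card_sing
        cubic_frame.card_through[OF cubic_frame_image])

  have CP: "thin (through (ext_mat N *v v) \<inter> bplane g c)" if "det N \<noteq> 0" "base g" "c \<in> cubic" "c \<noteq> 0" for N g c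
    using thin_through_bplane cubic_frame_image that by blast
  \<comment> \<open>The intersection is zero: the discriminant is nonzero on nonzero forms of the
    net but vanishes on singular forms.\<close>
  have CN: "thin (through (ext_mat N *v v) \<inter> {f. sing f y})" if "det N \<noteq> 0" "y \<noteq> 0" for N y
    using cubic_frame.through_disc[OF cubic_frame_image[OF that(1)]] disc_sing_eq_0[OF _ that(2)]
    unfolding thin_def by blast
  have PN: "thin (bplane g c \<inter> {f. sing f y})" if "base g" "c \<in> cubic" "c \<noteq> 0" "y \<noteq> 0" for g c y
  proof -
    obtain s where s: "s \<in> cubic" "y = pt s" by (rule pt_surj)
    then have "s \<noteq> 0" using that by auto
    then show ?thesis using thin_bplane_sing that s by blast
  qed
  have CC: "thin (through (ext_mat N *v v) \<inter> through (ext_mat M *v v))"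
    if "det N \<noteq> 0" "det M \<noteq> 0" "through (ext_mat N *v v) \<noteq> through (ext_mat M *v v)" for N M
    using cubic_frame.thin_through_or_companion[OF cubic_frame_image[OF that(1)] cubic_frame_image[OF that(2)]]
      cubic_frame.through_companion[OF cubic_frame_image[OF that(1)]] that(3) by metis
  have PP: "thin (bplane g c \<inter> bplane g' c')"
    if "base g" "c \<noteq> 0" "base g'" "c' \<noteq> 0" "bplane g c \<noteq> bplane g' c'" for g c g' c'
    using thin_bplane_bplane bplane_slopes_eq that by metis
  have NN: "thin ({f. sing f y} \<inter> {f. sing f y'})" if "y \<noteq> 0" "y' \<noteq> 0" "{f. sing f y} \<noteq> {f. sing f y'}" for y y' :: "'a^3"
    using thin_sing_sing[OF that(1,2)] subspace_points_eq_imp[OF subspace_sing subspace_sing] that(3) by blast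
  have cases: R if a: "U \<in> \<U>" and b: "\<And>N. U = through (ext_mat N *v v) \<Longrightarrow> det N \<noteq> 0 \<Longrightarrow> R"
      and c: "\<And>g c. U = bplane g c \<Longrightarrow> base g \<Longrightarrow> c \<in> cubic \<Longrightarrow> c \<noteq> 0 \<Longrightarrow> R"
      and d: "\<And>y. U = {f. sing f y} \<Longrightarrow> y \<noteq> 0 \<Longrightarrow> R" for U R
  proof -
    have "(\<exists>N. U = through (ext_mat N *v v) \<and> det N \<noteq> 0) \<or> (\<exists>g c. U = bplane g c \<and> base g \<and> c \<in> cubic \<and> c \<noteq> 0)
        \<or> (\<exists>y. U = {f. sing f y} \<and> y \<noteq> 0)"
      using a unfolding \<U>_def by (simp only: Un_iff mem_Collect_eq disj_assoc)
    then show R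
      using b c d by metis
  qed
  have thin: "thin (U \<inter> V)" if "U \<in> \<U>" "V \<in> \<U>" "U \<noteq> V" for U V
    using that(1)
  proof (rule cases)
    fix N assume N: "U = through (ext_mat N *v v)" "det N \<noteq> 0"
    show ?thesis
      using that(2)
    proof (rule cases)
      fix M assume "V = through (ext_mat M *v v)" "det M \<noteq> 0"
      then show ?thesis using CC[OF N(2)] N(1) that(3) by simp
    next
      fix g c assume "V = bplane g c" "base g" "c \<in> cubic" "c \<noteq> 0"
      then show ?thesis using CP[OF N(2)] N(1) by simp
    next
      fix y assume "V = {f. sing f y}" "y \<noteq> 0"
      then show ?thesis using CN[OF N(2)] N(1) by blast
    qed
  next
    fix g c assume g: "U = bplane g c" "base g" "c \<in> cubic" "c \<noteq> 0"
    show ?thesis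
      using that(2)
    proof (rule cases)
      fix M assume "V = through (ext_mat M *v v)" "det M \<noteq> 0"
      then show ?thesis using CP[OF _ g(2-4)] g(1) by (simp add: Int_commute)
    next
      fix g' c' assume "V = bplane g' c'" "base g'" "c' \<in> cubic" "c' \<noteq> 0"
      then show ?thesis using PP[OF g(2,4)] g(1) that(3) by simp
    next
      fix y assume "V = {f. sing f y}" "y \<noteq> 0"
      then show ?thesis using PN[OF g(2-4)] g(1) by blast
    qed
  next
    fix y assume y: "U = {f. sing f y}" "y \<noteq> 0"
    show ?thesis
      using that(2)
    proof (rule cases)
      fix M assume M: "V = through (ext_mat M *v v)" "det M \<noteq> 0"
      show ?thesis unfolding M(1) y(1) by (subst Int_commute) (rule CN[OF M(2) y(2)])
    next
      fix g c assume g: "V = bplane g c" "base g" "c \<in> cubic" "c \<noteq> 0"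
      show ?thesis unfolding g(1) y(1) by (subst Int_commute) (rule PN[OF g(2-4) y(2)])
    next
      fix y' assume y': "V = {f. sing f y'}" "y' \<noteq> 0"
      have "{f. sing f y} \<noteq> {f. sing f y'}" using that(3) unfolding y(1) y'(1) .
      then show ?thesis unfolding y(1) y'(1) by (rule NN[OF y(2) y'(2)])
    qed
  qed

  have planes: "\<forall>\<pi>\<in>\<P>. is_plane \<pi>"
    unfolding PU using U is_plane_subspace_points by blast
  have inter: "\<forall>\<pi>\<in>\<P>. \<forall>\<sigma>\<in>\<P>. \<pi> \<noteq> \<sigma> \<longrightarrow> card (\<pi> \<inter> \<sigma>) \<le> 1"
    unfolding PU using thin thin_imp_card_le_1 by blast

  have ne: "subspace_points U \<noteq> subspace_points V" if "vec.subspace U" "vec.subspace V" "card U = CARD('a)^3" "thin (U \<inter> V)"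
    for U V :: "('a^6) set"
    using distinct_subspace_points that by blast
  \<comment> \<open>The three families are disjoint since a thin intersection cannot be a plane, so
    their sizes add up.\<close>
  have "FC \<inter> FP = {}"
    unfolding FC_def FP_def
    using ne[OF subspace_through subspace_bplane cubic_frame.card_through[OF cubic_frame_image] CP] by blast
  moreover have "FC \<inter> FN = {}"
    unfolding FC_def FN_def
    using ne[OF subspace_through subspace_sing cubic_frame.card_through[OF cubic_frame_image] CN] by blast
  moreover have "FP \<inter> FN = {}"
    unfolding FP_def FN_def
    using ne[OF subspace_bplane subspace_sing card_bplane PN] by blast
  ultimately have card: "card \<P> = card FC + card FP + card FN"
    unfolding P by (simp add: card_Un_disjoint Int_Un_distrib2)

  have q2: "q \<ge> 2" using card_finite_field_ge_2 q by simp
  define Q where "Q = real q"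
  have Q: "Q \<ge> 2" using q2 by (simp add: Q_def)
  have le: "1 \<le> q^3" "q \<le> q^3" "q^2 \<le> q^3"
    using q2 by (simp_all add: self_le_power power_increasing)
  have q3: "real (q^3 - 1) = Q^3 - 1" "real (q^3 - q) = Q^3 - Q" "real (q^3 - q^2) = Q^3 - Q^2" "real (q - 1) = Q - 1"
    using le q2 by (simp_all add: of_nat_diff Q_def)
  have "(Q^3 - 1) * (3 * real (card FC)) = (Q^3 - 1) * ((Q^3 - Q) * (Q^3 - Q^2))"
    using arg_cong[OF card_planes_C, of real] unfolding FC_def[symmetric] q[symmetric] of_nat_mult q3
    by (simp only: mult_ac of_nat_numeral)
  moreover have Q31: "Q^3 - 1 \<noteq> 0"
  proof -
    have "Q^3 \<ge> 2^3" using Q by (intro power_mono) auto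
    then show ?thesis by simp
  qed
  ultimately have "3 * real (card FC) = (Q^3 - Q) * (Q^3 - Q^2)"
    by (metis mult_left_cancel)
  then have C: "real (card FC) = Q^3 * (Q^2 - 1) * (Q - 1) / 3"
    by (simp add: power2_eq_square power3_eq_cube algebra_simps)
  have "(Q - 1)^2 * real (card FP) = (Q^3 - Q^2) * (Q^3 - 1)"
    using arg_cong[OF card_planes_ei, of real] unfolding FP_def[symmetric] q[symmetric] of_nat_mult of_nat_power q3 by simp
  also have "\<dots> = (Q - 1)^2 * (Q^2 * (Q^2 + Q + 1))"
    by (simp add: power2_eq_square power3_eq_cube algebra_simps)
  finally have PC: "real (card FP) = Q^2 * (Q^2 + Q + 1)" using Q by simp
  have "(Q - 1) * real (card FN) = Q^3 - 1"
    using arg_cong[OF card_planes_N[where ?'a = 'a], of real] unfolding FN_def[symmetric] q[symmetric] of_nat_mult q3 by simp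
  also have "\<dots> = (Q - 1) * (Q^2 + Q + 1)"
    by (simp add: power2_eq_square power3_eq_cube algebra_simps)
  finally have N: "real (card FN) = Q^2 + Q + 1" using Q by simp
  \<comment> \<open>The joint contribution of \<open>\<Pi>\<^sub>e\<close> and
    \<open>\<Pi>\<^sub>i\<close> is \<open>q^2\<close> times \<open>q^2 + q + 1\<close>, and
    \<open>\<N>\<close> adds one more such term, which explains the factor
    \<open>q^2 + 1\<close>.\<close>
  have "real (card \<P>) = Q^3 * (Q^2 - 1) * (Q - 1) / 3 + (Q^2 + 1) * (Q^2 + Q + 1)"
    unfolding card of_nat_add C PC N by (simp add: algebra_simps)
  then show ?thesis
    using planes inter unfolding Q_def by blast
qed

end
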